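(* The Directed Steiner Tree problem, parameterized by $k$, is W[2]-hard on 2-degenerated directed graphs.
   Context: Directed Steiner Tree (DST): the input is a directed graph $D=(V,A)$, a root $r\in V$, a set $T\subseteq V\setminus\{r\}$ of terminals and an integer $k$; the question is whether there is a set $S\subseteq V\setminus(T\cup\{r\})$ with $|S|\le k$ such that $D[S\cup T\cup\{r\}]$ contains a directed path from $r$ to every $t\in T$. The degeneracy of an undirected graph is the least $d$ such that every subgraph has a vertex of degree at most $d$; the degeneracy of a digraph is that of its underlying undirected graph. *)

theory Defs
  imports
    "HOL-Library.Log_Nat"
    "Graph_Theory.Digraph_Component"
begin

section \<open>Machine model\<close>

text \<open>
  Deterministic WHILE programs over registers holding natural numbers, with the logarithmic cost
  measure: evaluating an expression costs one step plus the binary length of the value, for every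
  subexpression. Since every arithmetic operation is charged for the length of its operands and of
  its result, a program and a Turing machine simulate each other with polynomial overhead (a tape
  is a number, its cells are reached by multiplication and division). Subtraction is truncated,
  and \<open>m div 0 = 0\<close>.
\<close>

datatype aexp =
    Const nat
  | Reg nat
  | Plus aexp aexp
  | Minus aexp aexp
  | Times aexp aexp
  | Div aexp aexp

type_synonym state = "nat \<Rightarrow> nat"

primrec aval :: "aexp \<Rightarrow> state \<Rightarrow> nat" where
  "aval (Const n) s = n"
| "aval (Reg i) s = s i"
| "aval (Plus a b) s = aval a s + aval b s"
| "aval (Minus a b) s = aval a s - aval b s"
| "aval (Times a b) s = aval a s * aval b s"
| "aval (Div a b) s = aval a s div aval b s"

definition val_cost :: "nat \<Rightarrow> nat" where
  "val_cost v = 1 + floorlog 2 v"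

primrec acost :: "aexp \<Rightarrow> state \<Rightarrow> nat" where
  "acost (Const n) s = val_cost n"
| "acost (Reg i) s = val_cost (s i)"
| "acost (Plus a b) s = acost a s + acost b s + val_cost (aval (Plus a b) s)"
| "acost (Minus a b) s = acost a s + acost b s + val_cost (aval (Minus a b) s)"
| "acost (Times a b) s = acost a s + acost b s + val_cost (aval (Times a b) s)"
| "acost (Div a b) s = acost a s + acost b s + val_cost (aval (Div a b) s)"

datatype com =
    Assign nat aexp
  | Seq com com
  | Cond aexp com com
  | While aexp com

text \<open>\<open>exec c s t s'\<close>: started in \<open>s\<close>, the program \<open>c\<close> halts in \<open>s'\<close> at total cost \<open>t\<close>.
  A guard holds iff its value is nonzero.\<close>

inductive exec :: "com \<Rightarrow> state \<Rightarrow> nat \<Rightarrow> state \<Rightarrow> bool" where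
  Assign: "exec (Assign i a) s (acost a s) (s(i := aval a s))"
| Seq: "exec c1 s t1 s' \<Longrightarrow> exec c2 s' t2 s'' \<Longrightarrow> exec (Seq c1 c2) s (t1 + t2) s''"
| CondTrue: "aval b s \<noteq> 0 \<Longrightarrow> exec c1 s t s' \<Longrightarrow> exec (Cond b c1 c2) s (acost b s + t) s'"
| CondFalse: "aval b s = 0 \<Longrightarrow> exec c2 s t s' \<Longrightarrow> exec (Cond b c1 c2) s (acost b s + t) s'"
| WhileFalse: "aval b s = 0 \<Longrightarrow> exec (While b c) s (acost b s) s"
| WhileTrue: "aval b s \<noteq> 0 \<Longrightarrow> exec c s t1 s' \<Longrightarrow> exec (While b c) s' t2 s'' \<Longrightarrow>
    exec (While b c) s (acost b s + t1 + t2) s''"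

definition computable :: "(nat \<Rightarrow> nat) \<Rightarrow> bool" where
  "computable f \<longleftrightarrow>
     (\<exists>c. \<forall>n. \<exists>t s'. exec c ((\<lambda>_. 0)(0 := n)) t s' \<and> s' 0 = f n)"

section \<open>Parameterized problems and fpt-reductions\<close>

type_synonym param_problem = "(bool list \<times> nat) set"

text \<open>A string is stored in a register as a binary numeral, its first bit being the least
  significant one; the additional leading one marks the end of the string.\<close>

definition string_num :: "bool list \<Rightarrow> nat" where
  "string_num x = horner_sum of_bool 2 (x @ [True])"

definition fpt_time_computable :: "(bool list \<times> nat \<Rightarrow> bool list \<times> nat) \<Rightarrow> bool" where
  "fpt_time_computable R \<longleftrightarrow>
     (\<exists>c f p. computable f \<and>
       (\<forall>x k. \<exists>t s'. exec c ((\<lambda>_. 0)(0 := string_num x, 1 := k)) t s' \<and>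
          s' 0 = string_num (fst (R (x, k))) \<and> s' 1 = snd (R (x, k)) \<and>
          t \<le> f k * (length x + 1) ^ p))"

definition fpt_reduction ::
  "(bool list \<times> nat \<Rightarrow> bool list \<times> nat) \<Rightarrow> param_problem \<Rightarrow> param_problem \<Rightarrow> bool" where
  "fpt_reduction R L L' \<longleftrightarrow>
     (\<forall>I. I \<in> L \<longleftrightarrow> R I \<in> L') \<and>
     (\<exists>g. computable g \<and> (\<forall>x k. snd (R (x, k)) \<le> g k)) \<and>
     fpt_time_computable R"

section \<open>The W-hierarchy\<close>

text \<open>
  W[t] is defined as in Flum and Grohe, Parameterized Complexity Theory (Springer 2006): it is the
  closure under fpt-reductions of the weighted definability problems for first-order formulas
  \<open>\<phi>(X)\<close> in \<open>\<Pi>\<^sub>t\<close> with one free relation variable \<open>X\<close>. A vocabulary is given by the list of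
  the arities of its relation symbols; \<open>SetVar\<close> is the atom formed with \<open>X\<close>.
\<close>

datatype fo =
    Eq nat nat
  | Rel nat "nat list"
  | SetVar "nat list"
  | Neg fo
  | Conj fo fo
  | Disj fo fo
  | Ex nat fo
  | All nat fo

primrec fo_wf :: "nat list \<Rightarrow> nat \<Rightarrow> fo \<Rightarrow> bool" where
  "fo_wf ar s (Eq x y) \<longleftrightarrow> True"
| "fo_wf ar s (Rel i xs) \<longleftrightarrow> i < length ar \<and> length xs = ar ! i"
| "fo_wf ar s (SetVar xs) \<longleftrightarrow> length xs = s"
| "fo_wf ar s (Neg \<phi>) \<longleftrightarrow> fo_wf ar s \<phi>"
| "fo_wf ar s (Conj \<phi> \<psi>) \<longleftrightarrow> fo_wf ar s \<phi> \<and> fo_wf ar s \<psi>"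
| "fo_wf ar s (Disj \<phi> \<psi>) \<longleftrightarrow> fo_wf ar s \<phi> \<and> fo_wf ar s \<psi>"
| "fo_wf ar s (Ex x \<phi>) \<longleftrightarrow> fo_wf ar s \<phi>"
| "fo_wf ar s (All x \<phi>) \<longleftrightarrow> fo_wf ar s \<phi>"

primrec fo_free :: "fo \<Rightarrow> nat set" where
  "fo_free (Eq x y) = {x, y}"
| "fo_free (Rel i xs) = set xs"
| "fo_free (SetVar xs) = set xs"
| "fo_free (Neg \<phi>) = fo_free \<phi>"
| "fo_free (Conj \<phi> \<psi>) = fo_free \<phi> \<union> fo_free \<psi>"
| "fo_free (Disj \<phi> \<psi>) = fo_free \<phi> \<union> fo_free \<psi>"
| "fo_free (Ex x \<phi>) = fo_free \<phi> - {x}"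
| "fo_free (All x \<phi>) = fo_free \<phi> - {x}"

primrec qfree :: "fo \<Rightarrow> bool" where
  "qfree (Eq x y) \<longleftrightarrow> True"
| "qfree (Rel i xs) \<longleftrightarrow> True"
| "qfree (SetVar xs) \<longleftrightarrow> True"
| "qfree (Neg \<phi>) \<longleftrightarrow> qfree \<phi>"
| "qfree (Conj \<phi> \<psi>) \<longleftrightarrow> qfree \<phi> \<and> qfree \<psi>"
| "qfree (Disj \<phi> \<psi>) \<longleftrightarrow> qfree \<phi> \<and> qfree \<psi>"
| "qfree (Ex x \<phi>) \<longleftrightarrow> False"
| "qfree (All x \<phi>) \<longleftrightarrow> False"

inductive Sigma_fo :: "nat \<Rightarrow> fo \<Rightarrow> bool" and Pi_fo :: "nat \<Rightarrow> fo \<Rightarrow> bool" where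
  Sigma_0: "qfree \<phi> \<Longrightarrow> Sigma_fo 0 \<phi>"
| Pi_0: "qfree \<phi> \<Longrightarrow> Pi_fo 0 \<phi>"
| Sigma_Suc: "Pi_fo t \<phi> \<Longrightarrow> Sigma_fo (Suc t) \<phi>"
| Pi_Suc: "Sigma_fo t \<phi> \<Longrightarrow> Pi_fo (Suc t) \<phi>"
| Sigma_Ex: "Sigma_fo (Suc t) \<phi> \<Longrightarrow> Sigma_fo (Suc t) (Ex x \<phi>)"
| Pi_All: "Pi_fo (Suc t) \<phi> \<Longrightarrow> Pi_fo (Suc t) (All x \<phi>)"

text \<open>A finite structure has a universe \<open>{..<n}\<close>, \<open>n > 0\<close>, and a list of relations, each of them
  a set of tuples represented as lists.\<close>

definition tuples :: "nat \<Rightarrow> nat \<Rightarrow> nat list set" where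
  "tuples n r = {xs. length xs = r \<and> set xs \<subseteq> {..<n}}"

definition fo_structure :: "nat list \<Rightarrow> nat \<Rightarrow> nat list set list \<Rightarrow> bool" where
  "fo_structure ar n rels \<longleftrightarrow>
     0 < n \<and> length rels = length ar \<and> (\<forall>i<length ar. rels ! i \<subseteq> tuples n (ar ! i))"

primrec fo_sat ::
  "nat \<Rightarrow> nat list set list \<Rightarrow> nat list set \<Rightarrow> (nat \<Rightarrow> nat) \<Rightarrow> fo \<Rightarrow> bool" where
  "fo_sat n rels S e (Eq x y) \<longleftrightarrow> e x = e y"
| "fo_sat n rels S e (Rel i xs) \<longleftrightarrow> map e xs \<in> rels ! i"
| "fo_sat n rels S e (SetVar xs) \<longleftrightarrow> map e xs \<in> S"
| "fo_sat n rels S e (Neg \<phi>) \<longleftrightarrow> \<not> fo_sat n rels S e \<phi>"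
| "fo_sat n rels S e (Conj \<phi> \<psi>) \<longleftrightarrow> fo_sat n rels S e \<phi> \<and> fo_sat n rels S e \<psi>"
| "fo_sat n rels S e (Disj \<phi> \<psi>) \<longleftrightarrow> fo_sat n rels S e \<phi> \<or> fo_sat n rels S e \<psi>"
| "fo_sat n rels S e (Ex x \<phi>) \<longleftrightarrow> (\<exists>a<n. fo_sat n rels S (e(x := a)) \<phi>)"
| "fo_sat n rels S e (All x \<phi>) \<longleftrightarrow> (\<forall>a<n. fo_sat n rels S (e(x := a)) \<phi>)"

text \<open>The universe size in unary, followed by the characteristic strings of the relations.\<close>

definition structure_string :: "nat list \<Rightarrow> nat \<Rightarrow> nat list set list \<Rightarrow> bool list" where
  "structure_string ar n rels =
     replicate n True @ [False] @
     concat (map (\<lambda>i. map (\<lambda>xs. xs \<in> rels ! i) (List.n_lists (ar ! i) [0..<n])) [0..<length ar])"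

text \<open>\<open>WD ar s \<phi>\<close> is only used for sentences \<open>\<phi>\<close>, so the initial assignment is irrelevant.\<close>

definition WD :: "nat list \<Rightarrow> nat \<Rightarrow> fo \<Rightarrow> param_problem" where
  "WD ar s \<phi> =
     {(structure_string ar n rels, k) | n rels k.
        fo_structure ar n rels \<and>
        (\<exists>S \<subseteq> tuples n s. card S = k \<and> fo_sat n rels S (\<lambda>_. 0) \<phi>)}"

definition W :: "nat \<Rightarrow> param_problem set" where
  "W t =
     {L. \<exists>ar s \<phi> R. 0 \<notin> set ar \<and> 0 < s \<and> fo_wf ar s \<phi> \<and> fo_free \<phi> = {} \<and> Pi_fo t \<phi> \<and>
        fpt_reduction R L (WD ar s \<phi>)}"

text \<open>Hardness on a class \<open>C\<close> of instances: the reductions produce only instances from \<open>C\<close>.\<close>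

definition W_hard_on :: "nat \<Rightarrow> param_problem \<Rightarrow> (bool list \<times> nat) set \<Rightarrow> bool" where
  "W_hard_on t L C \<longleftrightarrow> (\<forall>L' \<in> W t. \<exists>R. fpt_reduction R L' L \<and> range R \<subseteq> C)"

section \<open>Degeneracy\<close>

definition underlying_edges :: "'a pair_pre_digraph \<Rightarrow> 'a set set" where
  "underlying_edges D = {{u, v} | u v. (u, v) \<in> parcs D}"

text \<open>Subgraphs are required to have a vertex; the null graph has no vertex of any degree.\<close>

definition degeneracy :: "'a set \<Rightarrow> 'a set set \<Rightarrow> nat" where
  "degeneracy V E =
     (LEAST d. \<forall>W F. W \<subseteq> V \<and> W \<noteq> {} \<and> F \<subseteq> E \<and> \<Union>F \<subseteq> W \<longrightarrow>
        (\<exists>v\<in>W. card {e \<in> F. v \<in> e} \<le> d))"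

definition digraph_degeneracy :: "'a pair_pre_digraph \<Rightarrow> nat" where
  "digraph_degeneracy D = degeneracy (pverts D) (underlying_edges D)"

section \<open>Directed Steiner Tree\<close>

definition dst_solvable :: "'a pair_pre_digraph \<Rightarrow> 'a \<Rightarrow> 'a set \<Rightarrow> nat \<Rightarrow> bool" where
  "dst_solvable D r T k \<longleftrightarrow>
     (\<exists>S \<subseteq> pverts D - (T \<union> {r}). card S \<le> k \<and>
        (\<forall>t\<in>T. \<exists>p. pre_digraph.apath (with_proj D \<restriction> (S \<union> T \<union> {r})) r p t))"

text \<open>Instances have vertex set \<open>{..<n}\<close>; they are encoded by \<open>n\<close> in unary, the adjacency matrix,
  and the characteristic strings of the root and of the terminals.\<close>

definition dst_instance :: "nat \<Rightarrow> nat pair_pre_digraph \<Rightarrow> nat \<Rightarrow> nat set \<Rightarrow> bool" where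
  "dst_instance n D r T \<longleftrightarrow>
     pair_digraph D \<and> pverts D = {..<n} \<and> r \<in> pverts D \<and> T \<subseteq> pverts D - {r}"

definition dst_string :: "nat \<Rightarrow> nat pair_pre_digraph \<Rightarrow> nat \<Rightarrow> nat set \<Rightarrow> bool list" where
  "dst_string n D r T =
     replicate n True @ [False] @
     concat (map (\<lambda>u. map (\<lambda>v. (u, v) \<in> parcs D) [0..<n]) [0..<n]) @
     map (\<lambda>v. v = r) [0..<n] @
     map (\<lambda>v. v \<in> T) [0..<n]"

definition DST :: param_problem where
  "DST = {(dst_string n D r T, k) | n D r T k. dst_instance n D r T \<and> dst_solvable D r T k}"

definition DST_degenerate_instances :: "nat \<Rightarrow> (bool list \<times> nat) set" where
  "DST_degenerate_instances d =
     {(dst_string n D r T, k) | n D r T k. dst_instance n D r T \<and> digraph_degeneracy D \<le> d}"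

end

theory Submission
  imports Defs
begin

text \<open>A \<open>\<Pi>\<^sub>2\<close>-condition on a \<open>k\<close>-element set \<open>S\<close> of \<open>N\<close> possible tuples says that, for each value of the
  universal variables, boundedly many literals on \<open>S\<close> hold for some value of the existential ones.
  Enumerate \<open>S\<close> increasingly between two sentinels: a positive literal is
  witnessed by the content of one slot of the enumeration and a negative literal by two consecutive slots.
  Hence, with \<open>D\<close> bounding the number of slots needed, guess for each of the \<open>(k + 2) ^ D\<close> tuples of slots
  their contents. Consistency of the guesses and the truth of the formula become clauses each asking
  for one of several guesses, that is, a hitting set instance with budget \<open>(k + 2) ^ D\<close>.
  In the Steiner tree instance a clause is a star of terminals with arcs in both directions, one leaf per
  guess, so a clause is reached as soon as one of its leaves is, and the leaves have degree 2.
  The instance is computed by a bounded arithmetic expression for each of its bits, and such expressions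
  compile to polynomial time programs.\<close>

section \<open>Timed execution\<close>

text \<open>Hitting sets are monotone, but the formula is not: for one value of the universal
  variables it asks for a disjunction of conjunctions of literals of both signs. A clause is
  satisfied by a single item, so one item must certify a whole conjunction with its negative
  literals; hence an item carries \<open>D\<close> slots with their values and not one element of
  \<open>S\<close>. The budget equals the number of slot tuples, and every tuple is forced to
  receive an item, so a solution makes exactly one guess per tuple. Thus "the guess for
  \<open>I\<close> is not \<open>u\<close>" becomes the monotone statement that another guess for
  \<open>I\<close> is chosen, and implications between guesses become clauses. \<open>D\<close> is
  two per atom of the set variable plus two: the extra two make every pair of slots occur together
  in some tuple, so that a single item can witness that the enumeration increases. Since W[2]
  consists of the problems reducible to weighted definability problems, only the latter have to be
  reduced. This second step may take time polynomial in the value of \<open>k\<close>, because the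
  parameter of the intermediate instance is bounded computably.\<close>

definition runs :: "com \<Rightarrow> state \<Rightarrow> nat \<Rightarrow> (state \<Rightarrow> bool) \<Rightarrow> bool" where
  "runs c s B Q \<longleftrightarrow> (\<exists>t s'. exec c s t s' \<and> t \<le> B \<and> Q s')"

lemma runs_weaken:
  assumes "runs c s B P" and "B \<le> B'" and "\<And>s'. P s' \<Longrightarrow> Q s'"
  shows "runs c s B' Q"
  using assms unfolding runs_def by (meson le_trans)

lemma runs_Assign:
  assumes "acost a s \<le> B" and "Q (s(i := aval a s))"
  shows "runs (Assign i a) s B Q"
  using assms exec.Assign unfolding runs_def by blast

lemma runs_Seq:
  assumes "runs c1 s B1 P" and "\<And>s'. P s' \<Longrightarrow> runs c2 s' B2 Q"
  shows "runs (Seq c1 c2) s (B1 + B2) Q"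
proof -
  obtain t1 s' where 1: "exec c1 s t1 s'" "t1 \<le> B1" "P s'"
    using assms(1) unfolding runs_def by blast
  obtain t2 s'' where 2: "exec c2 s' t2 s''" "t2 \<le> B2" "Q s''"
    using assms(2)[OF 1(3)] unfolding runs_def by blast
  show ?thesis
    unfolding runs_def using exec.Seq[OF 1(1) 2(1)] 1 2 add_mono by blast
qed

lemma floorlog_2_le_self: "floorlog 2 v \<le> v"
proof (cases "v = 0")
  case False
  have "2 ^ (floorlog 2 v - 1) \<le> v"
    using False floorlog_bounds[of v 2] by simp
  moreover have "floorlog 2 v - 1 < 2 ^ (floorlog 2 v - 1)"
    by (rule less_exp)
  ultimately show ?thesis by linarith
qed (simp add: floorlog_def)

lemma val_cost_le: "v \<le> M \<Longrightarrow> val_cost v \<le> Suc M"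
  using floorlog_2_le_self[of v] by (simp add: val_cost_def)

lemma floorlog_2_mono: "u \<le> v \<Longrightarrow> floorlog 2 u \<le> floorlog 2 v"
  by (rule floorlog_mono)

text \<open>The counter drops before the body runs, so the body sees \<open>L - 1\<close>, ...,
  \<open>0\<close>, the index range of a sum or list of length \<open>L\<close>, and may read the
  counter as its loop variable.\<close>

definition countdown :: "nat \<Rightarrow> com \<Rightarrow> com" where
  "countdown v c = While (Reg v) (Seq (Assign v (Minus (Reg v) (Const 1))) c)"

text \<open>A round costs at most \<open>L + 1\<close> for the guard, \<open>2 * L + 4\<close> for
  the decrement and \<open>B\<close> for the body; the final \<open>+ 1\<close> is the failing guard
  on value 0.\<close>

lemma runs_countdown:
  assumes step: "\<And>i s. i < L \<Longrightarrow> Inv (Suc i) s \<Longrightarrow> s v = Suc i \<Longrightarrow>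
      runs c (s(v := i)) B (\<lambda>s'. s' v = i \<and> Inv i s')"
    and "Inv L s" and "s v = L"
  shows "runs (countdown v c) s (L * (3 * L + 5 + B) + 1) (\<lambda>s'. s' v = 0 \<and> Inv 0 s')"
proof -
  have "runs (countdown v c) s (i * (3 * L + 5 + B) + 1) (\<lambda>s'. s' v = 0 \<and> Inv 0 s')"
    if "i \<le> L" "Inv i s" "s v = i" for i s
    using that
  proof (induction i arbitrary: s)
    case 0
    have "exec (countdown v c) s (acost (Reg v) s) s"
      unfolding countdown_def by (rule exec.WhileFalse) (simp add: 0)
    moreover have "acost (Reg v) s = 1"
      using 0 by (simp add: val_cost_def floorlog_def)
    ultimately show ?case
      using 0 unfolding runs_def by auto
  next
    case (Suc i)
    let ?a = "Minus (Reg v) (Const 1)"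
    obtain t1 s' where 1: "exec c (s(v := i)) t1 s'" "t1 \<le> B" "s' v = i" "Inv i s'"
      using step[of i s] Suc.prems unfolding runs_def by auto
    obtain t2 s'' where 2: "exec (countdown v c) s' t2 s''" "t2 \<le> i * (3 * L + 5 + B) + 1"
        "s'' v = 0" "Inv 0 s''"
      using Suc.IH[of s'] Suc.prems 1 unfolding runs_def by auto
    have "exec (Assign v ?a) s (acost ?a s) (s(v := i))"
      using exec.Assign[of v ?a s] Suc.prems by simp
    from exec.WhileTrue[where b = "Reg v", OF _ exec.Seq[OF this 1(1)] 2(1)[unfolded countdown_def]]
    have "exec (countdown v c) s (acost (Reg v) s + (acost ?a s + t1) + t2) s''"
      using Suc.prems by (simp add: countdown_def)
    moreover have "acost (Reg v) s \<le> Suc L" "acost ?a s \<le> Suc L + 2 + Suc L"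
      using Suc.prems val_cost_le[of "s v" L] val_cost_le[of i L] val_cost_le[of 1 1]
      by auto
    hence "acost (Reg v) s + (acost ?a s + t1) + t2 \<le> Suc i * (3 * L + 5 + B) + 1"
      using 1(2) 2(2) by simp
    ultimately show ?case
      using 2 unfolding runs_def by blast
  qed
  from this[of L s] show ?thesis using assms by simp
qed

text \<open>For \<open>M\<close> at least 2, constants and factors are absorbed by a higher
  exponent, so every bound can be brought to the form \<open>M ^ p\<close>. This form is stable
  under replacing \<open>M\<close> by \<open>M ^ Suc p\<close>, which binders cause.\<close>

definition poly_bounded :: "(nat \<Rightarrow> nat) \<Rightarrow> bool" where
  "poly_bounded f \<longleftrightarrow> (\<exists>p. \<forall>M\<ge>2. f M \<le> M ^ p)"

lemma poly_bounded_const: "poly_bounded (\<lambda>M. c)"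
  unfolding poly_bounded_def
proof (intro exI allI impI)
  fix M :: nat assume "2 \<le> M"
  have "c \<le> 2 ^ c" by (rule less_imp_le[OF less_exp])
  also have "\<dots> \<le> M ^ c" using \<open>2 \<le> M\<close> by (rule power_mono) simp
  finally show "c \<le> M ^ c" .
qed

lemma poly_bounded_power: "poly_bounded (\<lambda>M. M ^ a)"
  unfolding poly_bounded_def by blast

lemma poly_bounded_id: "poly_bounded (\<lambda>M. M)"
  using poly_bounded_power[of 1] by simp

lemma poly_bounded_add:
  assumes "poly_bounded f" "poly_bounded g"
  shows "poly_bounded (\<lambda>M. f M + g M)"
proof -
  obtain a b where ab: "\<forall>M\<ge>2. f M \<le> M ^ a" "\<forall>M\<ge>2. g M \<le> M ^ b"
    using assms unfolding poly_bounded_def by blast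
  have "f M + g M \<le> M ^ (Suc (a + b))" if "2 \<le> M" for M
  proof -
    have "M ^ a \<le> M ^ (a + b)" "M ^ b \<le> M ^ (a + b)"
      using that by (auto intro!: power_increasing)
    hence "f M + g M \<le> 2 * M ^ (a + b)"
      using ab that by (metis add_mono le_trans mult_2)
    also have "\<dots> \<le> M * M ^ (a + b)"
      using that by simp
    finally show ?thesis by simp
  qed
  thus ?thesis unfolding poly_bounded_def by blast
qed

lemma poly_bounded_mult:
  assumes "poly_bounded f" "poly_bounded g"
  shows "poly_bounded (\<lambda>M. f M * g M)"
proof -
  obtain a b where "\<forall>M\<ge>2. f M \<le> M ^ a" "\<forall>M\<ge>2. g M \<le> M ^ b"
    using assms unfolding poly_bounded_def by blast
  hence "\<forall>M\<ge>2. f M * g M \<le> M ^ (a + b)"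
    by (simp add: power_add mult_mono)
  thus ?thesis unfolding poly_bounded_def by blast
qed

lemma poly_bounded_Suc: "poly_bounded f \<Longrightarrow> poly_bounded (\<lambda>M. Suc (f M))"
  using poly_bounded_add[OF _ poly_bounded_const[of 1]] by simp

lemmas poly_bounded_intros =
  poly_bounded_const poly_bounded_power poly_bounded_id poly_bounded_add poly_bounded_mult
  poly_bounded_Suc

section \<open>Bounded arithmetic\<close>

text \<open>Expressions over a big number \<open>x\<close>, accessible only bitwise, and variables of small value.
  Variable \<open>i\<close> lives in register \<open>i + 1\<close>, and \<open>x\<close> in register 0. All their values
  are polynomial in the values of the variables, so that the programs obtained from them run in
  polynomial time.\<close>

datatype bexp =
    Num nat
  | Var nat
  | Add bexp bexp
  | Sub bexp bexp
  | Mul bexp bexp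
  | Quo bexp bexp
  | Bit bexp
  | BSum nat bexp bexp
  | Bind nat bexp bexp

primrec ev :: "bexp \<Rightarrow> nat \<Rightarrow> (nat \<Rightarrow> nat) \<Rightarrow> nat" where
  "ev (Num c) x r = c"
| "ev (Var i) x r = r i"
| "ev (Add a b) x r = ev a x r + ev b x r"
| "ev (Sub a b) x r = ev a x r - ev b x r"
| "ev (Mul a b) x r = ev a x r * ev b x r"
| "ev (Quo a b) x r = ev a x r div ev b x r"
| "ev (Bit a) x r = x div 2 ^ ev a x r mod 2"
| "ev (BSum v a b) x r = (\<Sum>i<ev a x r. ev b x (r(v := i)))"
| "ev (Bind v a b) x r = ev b x (r(v := ev a x r))"

primrec var_bound :: "bexp \<Rightarrow> nat" where
  "var_bound (Num c) = 0"
| "var_bound (Var i) = Suc i"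
| "var_bound (Add a b) = max (var_bound a) (var_bound b)"
| "var_bound (Sub a b) = max (var_bound a) (var_bound b)"
| "var_bound (Mul a b) = max (var_bound a) (var_bound b)"
| "var_bound (Quo a b) = max (var_bound a) (var_bound b)"
| "var_bound (Bit a) = var_bound a"
| "var_bound (BSum v a b) = max (Suc v) (max (var_bound a) (var_bound b))"
| "var_bound (Bind v a b) = max (Suc v) (max (var_bound a) (var_bound b))"

definition comp_binop :: "(aexp \<Rightarrow> aexp \<Rightarrow> aexp) \<Rightarrow> com \<Rightarrow> com \<Rightarrow> nat \<Rightarrow> com" where
  "comp_binop f c1 c2 d =
     Seq c1 (Seq c2 (Assign (Suc d) (f (Reg (Suc d)) (Reg (Suc (Suc d))))))"

text \<open>\<open>comp e d\<close> leaves the value of \<open>e\<close> in register \<open>d + 1\<close> and preserves the registers up to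
  \<open>d\<close>. In \<open>Bit\<close>, \<open>BSum\<close> and \<open>Bind\<close> register \<open>d + 2\<close> keeps the shifted copy of \<open>x\<close> and the saved
  value of the bound variable, respectively.\<close>

primrec comp :: "bexp \<Rightarrow> nat \<Rightarrow> com" where
  "comp (Num c) d = Assign (Suc d) (Const c)"
| "comp (Var i) d = Assign (Suc d) (Reg (Suc i))"
| "comp (Add a b) d = comp_binop Plus (comp a d) (comp b (Suc d)) d"
| "comp (Sub a b) d = comp_binop Minus (comp a d) (comp b (Suc d)) d"
| "comp (Mul a b) d = comp_binop Times (comp a d) (comp b (Suc d)) d"
| "comp (Quo a b) d = comp_binop Div (comp a d) (comp b (Suc d)) d"
| "comp (Bit a) d =
     Seq (comp a d) (Seq (Assign (Suc (Suc d)) (Reg 0))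
    (Seq (countdown (Suc d) (Assign (Suc (Suc d)) (Div (Reg (Suc (Suc d))) (Const 2))))
      (Assign (Suc d) (Minus (Reg (Suc (Suc d)))
         (Times (Div (Reg (Suc (Suc d))) (Const 2)) (Const 2))))))"
| "comp (BSum v a b) d =
     Seq (comp a d) (Seq (Assign (Suc (Suc d)) (Reg (Suc v)))
    (Seq (Assign (Suc v) (Reg (Suc d))) (Seq (Assign (Suc d) (Const 0))
    (Seq (countdown (Suc v) (Seq (comp b (Suc (Suc d)))
           (Assign (Suc d) (Plus (Reg (Suc d)) (Reg (Suc (Suc (Suc d))))))))
      (Assign (Suc v) (Reg (Suc (Suc d))))))))"
| "comp (Bind v a b) d =
     Seq (comp a d) (Seq (Assign (Suc (Suc d)) (Reg (Suc v)))
    (Seq (Assign (Suc v) (Reg (Suc d))) (Seq (comp b (Suc (Suc d)))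
    (Seq (Assign (Suc v) (Reg (Suc (Suc d)))) (Assign (Suc d) (Reg (Suc (Suc (Suc d)))))))))"

section \<open>Correctness and cost of the compiler\<close>

definition env_state :: "nat \<Rightarrow> nat \<Rightarrow> nat \<Rightarrow> (nat \<Rightarrow> nat) \<Rightarrow> state \<Rightarrow> bool" where
  "env_state m M x r s \<longleftrightarrow> floorlog 2 x \<le> M \<and> s 0 = x \<and> (\<forall>i<m. r i \<le> M \<and> s (Suc i) = r i)"

text \<open>One function bounds both time and value, because a value may become a loop length or the
  content of a bound variable. In \<open>env_state\<close>, \<open>M\<close> bounds the length of
  \<open>x\<close> but the values of the variables: \<open>x\<close> is only copied and shifted,
  while a variable may drive a loop.\<close>

definition comp_spec :: "bexp \<Rightarrow> nat \<Rightarrow> (nat \<Rightarrow> nat) \<Rightarrow> bool" where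
  "comp_spec e d f \<longleftrightarrow> (\<forall>M x r s. 2 \<le> M \<longrightarrow> env_state (var_bound e) M x r s \<longrightarrow>
     ev e x r \<le> f M \<and>
     runs (comp e d) s (f M) (\<lambda>s'. s' (Suc d) = ev e x r \<and> (\<forall>i\<le>d. s' i = s i)))"

lemma comp_specD:
  assumes "comp_spec e d f" "2 \<le> M" "env_state (var_bound e) M x r s"
  shows "ev e x r \<le> f M"
    "runs (comp e d) s (f M) (\<lambda>s'. s' (Suc d) = ev e x r \<and> (\<forall>i\<le>d. s' i = s i))"
  using assms unfolding comp_spec_def by blast+

lemma env_state_mono:
  "env_state m M x r s \<Longrightarrow> m' \<le> m \<Longrightarrow> M \<le> M' \<Longrightarrow> env_state m' M' x r s"
  unfolding env_state_def by (meson le_trans less_le_trans)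

lemma env_state_cong:
  "env_state m M x r s \<Longrightarrow> m \<le> d \<Longrightarrow> (\<forall>i\<le>d. s' i = s i) \<Longrightarrow> env_state m M x r s'"
  unfolding env_state_def by auto

lemma comp_spec_poly:
  assumes "poly_bounded f" "comp_spec e d f"
  shows "\<exists>p. comp_spec e d (\<lambda>M. M ^ p)"
proof -
  obtain p where "\<forall>M\<ge>2. f M \<le> M ^ p"
    using assms(1) unfolding poly_bounded_def by blast
  hence "comp_spec e d (\<lambda>M. M ^ p)"
    using assms(2) unfolding comp_spec_def by (blast intro: le_trans runs_weaken)
  thus ?thesis ..
qed

text \<open>The product \<open>(u + 1) * (v + 1)\<close> dominates sum, difference, product and
  quotient alike, so one argument serves all four operations.\<close>

lemma comp_spec_binop:
  assumes "var_bound a \<le> d" "var_bound b \<le> d"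
    and a: "comp_spec a d (\<lambda>M. M ^ p)" and b: "comp_spec b (Suc d) (\<lambda>M. M ^ q)"
    and vb: "var_bound e = max (var_bound a) (var_bound b)"
    and ce: "comp e d = comp_binop f (comp a d) (comp b (Suc d)) d"
    and ev: "\<And>x r. ev e x r = g (ev a x r) (ev b x r)"
    and aval: "\<And>u v s. aval (f u v) s = g (aval u s) (aval v s)"
    and acost: "\<And>u v s. acost (f u v) s = acost u s + acost v s + val_cost (aval (f u v) s)"
    and g: "\<And>u v. g u v \<le> (u + 1) * (v + 1)"
  shows "\<exists>p. comp_spec e d (\<lambda>M. M ^ p)"
proof (rule comp_spec_poly)
  let ?F = "\<lambda>M. M ^ p + (M ^ q + (Suc (M ^ p) + Suc (M ^ q) + Suc ((M ^ p + 1) * (M ^ q + 1))))"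
  show "poly_bounded ?F"
    by (intro poly_bounded_intros)
  show "comp_spec e d ?F"
    unfolding comp_spec_def
  proof (intro allI impI)
    fix M x r s
    assume M: "2 \<le> M" and env: "env_state (var_bound e) M x r s"
    have ea: "env_state (var_bound a) M x r s" and eb: "env_state (var_bound b) M x r s"
      using env by (auto simp: vb intro: env_state_mono)
    have va: "ev a x r \<le> M ^ p" and vb: "ev b x r \<le> M ^ q"
      using comp_specD(1)[OF a M ea] comp_specD(1)[OF b M eb] by auto
    have ve: "ev e x r \<le> (M ^ p + 1) * (M ^ q + 1)"
      unfolding ev by (rule order.trans[OF g mult_mono]) (use va vb in auto)
    have "runs (comp e d) s (?F M) (\<lambda>s'. s' (Suc d) = ev e x r \<and> (\<forall>i\<le>d. s' i = s i))"
      unfolding ce comp_binop_def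
    proof (intro runs_Seq, rule comp_specD(2)[OF a M ea])
      fix s1 assume s1: "s1 (Suc d) = ev a x r \<and> (\<forall>i\<le>d. s1 i = s i)"
      have "env_state (var_bound b) M x r s1"
        using env_state_cong[OF eb assms(2)] s1 by blast
      from comp_specD(2)[OF b M this]
      show "runs (comp b (Suc d)) s1 (M ^ q)
          (\<lambda>s'. s' (Suc (Suc d)) = ev b x r \<and> (\<forall>i\<le>d. s' i = s i) \<and> s' (Suc d) = ev a x r)"
        by (rule runs_weaken) (use s1 in auto)
    next
      fix s2 assume s2: "s2 (Suc (Suc d)) = ev b x r \<and> (\<forall>i\<le>d. s2 i = s i) \<and> s2 (Suc d) = ev a x r"
      show "runs (Assign (Suc d) (f (Reg (Suc d)) (Reg (Suc (Suc d))))) s2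
        (Suc (M ^ p) + Suc (M ^ q) + Suc ((M ^ p + 1) * (M ^ q + 1)))
        (\<lambda>s'. s' (Suc d) = ev e x r \<and> (\<forall>i\<le>d. s' i = s i))"
      proof (rule runs_Assign)
        show "acost (f (Reg (Suc d)) (Reg (Suc (Suc d)))) s2
            \<le> Suc (M ^ p) + Suc (M ^ q) + Suc ((M ^ p + 1) * (M ^ q + 1))"
          unfolding acost using val_cost_le[OF va] val_cost_le[OF vb] val_cost_le[OF ve] s2
          by (simp add: aval ev)
      qed (use s2 in \<open>simp add: aval ev\<close>)
    qed
    moreover have "ev e x r \<le> ?F M"
      using ve by simp
    ultimately show "ev e x r \<le> ?F M \<and>
        runs (comp e d) s (?F M) (\<lambda>s'. s' (Suc d) = ev e x r \<and> (\<forall>i\<le>d. s' i = s i))"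
      by blast
  qed
qed

lemma comp_spec_Bit:
  assumes "var_bound a \<le> d" and a: "comp_spec a d (\<lambda>M. M ^ p)"
  shows "\<exists>p. comp_spec (Bit a) d (\<lambda>M. M ^ p)"
proof (rule comp_spec_poly)
  let ?X = "Suc (Suc d)"
  let ?F = "\<lambda>M. M ^ p + (Suc M + ((M ^ p * (3 * M ^ p + 5 + (Suc M + 3 + Suc M)) + 1)
     + (Suc M + (Suc M + 3 + Suc M + 3 + Suc M) + 2)))"
  show "poly_bounded ?F"
    by (intro poly_bounded_intros)
  show "comp_spec (Bit a) d ?F"
    unfolding comp_spec_def
  proof (intro allI impI)
    fix M x r s
    assume M: "2 \<le> M" and env: "env_state (var_bound (Bit a)) M x r s"
    have ea: "env_state (var_bound a) M x r s"
      using env by simp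
    have s0: "s 0 = x" and lx: "floorlog 2 x \<le> M"
      using env by (auto simp: env_state_def)
    have small: "val_cost y \<le> Suc M" if "y \<le> x" for y
      using floorlog_2_mono[OF that] lx by (simp add: val_cost_def)
    have c2: "val_cost 2 \<le> 3" and c1: "\<And>y. y \<le> 1 \<Longrightarrow> val_cost y \<le> 2"
      using val_cost_le[of 2 2] val_cost_le[of _ 1] by (auto simp: numeral_eq_Suc)
    let ?L = "ev a x r"
    have va: "?L \<le> M ^ p"
      using comp_specD(1)[OF a M ea] .
    \<comment> \<open>With \<open>i\<close> rounds to go, \<open>?L - i\<close> low bits have been
      shifted out.\<close>
    let ?Inv = "\<lambda>i t. i \<le> ?L \<and> t ?X = x div 2 ^ (?L - i) \<and> (\<forall>i\<le>d. t i = s i)"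
    have "runs (comp (Bit a) d) s (?F M) (\<lambda>s'. s' (Suc d) = ev (Bit a) x r \<and> (\<forall>i\<le>d. s' i = s i))"
      unfolding comp.simps
    proof (intro runs_Seq, rule comp_specD(2)[OF a M ea])
      fix s1 assume s1: "s1 (Suc d) = ?L \<and> (\<forall>i\<le>d. s1 i = s i)"
      show "runs (Assign ?X (Reg 0)) s1 (Suc M)
          (\<lambda>s'. s' (Suc d) = ?L \<and> ?Inv ?L s')"
        by (rule runs_Assign) (use s1 s0 small[of x] in auto)
    next
      fix s2 assume s2: "s2 (Suc d) = ?L \<and> ?Inv ?L s2"
      have "runs (countdown (Suc d) (Assign ?X (Div (Reg ?X) (Const 2)))) s2
          (?L * (3 * ?L + 5 + (Suc M + 3 + Suc M)) + 1)
          (\<lambda>s'. s' (Suc d) = 0 \<and> ?Inv 0 s')"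
      proof (rule runs_countdown)
        fix i t assume i: "i < ?L" and t: "?Inv (Suc i) t" "t (Suc d) = Suc i"
        have "?L - i = Suc (?L - Suc i)" using i by simp
        hence eq: "t ?X div 2 = x div 2 ^ (?L - i)"
          using t(1) by (simp add: mult.commute flip: div_mult2_eq)
        show "runs (Assign ?X (Div (Reg ?X) (Const 2))) (t(Suc d := i))
             (Suc M + 3 + Suc M) (\<lambda>s'. s' (Suc d) = i \<and> ?Inv i s')"
        proof (rule runs_Assign)
          have "t ?X \<le> x" "t ?X div 2 \<le> x" using t eq by auto
          thus "acost (Div (Reg ?X) (Const 2)) (t(Suc d := i)) \<le> Suc M + 3 + Suc M"
            using small[of "t ?X"] small[of "t ?X div 2"] c2 by simp
        qed (use i t eq in auto)
      qed (use s2 in auto)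
      moreover have "?L * (3 * ?L + 5 + (Suc M + 3 + Suc M)) + 1
          \<le> M ^ p * (3 * M ^ p + 5 + (Suc M + 3 + Suc M)) + 1"
        by (intro add_mono mult_mono) (use va in auto)
      ultimately show "runs (countdown (Suc d) (Assign ?X (Div (Reg ?X) (Const 2)))) s2
          (M ^ p * (3 * M ^ p + 5 + (Suc M + 3 + Suc M)) + 1)
          (\<lambda>s'. s' (Suc d) = 0 \<and> ?Inv 0 s')"
        by (rule runs_weaken)
    next
      fix s3 assume s3: "s3 (Suc d) = 0 \<and> ?Inv 0 s3"
      \<comment> \<open>The machine has no remainder operation, hence
        \<open>y - y div 2 * 2\<close>.\<close>
      let ?e = "Minus (Reg ?X) (Times (Div (Reg ?X) (Const 2)) (Const 2))"
      have le: "s3 ?X \<le> x" "s3 ?X div 2 \<le> x" "s3 ?X div 2 * 2 \<le> x"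
        using s3 by (auto intro: order.trans[OF div_le_dividend] order.trans[OF div_times_less_eq_dividend])
      have md: "s3 ?X - s3 ?X div 2 * 2 = s3 ?X mod 2"
        by (rule minus_div_mult_eq_mod)
      show "runs (Assign (Suc d) ?e) s3
         (Suc M + (Suc M + 3 + Suc M + 3 + Suc M) + 2)
         (\<lambda>s'. s' (Suc d) = ev (Bit a) x r \<and> (\<forall>i\<le>d. s' i = s i))"
      proof (rule runs_Assign)
        show "acost ?e s3 \<le> Suc M + (Suc M + 3 + Suc M + 3 + Suc M) + 2"
          using small[OF le(1)] small[OF le(2)] small[OF le(3)] c2 c1[of "s3 ?X mod 2"]
            mod_less_divisor[of 2 "s3 ?X"]
          by (simp add: md del: mod_less_divisor)
      qed (use s3 in \<open>simp add: minus_div_mult_eq_mod\<close>)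
    qed
    moreover have "ev (Bit a) x r \<le> ?F M"
    proof -
      have "ev (Bit a) x r \<le> 1" by simp
      also have "1 \<le> ?F M" by simp
      finally show ?thesis .
    qed
    ultimately show "ev (Bit a) x r \<le> ?F M \<and>
        runs (comp (Bit a) d) s (?F M) (\<lambda>s'. s' (Suc d) = ev (Bit a) x r \<and> (\<forall>i\<le>d. s' i = s i))"
      by blast
  qed
qed

lemma env_state_bound:
  assumes "env_state m M x r s" "m \<le> d" "v < m" "i \<le> M'" "M \<le> M'"
    and "\<forall>j\<le>d. j \<noteq> Suc v \<longrightarrow> s' j = s j" "s' (Suc v) = i"
  shows "env_state m M' x (r(v := i)) s'"
  using assms unfolding env_state_def by (auto intro: le_trans)

lemma le_power_Suc: "2 \<le> (M::nat) \<Longrightarrow> M ^ a \<le> M ^ Suc a" "2 \<le> M \<Longrightarrow> M \<le> M ^ Suc a"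
  by auto

lemma comp_spec_Bind:
  assumes d: "var_bound (Bind v a b) \<le> d" and a: "comp_spec a d (\<lambda>M. M ^ p)"
    and b: "comp_spec b (Suc (Suc d)) (\<lambda>M. M ^ q)"
  shows "\<exists>p. comp_spec (Bind v a b) d (\<lambda>M. M ^ p)"
proof (rule comp_spec_poly)
  let ?F = "\<lambda>M. M ^ p + (Suc M + (Suc (M ^ p) + (M ^ (Suc p * q) + (Suc M + Suc (M ^ (Suc p * q))))))"
  show "poly_bounded ?F"
    by (intro poly_bounded_intros)
  show "comp_spec (Bind v a b) d ?F"
    unfolding comp_spec_def
  proof (intro allI impI)
    fix M x r s
    assume M: "2 \<le> M" and env: "env_state (var_bound (Bind v a b)) M x r s"
    let ?m = "var_bound (Bind v a b)"
    have ea: "env_state (var_bound a) M x r s"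
      using env by (auto intro: env_state_mono)
    let ?r = "r(v := ev a x r)"
    have va: "ev a x r \<le> M ^ p"
      using comp_specD(1)[OF a M ea] .
    \<comment> \<open>The body is evaluated under the bound \<open>M ^ Suc p\<close> and not
      \<open>M ^ p\<close>, as the bound must also dominate \<open>M\<close> for the other
      variables, which fails for \<open>p = 0\<close>.\<close>
    have va': "ev a x r \<le> M ^ Suc p"
      using va le_power_Suc(1)[OF M] by (rule order.trans)
    have M': "2 \<le> M ^ Suc p" using le_power_Suc(2)[OF M, of p] M by linarith
    have eb: "env_state (var_bound b) (M ^ Suc p) x ?r t"
      if "t (Suc v) = ev a x r" "\<forall>j\<le>d. j \<noteq> Suc v \<longrightarrow> t j = s j" for t
    proof -
      have "env_state ?m (M ^ Suc p) x ?r t"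
        by (rule env_state_bound[OF env d])
          (use that va' le_power_Suc(2)[OF M, of p] in \<open>auto simp del: power_Suc\<close>)
      thus ?thesis by (rule env_state_mono) auto
    qed
    have "v < d" using d by simp
    have rv: "s (Suc v) \<le> M" using env by (auto simp: env_state_def)
    have vb: "ev b x ?r \<le> M ^ (Suc p * q)"
      using comp_specD(1)[OF b M' eb[of "s(Suc v := ev a x r)"]] by (simp add: power_mult del: power_Suc mult_Suc)
    have "runs (comp (Bind v a b) d) s (?F M)
        (\<lambda>s'. s' (Suc d) = ev (Bind v a b) x r \<and> (\<forall>i\<le>d. s' i = s i))"
      unfolding comp.simps
    proof (intro runs_Seq, rule comp_specD(2)[OF a M ea])
      fix s1 assume s1: "s1 (Suc d) = ev a x r \<and> (\<forall>i\<le>d. s1 i = s i)"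
      show "runs (Assign (Suc (Suc d)) (Reg (Suc v))) s1 (Suc M)
        (\<lambda>s'. s' (Suc (Suc d)) = s (Suc v) \<and> s' (Suc d) = ev a x r \<and> (\<forall>i\<le>d. s' i = s i))"
        by (rule runs_Assign) (use s1 \<open>v < d\<close> val_cost_le[OF rv] in auto)
    next
      fix s2 assume s2: "s2 (Suc (Suc d)) = s (Suc v) \<and> s2 (Suc d) = ev a x r \<and> (\<forall>i\<le>d. s2 i = s i)"
      show "runs (Assign (Suc v) (Reg (Suc d))) s2 (Suc (M ^ p))
        (\<lambda>s'. s' (Suc (Suc d)) = s (Suc v) \<and> s' (Suc v) = ev a x r \<and>
          (\<forall>i\<le>d. i \<noteq> Suc v \<longrightarrow> s' i = s i))"
        by (rule runs_Assign) (use s2 \<open>v < d\<close> val_cost_le[OF va] in auto)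
    next
      fix s3 assume s3: "s3 (Suc (Suc d)) = s (Suc v) \<and> s3 (Suc v) = ev a x r \<and>
          (\<forall>i\<le>d. i \<noteq> Suc v \<longrightarrow> s3 i = s i)"
      show "runs (comp b (Suc (Suc d))) s3 (M ^ (Suc p * q))
         (\<lambda>s'. s' (Suc (Suc (Suc d))) = ev b x ?r \<and> s' (Suc (Suc d)) = s (Suc v) \<and>
          (\<forall>i\<le>d. i \<noteq> Suc v \<longrightarrow> s' i = s i))"
        by (rule runs_weaken[OF comp_specD(2)[OF b M' eb]])
          (use s3 in \<open>auto simp: power_mult simp del: power_Suc mult_Suc\<close>)
    next
      fix s4 assume s4: "s4 (Suc (Suc (Suc d))) = ev b x ?r \<and> s4 (Suc (Suc d)) = s (Suc v) \<and>
          (\<forall>i\<le>d. i \<noteq> Suc v \<longrightarrow> s4 i = s i)"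
      show "runs (Assign (Suc v) (Reg (Suc (Suc d)))) s4 (Suc M)
        (\<lambda>s'. s' (Suc (Suc (Suc d))) = ev b x ?r \<and> (\<forall>i\<le>d. s' i = s i))"
        by (rule runs_Assign) (use s4 \<open>v < d\<close> val_cost_le[OF rv] in auto)
    next
      fix s5 assume s5: "s5 (Suc (Suc (Suc d))) = ev b x ?r \<and> (\<forall>i\<le>d. s5 i = s i)"
      show "runs (Assign (Suc d) (Reg (Suc (Suc (Suc d))))) s5 (Suc (M ^ (Suc p * q)))
        (\<lambda>s'. s' (Suc d) = ev (Bind v a b) x r \<and> (\<forall>i\<le>d. s' i = s i))"
        by (rule runs_Assign) (use s5 val_cost_le[OF vb] in auto)
    qed
    moreover have "ev (Bind v a b) x r \<le> ?F M"
      using vb by simp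
    ultimately show "ev (Bind v a b) x r \<le> ?F M \<and> runs (comp (Bind v a b) d) s (?F M)
        (\<lambda>s'. s' (Suc d) = ev (Bind v a b) x r \<and> (\<forall>i\<le>d. s' i = s i))"
      by blast
  qed
qed

lemma comp_spec_BSum:
  assumes d: "var_bound (BSum v a b) \<le> d" and a: "comp_spec a d (\<lambda>M. M ^ p)"
    and b: "comp_spec b (Suc (Suc d)) (\<lambda>M. M ^ q)"
  shows "\<exists>p. comp_spec (BSum v a b) d (\<lambda>M. M ^ p)"
proof (rule comp_spec_poly)
  let ?B = "\<lambda>M. M ^ (Suc p * q)"
  let ?S = "\<lambda>M. M ^ p * M ^ (Suc p * q)"
  let ?C = "\<lambda>M. ?B M + (Suc (?S M) + Suc (?S M) + Suc (?S M))"
  let ?F = "\<lambda>M. M ^ p + (Suc M + (Suc (M ^ p) + (1 +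
      ((M ^ p * (3 * M ^ p + 5 + ?C M) + 1) + Suc M)))) + ?S M"
  show "poly_bounded ?F"
    by (intro poly_bounded_intros)
  show "comp_spec (BSum v a b) d ?F"
    unfolding comp_spec_def
  proof (intro allI impI)
    fix M x r s
    assume M: "2 \<le> M" and env: "env_state (var_bound (BSum v a b)) M x r s"
    let ?m = "var_bound (BSum v a b)"
    have ea: "env_state (var_bound a) M x r s"
      using env by (auto intro: env_state_mono)
    let ?L = "ev a x r"
    let ?g = "\<lambda>i. ev b x (r(v := i))"
    have va: "?L \<le> M ^ p"
      using comp_specD(1)[OF a M ea] .
    have va': "ev a x r \<le> M ^ Suc p"
      using va le_power_Suc(1)[OF M] by (rule order.trans)
    have M': "2 \<le> M ^ Suc p" using le_power_Suc(2)[OF M, of p] M by linarith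
    have eb: "env_state (var_bound b) (M ^ Suc p) x (r(v := i)) t"
      if "i \<le> ?L" "t (Suc v) = i" "\<forall>j\<le>d. j \<noteq> Suc v \<longrightarrow> t j = s j" for i t
    proof -
      have "env_state ?m (M ^ Suc p) x (r(v := i)) t"
        by (rule env_state_bound[OF env d])
          (use that va' le_power_Suc(2)[OF M, of p] in \<open>auto simp del: power_Suc\<close>)
      thus ?thesis by (rule env_state_mono) auto
    qed
    have "v < d" using d by simp
    have rv: "s (Suc v) \<le> M" using env by (auto simp: env_state_def)
    have vb: "?g i \<le> ?B M" if "i \<le> ?L" for i
      using comp_specD(1)[OF b M' eb[of i "s(Suc v := i)"]] that by (simp add: power_mult del: power_Suc mult_Suc)
    have sums: "sum ?g {i..<?L} \<le> ?S M" for i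
    proof -
      have "sum ?g {i..<?L} \<le> of_nat (card {i..<?L}) * ?B M"
        by (rule sum_bounded_above) (use vb in auto)
      also have "\<dots> \<le> ?S M"
        using va by (intro mult_right_mono) auto
      finally show ?thesis .
    qed
    have ev_eq: "ev (BSum v a b) x r = sum ?g {0..<?L}"
      by (simp add: lessThan_atLeast0)
    \<comment> \<open>The bound variable is itself the counter and runs downwards, so the
      accumulator holds a tail of the sum.\<close>
    let ?Inv = "\<lambda>i t. t (Suc (Suc d)) = s (Suc v) \<and> t (Suc d) = sum ?g {i..<?L} \<and>
       (\<forall>j\<le>d. j \<noteq> Suc v \<longrightarrow> t j = s j)"
    \<comment> \<open>The summand \<open>?S M\<close> of \<open>?F M\<close> pays for the bound on
      the value; the run fits into the rest.\<close>
    have "runs (comp (BSum v a b) d) s (?F M - ?S M)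
        (\<lambda>s'. s' (Suc d) = ev (BSum v a b) x r \<and> (\<forall>i\<le>d. s' i = s i))"
      unfolding comp.simps diff_add_inverse2
    proof (intro runs_Seq, rule comp_specD(2)[OF a M ea])
      fix s1 assume s1: "s1 (Suc d) = ev a x r \<and> (\<forall>i\<le>d. s1 i = s i)"
      show "runs (Assign (Suc (Suc d)) (Reg (Suc v))) s1 (Suc M)
        (\<lambda>s'. s' (Suc (Suc d)) = s (Suc v) \<and> s' (Suc d) = ev a x r \<and> (\<forall>i\<le>d. s' i = s i))"
        by (rule runs_Assign) (use s1 \<open>v < d\<close> val_cost_le[OF rv] in auto)
    next
      fix s2 assume s2: "s2 (Suc (Suc d)) = s (Suc v) \<and> s2 (Suc d) = ev a x r \<and> (\<forall>i\<le>d. s2 i = s i)"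
      show "runs (Assign (Suc v) (Reg (Suc d))) s2 (Suc (M ^ p))
        (\<lambda>s'. s' (Suc (Suc d)) = s (Suc v) \<and> s' (Suc v) = ev a x r \<and>
          (\<forall>i\<le>d. i \<noteq> Suc v \<longrightarrow> s' i = s i))"
        by (rule runs_Assign) (use s2 \<open>v < d\<close> val_cost_le[OF va] in auto)
    next
      fix s3 assume s3: "s3 (Suc (Suc d)) = s (Suc v) \<and> s3 (Suc v) = ev a x r \<and>
          (\<forall>i\<le>d. i \<noteq> Suc v \<longrightarrow> s3 i = s i)"
      show "runs (Assign (Suc d) (Const 0)) s3 1 (\<lambda>s'. s' (Suc v) = ?L \<and> ?Inv ?L s')"
        by (rule runs_Assign) (use s3 val_cost_le[of 0 0] \<open>v < d\<close> in auto)
    next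
      fix s4 assume s4: "s4 (Suc v) = ?L \<and> ?Inv ?L s4"
      let ?body = "Seq (comp b (Suc (Suc d)))
           (Assign (Suc d) (Plus (Reg (Suc d)) (Reg (Suc (Suc (Suc d))))))"
      have "runs (countdown (Suc v) ?body) s4
          (?L * (3 * ?L + 5 + ?C M) + 1) (\<lambda>s'. s' (Suc v) = 0 \<and> ?Inv 0 s')"
      proof (rule runs_countdown)
        fix i t assume i: "i < ?L" and t: "?Inv (Suc i) t" "t (Suc v) = Suc i"
        show "runs ?body (t(Suc v := i)) (?C M) (\<lambda>s'. s' (Suc v) = i \<and> ?Inv i s')"
        proof (rule runs_Seq)
          have e: "env_state (var_bound b) (M ^ Suc p) x (r(v := i)) (t(Suc v := i))"
            by (rule eb) (use i t in auto)
          show "runs (comp b (Suc (Suc d))) (t(Suc v := i)) (?B M)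
             (\<lambda>s'. s' (Suc (Suc (Suc d))) = ?g i \<and> s' (Suc v) = i \<and> ?Inv (Suc i) s')"
            by (rule runs_weaken[OF comp_specD(2)[OF b M' e]])
              (use t \<open>v < d\<close> in \<open>auto simp: power_mult simp del: power_Suc mult_Suc\<close>)
        next
          fix t1 assume t1: "t1 (Suc (Suc (Suc d))) = ?g i \<and> t1 (Suc v) = i \<and> ?Inv (Suc i) t1"
          have sm: "sum ?g {i..<?L} = sum ?g {Suc i..<?L} + ?g i"
            using i by (simp add: sum.atLeast_Suc_lessThan)
          have le: "?g i \<le> ?S M" using sums[of i] sm by linarith
          show "runs (Assign (Suc d) (Plus (Reg (Suc d)) (Reg (Suc (Suc (Suc d)))))) t1
             (Suc (?S M) + Suc (?S M) + Suc (?S M)) (\<lambda>s'. s' (Suc v) = i \<and> ?Inv i s')"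
          proof (rule runs_Assign)
            show "acost (Plus (Reg (Suc d)) (Reg (Suc (Suc (Suc d))))) t1
                \<le> Suc (?S M) + Suc (?S M) + Suc (?S M)"
              using t1 val_cost_le[OF sums[of "Suc i"]] val_cost_le[OF le]
                val_cost_le[OF sums[of i]] by (simp add: sm)
          qed (use t1 sm \<open>v < d\<close> in auto)
        qed
      qed (use s4 in auto)
      moreover have "?L * (3 * ?L + 5 + ?C M) + 1 \<le> M ^ p * (3 * M ^ p + 5 + ?C M) + 1"
        by (intro add_mono mult_mono) (use va in auto)
      ultimately show "runs (countdown (Suc v) ?body) s4
          (M ^ p * (3 * M ^ p + 5 + ?C M) + 1) (\<lambda>s'. s' (Suc v) = 0 \<and> ?Inv 0 s')"
        by (rule runs_weaken)
    next
      fix s5 assume s5: "s5 (Suc v) = 0 \<and> ?Inv 0 s5"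
      show "runs (Assign (Suc v) (Reg (Suc (Suc d)))) s5 (Suc M)
        (\<lambda>s'. s' (Suc d) = ev (BSum v a b) x r \<and> (\<forall>i\<le>d. s' i = s i))"
        by (rule runs_Assign) (use s5 \<open>v < d\<close> val_cost_le[OF rv] in \<open>auto simp: lessThan_atLeast0\<close>)
    qed
    hence "runs (comp (BSum v a b) d) s (?F M)
        (\<lambda>s'. s' (Suc d) = ev (BSum v a b) x r \<and> (\<forall>i\<le>d. s' i = s i))"
      by (rule runs_weaken) auto
    moreover have "ev (BSum v a b) x r \<le> ?F M"
      using sums[of 0] ev_eq by linarith
    ultimately show "ev (BSum v a b) x r \<le> ?F M \<and> runs (comp (BSum v a b) d) s (?F M)
        (\<lambda>s'. s' (Suc d) = ev (BSum v a b) x r \<and> (\<forall>i\<le>d. s' i = s i))"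
      by blast
  qed
qed

text \<open>Exponents multiply under nested binders, but they depend only on the expression and the
  register offset, never on the input.\<close>

theorem comp_correct: "var_bound e \<le> d \<Longrightarrow> \<exists>p. comp_spec e d (\<lambda>M. M ^ p)"
proof (induction e arbitrary: d)
  case (Num c)
  show ?case
  proof (rule comp_spec_poly)
    show "poly_bounded (\<lambda>M. Suc c)" by (intro poly_bounded_intros)
    show "comp_spec (Num c) d (\<lambda>M. Suc c)"
      unfolding comp_spec_def using val_cost_le[of c c] by (auto intro!: runs_Assign)
  qed
next
  case (Var i)
  show ?case
  proof (rule comp_spec_poly)
    show "poly_bounded (\<lambda>M. Suc M)" by (intro poly_bounded_intros)
    show "comp_spec (Var i) d (\<lambda>M. Suc M)"
      unfolding comp_spec_def env_state_def by (auto intro!: runs_Assign val_cost_le intro: le_SucI)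
  qed
next
  case (Add a b)
  obtain p q where "comp_spec a d (\<lambda>M. M ^ p)" "comp_spec b (Suc d) (\<lambda>M. M ^ q)"
    using Add.IH(1)[of d] Add.IH(2)[of "Suc d"] Add.prems by auto
  thus ?case
    using Add.prems by (intro comp_spec_binop[where a = a and b = b and f = Plus and g = "(+)"]) auto
next
  case (Sub a b)
  obtain p q where "comp_spec a d (\<lambda>M. M ^ p)" "comp_spec b (Suc d) (\<lambda>M. M ^ q)"
    using Sub.IH(1)[of d] Sub.IH(2)[of "Suc d"] Sub.prems by auto
  thus ?case
    using Sub.prems by (intro comp_spec_binop[where a = a and b = b and f = Minus and g = "(-)"]) auto
next
  case (Mul a b)
  obtain p q where "comp_spec a d (\<lambda>M. M ^ p)" "comp_spec b (Suc d) (\<lambda>M. M ^ q)"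
    using Mul.IH(1)[of d] Mul.IH(2)[of "Suc d"] Mul.prems by auto
  thus ?case
    using Mul.prems by (intro comp_spec_binop[where a = a and b = b and f = Times and g = "(*)"]) auto
next
  case (Quo a b)
  have le: "u div v \<le> (u + 1) * (v + 1)" for u v :: nat
    by (rule order.trans[OF div_le_dividend]) simp
  obtain p q where "comp_spec a d (\<lambda>M. M ^ p)" "comp_spec b (Suc d) (\<lambda>M. M ^ q)"
    using Quo.IH(1)[of d] Quo.IH(2)[of "Suc d"] Quo.prems by auto
  thus ?case
    using Quo.prems le
    by (intro comp_spec_binop[where a = a and b = b and f = Div and g = "(div)"]) auto
next
  case (Bit a)
  thus ?case using comp_spec_Bit[of a d] by fastforce
next
  case (BSum v a b)
  obtain p q where "comp_spec a d (\<lambda>M. M ^ p)" "comp_spec b (Suc (Suc d)) (\<lambda>M. M ^ q)"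
    using BSum.IH(1)[of d] BSum.IH(2)[of "Suc (Suc d)"] BSum.prems by auto
  thus ?case
    using BSum.prems by (intro comp_spec_BSum) auto
next
  case (Bind v a b)
  obtain p q where "comp_spec a d (\<lambda>M. M ^ p)" "comp_spec b (Suc (Suc d)) (\<lambda>M. M ^ q)"
    using Bind.IH(1)[of d] Bind.IH(2)[of "Suc (Suc d)"] Bind.prems by auto
  thus ?case
    using Bind.prems by (intro comp_spec_Bind) auto
qed

section \<open>Composition of fpt-reductions\<close>

primrec clear :: "nat \<Rightarrow> nat \<Rightarrow> com" where
  "clear a 0 = Assign a (Const 0)"
| "clear a (Suc n) = Seq (clear a n) (Assign (a + Suc n) (Const 0))"

lemma runs_clear:
  "runs (clear a n) s (Suc n) (\<lambda>s'. s' = (\<lambda>i. if a \<le> i \<and> i \<le> a + n then 0 else s i))"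
proof (induction n)
  case 0
  show ?case
    unfolding clear.simps by (rule runs_Assign) (use val_cost_le[of 0 0] in auto)
next
  case (Suc n)
  have "runs (Seq (clear a n) (Assign (a + Suc n) (Const 0))) s (Suc n + 1)
     (\<lambda>s'. s' = (\<lambda>i. if a \<le> i \<and> i \<le> a + Suc n then 0 else s i))"
    by (rule runs_Seq[OF Suc], rule runs_Assign) (use val_cost_le[of 0 0] in auto)
  thus ?case by simp
qed

section \<open>Programs confined to the low registers\<close>

primrec aexp_bound :: "aexp \<Rightarrow> nat" where
  "aexp_bound (Const n) = 0"
| "aexp_bound (Reg i) = Suc i"
| "aexp_bound (Plus a b) = max (aexp_bound a) (aexp_bound b)"
| "aexp_bound (Minus a b) = max (aexp_bound a) (aexp_bound b)"
| "aexp_bound (Times a b) = max (aexp_bound a) (aexp_bound b)"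
| "aexp_bound (Div a b) = max (aexp_bound a) (aexp_bound b)"

primrec com_bound :: "com \<Rightarrow> nat" where
  "com_bound (Assign i a) = max (Suc i) (aexp_bound a)"
| "com_bound (Seq c1 c2) = max (com_bound c1) (com_bound c2)"
| "com_bound (Cond b c1 c2) = max (aexp_bound b) (max (com_bound c1) (com_bound c2))"
| "com_bound (While b c) = max (aexp_bound b) (com_bound c)"

lemma aval_acost_frame:
  "aexp_bound a \<le> m \<Longrightarrow> \<forall>i<m. u i = s i \<Longrightarrow> aval a u = aval a s \<and> acost a u = acost a s"
  by (induction a) auto

text \<open>Registers from \<open>com_bound\<close> on are neither read nor written, so data parked
  there survives. This allows running two programs in sequence that both expect a fresh
  memory.\<close>

lemma exec_frame:
  "exec c s t s' \<Longrightarrow> com_bound c \<le> m \<Longrightarrow> \<forall>i<m. u i = s i \<Longrightarrow>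
   \<exists>u'. exec c u t u' \<and> (\<forall>i<m. u' i = s' i) \<and> (\<forall>i\<ge>m. u' i = u i)"
proof (induction arbitrary: u rule: exec.induct)
  case (Assign i a s)
  hence "aval a u = aval a s" "acost a u = acost a s"
    using aval_acost_frame[of a m u s] by auto
  hence "exec (Assign i a) u (acost a s) (u(i := aval a s))"
    using exec.Assign[of i a u] by simp
  moreover have "\<forall>j<m. (u(i := aval a s)) j = (s(i := aval a s)) j"
      "\<forall>j\<ge>m. (u(i := aval a s)) j = u j"
    using Assign.prems by auto
  ultimately show ?case
    by (intro exI[of _ "u(i := aval a s)"] conjI)
next
  case (Seq c1 s t1 s' c2 t2 s'')
  obtain u1 where 1: "exec c1 u t1 u1" "\<forall>i<m. u1 i = s' i" "\<forall>i\<ge>m. u1 i = u i"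
    using Seq.IH(1)[of u] Seq.prems by auto
  obtain u2 where "exec c2 u1 t2 u2" "\<forall>i<m. u2 i = s'' i" "\<forall>i\<ge>m. u2 i = u1 i"
    using Seq.IH(2)[of u1] Seq.prems 1 by auto
  hence "exec (Seq c1 c2) u (t1 + t2) u2 \<and> (\<forall>i<m. u2 i = s'' i) \<and> (\<forall>i\<ge>m. u2 i = u i)"
    using exec.Seq[OF 1(1)] 1 by simp
  thus ?case by blast
next
  case (CondTrue b s c1 t s' c2)
  have b: "aval b u = aval b s" "acost b u = acost b s"
    using aval_acost_frame[of b m u s] CondTrue.prems by auto
  obtain u1 where 1: "exec c1 u t u1" "\<forall>i<m. u1 i = s' i" "\<forall>i\<ge>m. u1 i = u i"
    using CondTrue.IH[of u] CondTrue.prems by auto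
  have "exec (Cond b c1 c2) u (acost b s + t) u1"
    using exec.CondTrue[of b u c1, OF _ 1(1)] b CondTrue.hyps(1) by simp
  thus ?case using 1 by blast
next
  case (CondFalse b s c2 t s' c1)
  have b: "aval b u = aval b s" "acost b u = acost b s"
    using aval_acost_frame[of b m u s] CondFalse.prems by auto
  obtain u1 where 1: "exec c2 u t u1" "\<forall>i<m. u1 i = s' i" "\<forall>i\<ge>m. u1 i = u i"
    using CondFalse.IH[of u] CondFalse.prems by auto
  have "exec (Cond b c1 c2) u (acost b s + t) u1"
    using exec.CondFalse[of b u c2, OF _ 1(1)] b CondFalse.hyps(1) by simp
  thus ?case using 1 by blast
next
  case (WhileFalse b s c)
  have "aval b u = aval b s" "acost b u = acost b s"
    using aval_acost_frame[of b m u s] WhileFalse.prems by auto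
  hence "exec (While b c) u (acost b s) u"
    using exec.WhileFalse[of b u c] WhileFalse.hyps by simp
  thus ?case using WhileFalse.prems by blast
next
  case (WhileTrue b s c t1 s' t2 s'')
  have b: "aval b u = aval b s" "acost b u = acost b s"
    using aval_acost_frame[of b m u s] WhileTrue.prems by auto
  obtain u1 where 1: "exec c u t1 u1" "\<forall>i<m. u1 i = s' i" "\<forall>i\<ge>m. u1 i = u i"
    using WhileTrue.IH(1)[of u] WhileTrue.prems by auto
  obtain u2 where 2: "exec (While b c) u1 t2 u2" "\<forall>i<m. u2 i = s'' i" "\<forall>i\<ge>m. u2 i = u1 i"
    using WhileTrue.IH(2)[of u1] WhileTrue.prems 1 by auto
  have "exec (While b c) u (acost b s + t1 + t2) u2"
    using exec.WhileTrue[of b u c t1 u1 t2 u2] b WhileTrue.hyps(1) 1 2 by simp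
  moreover have "\<forall>i\<ge>m. u2 i = u i"
    using 1 2 by simp
  ultimately show ?case using 2 by blast
qed

text \<open>A written value has been charged for its binary length, so lengths grow by at most the
  time spent. For register 0 this bounds the output length of a reduction.\<close>

lemma exec_floorlog_le: "exec c s t s' \<Longrightarrow> floorlog 2 (s' i) \<le> floorlog 2 (s i) + t"
proof (induction arbitrary: i rule: exec.induct)
  case (Assign j a s)
  have "floorlog 2 (aval a s) \<le> acost a s"
    by (cases a) (auto simp: val_cost_def)
  thus ?case by simp
next
  case (Seq c1 s t1 s' c2 t2 s'')
  show ?case using Seq.IH(1)[of i] Seq.IH(2)[of i] by linarith
next
  case (CondTrue b s c1 t s' c2)
  show ?case using CondTrue.IH[of i] by linarith
next
  case (CondFalse b s c2 t s' c1)
  show ?case using CondFalse.IH[of i] by linarith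
next
  case (WhileTrue b s c t1 s' t2 s'')
  show ?case using WhileTrue.IH(1)[of i] WhileTrue.IH(2)[of i] by linarith
qed simp

text \<open>Both programs assume that all registers but the input are zero. Input and first result
  are therefore parked in registers \<open>m\<close> and \<open>m + 1\<close>, beyond the reach of
  either program, and the registers below \<open>m\<close> are cleared in between.\<close>

lemma computable_binop:
  assumes "computable f" "computable g"
    and op: "\<And>a b s. aval (op a b) s = h (aval a s) (aval b s)"
  shows "computable (\<lambda>n. h (f n) (g n))"
proof -
  let ?init = "\<lambda>n. (\<lambda>_. 0)(0 := n) :: state"
  obtain c1 where c1: "\<And>n. \<exists>t s'. exec c1 (?init n) t s' \<and> s' 0 = f n"
    using assms(1) unfolding computable_def by blast
  obtain c2 where c2: "\<And>n. \<exists>t s'. exec c2 (?init n) t s' \<and> s' 0 = g n"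
    using assms(2) unfolding computable_def by blast
  define m where "m = Suc (max (com_bound c1) (com_bound c2))"
  have m: "com_bound c1 \<le> m" "com_bound c2 \<le> m" "0 < m" by (auto simp: m_def)
  define c where "c = Seq (Assign m (Reg 0)) (Seq c1 (Seq (Assign (Suc m) (Reg 0))
      (Seq (clear 0 (m - 1)) (Seq (Assign 0 (Reg m)) (Seq c2
        (Assign 0 (op (Reg (Suc m)) (Reg 0))))))))"
  have "\<exists>t s'. exec c (?init n) t s' \<and> s' 0 = h (f n) (g n)" for n
  proof -
    have a1: "exec (Assign m (Reg 0)) (?init n) (acost (Reg 0) (?init n)) ((?init n)(m := n))"
      using exec.Assign[of m "Reg 0" "?init n"] by simp
    obtain t1 s1 where 1: "exec c1 (?init n) t1 s1" "s1 0 = f n"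
      using c1 by blast
    obtain u1 where u1: "exec c1 ((?init n)(m := n)) t1 u1" "\<forall>i<m. u1 i = s1 i"
        "\<forall>i\<ge>m. u1 i = ((?init n)(m := n)) i"
      using exec_frame[OF 1(1), of m "(?init n)(m := n)"] m by auto
    define u2 where "u2 = u1(Suc m := f n)"
    have a2: "exec (Assign (Suc m) (Reg 0)) u1 (acost (Reg 0) u1) u2"
      using exec.Assign[of "Suc m" "Reg 0" u1] u1 1(2) by (simp add: u2_def m_def)
    obtain t3 where a3: "exec (clear 0 (m - 1)) u2 t3 (\<lambda>i. if i \<le> m - 1 then 0 else u2 i)"
      using runs_clear[of 0 "m - 1" u2] unfolding runs_def by auto
    define u3 where "u3 = (\<lambda>i. if i \<le> m - 1 then 0 else u2 i)"
    have u3m: "u3 m = n" "u3 (Suc m) = f n"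
      using u1(3) by (auto simp: u3_def u2_def m_def)
    have a4: "exec (Assign 0 (Reg m)) u3 (acost (Reg m) u3) (u3(0 := n))"
      using exec.Assign[of 0 "Reg m" u3] by (simp add: u3m)
    obtain t5 s5 where 5: "exec c2 (?init n) t5 s5" "s5 0 = g n"
      using c2 by blast
    have "\<forall>i<m. (u3(0 := n)) i = (?init n) i"
      by (auto simp: u3_def)
    then obtain u5 where u5: "exec c2 (u3(0 := n)) t5 u5" "\<forall>i<m. u5 i = s5 i"
        "\<forall>i\<ge>m. u5 i = (u3(0 := n)) i"
      using exec_frame[OF 5(1), of m "u3(0 := n)"] m by blast
    have "u5 (Suc m) = (u3(0 := n)) (Suc m)"
      using u5(3) by (simp del: fun_upd_apply)
    hence "u5 (Suc m) = f n" "u5 0 = g n"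
      using u5(2) u3m 5(2) m by auto
    hence a6: "exec (Assign 0 (op (Reg (Suc m)) (Reg 0))) u5
        (acost (op (Reg (Suc m)) (Reg 0)) u5) (u5(0 := h (f n) (g n)))"
      using exec.Assign[of 0 "op (Reg (Suc m)) (Reg 0)" u5] by (simp add: op)
    show ?thesis
      unfolding c_def
      using exec.Seq[OF a1 exec.Seq[OF u1(1) exec.Seq[OF a2 exec.Seq[OF a3[folded u3_def]
        exec.Seq[OF a4 exec.Seq[OF u5(1) a6]]]]]]
      by fastforce
  qed
  thus ?thesis unfolding computable_def by blast
qed

lemma computable_add: "computable f \<Longrightarrow> computable g \<Longrightarrow> computable (\<lambda>n. f n + g n)"
  by (rule computable_binop[where op = Plus]) auto

lemma computable_mult: "computable f \<Longrightarrow> computable g \<Longrightarrow> computable (\<lambda>n. f n * g n)"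
  by (rule computable_binop[where op = Times]) auto

lemma computable_const: "computable (\<lambda>n. c)"
  unfolding computable_def using exec.Assign[of 0 "Const c"] by fastforce

lemma computable_power: "computable f \<Longrightarrow> computable (\<lambda>n. f n ^ q)"
  by (induction q) (simp_all add: computable_const computable_mult)

section \<open>Strings as binary numerals\<close>

lemma string_num_Nil: "string_num [] = 1"
  by (simp add: string_num_def)

lemma string_num_Cons: "string_num (b # y) = of_bool b + 2 * string_num y"
  by (simp add: string_num_def)

lemma string_num_pos: "0 < string_num y"
  by (induction y) (auto simp: string_num_Nil string_num_Cons)

lemma string_num_Cons_div: "string_num (b # y) div 2 = string_num y"
  by (simp add: string_num_Cons)

lemma floorlog_string_num: "floorlog 2 (string_num y) = Suc (length y)"
proof (induction y)
  case Nil
  have "floorlog 2 1 = Suc (floorlog 2 0)"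
    by (subst compute_floorlog) simp
  thus ?case by (simp add: string_num_Nil floorlog_def)
next
  case (Cons b y)
  have "floorlog 2 (string_num (b # y)) = Suc (floorlog 2 (string_num (b # y) div 2))"
    by (subst compute_floorlog) (simp add: string_num_pos)
  thus ?case by (simp add: string_num_Cons_div Cons)
qed

lemma string_num_bit: "i < length y \<Longrightarrow> string_num y div 2 ^ i mod 2 = of_bool (y ! i)"
proof (induction y arbitrary: i)
  case (Cons b y)
  show ?case
  proof (cases i)
    case 0
    thus ?thesis by (simp add: string_num_Cons)
  next
    case (Suc j)
    hence "string_num (b # y) div 2 ^ i = string_num y div 2 ^ j"
      by (simp add: div_mult2_eq string_num_Cons_div)
    thus ?thesis using Cons Suc by simp
  qed
qed simp

text \<open>All registers but 0 and 1 are arbitrary, because the program will run after another one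
  that leaves garbage behind.\<close>

definition poly_time_reduction :: "(bool list \<times> nat \<Rightarrow> bool list \<times> nat) \<Rightarrow> bool" where
  "poly_time_reduction R \<longleftrightarrow> (\<exists>c q. \<forall>x k s. s 0 = string_num x \<longrightarrow> s 1 = k \<longrightarrow>
     runs c s ((length x + k + 2) ^ q)
       (\<lambda>s'. s' 0 = string_num (fst (R (x, k))) \<and> s' 1 = snd (R (x, k))))"

text \<open>The second program sees a string of length at most \<open>length x + t1\<close> and a
  parameter of at most \<open>g k\<close>. Its polynomial bound splits into a power of
  \<open>f k + (g k + 2)\<close> and a power of \<open>length x + 1\<close>, which is again an fpt
  bound.\<close>

theorem fpt_reduction_comp:
  assumes red: "fpt_reduction R1 L1 L2"
    and iff: "\<And>I. I \<in> L2 \<longleftrightarrow> R2 I \<in> L3"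
    and time: "poly_time_reduction R2"
    and param: "\<And>x k. snd (R2 (x, k)) \<le> (k + 2) ^ a"
  shows "fpt_reduction (\<lambda>I. R2 (R1 I)) L1 L3"
proof -
  obtain g where g: "computable g" "\<And>x k. snd (R1 (x, k)) \<le> g k"
    using red unfolding fpt_reduction_def by blast
  obtain c1 f p where f: "computable f" and c1: "\<And>x k. \<exists>t s'.
      exec c1 ((\<lambda>_. 0)(0 := string_num x, 1 := k)) t s' \<and>
      s' 0 = string_num (fst (R1 (x, k))) \<and> s' 1 = snd (R1 (x, k)) \<and> t \<le> f k * (length x + 1) ^ p"
    using red unfolding fpt_reduction_def fpt_time_computable_def by blast
  obtain c2 q where c2: "\<And>x k s. s 0 = string_num x \<Longrightarrow> s 1 = k \<Longrightarrow>
     runs c2 s ((length x + k + 2) ^ q)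
       (\<lambda>s'. s' 0 = string_num (fst (R2 (x, k))) \<and> s' 1 = snd (R2 (x, k)))"
    using time unfolding poly_time_reduction_def by blast
  let ?f = "\<lambda>k. f k + (f k + (g k + 2)) ^ q"
  let ?p = "p + (p + 1) * q"
  have "fpt_time_computable (\<lambda>I. R2 (R1 I))"
    unfolding fpt_time_computable_def
  proof (rule exI[of _ "Seq c1 c2"], rule exI[of _ ?f], rule exI[of _ ?p], intro conjI allI)
    show "computable ?f"
      by (intro computable_add computable_power computable_const f g)
    fix x k
    let ?s = "(\<lambda>_. 0)(0 := string_num x, 1 := k)"
    let ?l = "length x + 1"
    obtain t1 s1 where 1: "exec c1 ?s t1 s1" "s1 0 = string_num (fst (R1 (x, k)))"
        "s1 1 = snd (R1 (x, k))" "t1 \<le> f k * ?l ^ p"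
      using c1 by blast
    obtain t2 s2 where 2: "exec c2 s1 t2 s2"
        "t2 \<le> (length (fst (R1 (x, k))) + snd (R1 (x, k)) + 2) ^ q"
        "s2 0 = string_num (fst (R2 (R1 (x, k))))" "s2 1 = snd (R2 (R1 (x, k)))"
      using c2[OF 1(2,3)] unfolding runs_def by auto
    have pos: "1 \<le> ?l ^ j" for j by simp
    have "length (fst (R1 (x, k))) \<le> length x + t1"
      using exec_floorlog_le[OF 1(1), of 0] 1(2) by (simp add: floorlog_string_num)
    hence "length (fst (R1 (x, k))) + snd (R1 (x, k)) + 2 \<le> ?l + f k * ?l ^ p + (g k + 1)"
      using 1(4) g(2)[of x k] by linarith
    \<comment> \<open>All summands are padded to multiples of \<open>?l ^ Suc p\<close>, so that the
      parameter can be factored out before raising to the power \<open>q\<close>.\<close>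
    also have "\<dots> \<le> ?l ^ Suc p + f k * ?l ^ Suc p + (g k + 1) * ?l ^ Suc p"
    proof (intro add_mono)
      show "?l \<le> ?l ^ Suc p" by (rule self_le_power) simp_all
      show "f k * ?l ^ p \<le> f k * ?l ^ Suc p" by simp
      show "g k + 1 \<le> (g k + 1) * ?l ^ Suc p" using mult_le_mono2[OF pos[of "Suc p"], of "g k + 1"] by (simp only: mult_1_right)
    qed
    also have "\<dots> = (f k + (g k + 2)) * ?l ^ Suc p"
      by (simp add: algebra_simps)
    finally have "t2 \<le> ((f k + (g k + 2)) * ?l ^ Suc p) ^ q"
      using 2(2) by (meson le_trans power_mono zero_le)
    also have "\<dots> = (f k + (g k + 2)) ^ q * ?l ^ ((p + 1) * q)"
      by (simp only: power_mult_distrib Suc_eq_plus1 flip: power_mult)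
    also have "\<dots> \<le> (f k + (g k + 2)) ^ q * ?l ^ ?p"
      by (intro mult_left_mono power_increasing) auto
    finally have "t2 \<le> (f k + (g k + 2)) ^ q * ?l ^ ?p" .
    moreover have "t1 \<le> f k * ?l ^ ?p"
      using 1(4) by (rule order.trans) (intro mult_left_mono power_increasing; simp)
    ultimately have "t1 + t2 \<le> ?f k * ?l ^ ?p"
      by (simp add: add_mult_distrib)
    thus "\<exists>t s'. exec (Seq c1 c2) ?s t s' \<and> s' 0 = string_num (fst (R2 (R1 (x, k)))) \<and>
        s' 1 = snd (R2 (R1 (x, k))) \<and> t \<le> ?f k * (length x + 1) ^ ?p"
      using exec.Seq[OF 1(1) 2(1)] 2 by blast
  qed
  moreover have "\<exists>h. computable h \<and> (\<forall>x k. snd (R2 (R1 (x, k))) \<le> h k)"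
  proof (intro exI conjI allI)
    show "computable (\<lambda>k. (g k + 2) ^ a)"
      by (intro computable_power computable_add computable_const g)
    fix x k
    have "snd (R2 (R1 (x, k))) \<le> (snd (R1 (x, k)) + 2) ^ a"
      using param[of "fst (R1 (x, k))" "snd (R1 (x, k))"] by simp
    also have "\<dots> \<le> (g k + 2) ^ a"
      using g(2) by (intro power_mono) auto
    finally show "snd (R2 (R1 (x, k))) \<le> (g k + 2) ^ a" .
  qed
  moreover have "I \<in> L1 \<longleftrightarrow> R2 (R1 I) \<in> L3" for I
    using red iff unfolding fpt_reduction_def by blast
  ultimately show ?thesis
    unfolding fpt_reduction_def by blast
qed

text \<open>The numeral has one digit more than the string, the end marker; halving once before the
  loop discounts it.\<close>

definition length_prog :: com where
  "length_prog = Seq (Assign 3 (Div (Reg 0) (Const 2))) (While (Reg 3)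
     (Seq (Assign 3 (Div (Reg 3) (Const 2))) (Assign 2 (Plus (Reg 2) (Const 1)))))"

lemma runs_length_loop:
  assumes "s 3 = string_num y div 2" "s 2 + length y \<le> M"
  shows "runs (While (Reg 3)
     (Seq (Assign 3 (Div (Reg 3) (Const 2))) (Assign 2 (Plus (Reg 2) (Const 1)))))
     s (length y * (5 * M + 20) + 1) (\<lambda>s'. s' = s(2 := s 2 + length y, 3 := 0))"
  using assms
proof (induction y arbitrary: s)
  case Nil
  hence 3: "s 3 = 0" by (simp add: string_num_Nil)
  moreover have "val_cost 0 = 1" by (simp add: val_cost_def floorlog_def)
  ultimately show ?case
    using exec.WhileFalse[of "Reg 3" s] unfolding runs_def by (fastforce simp: fun_eq_iff)
next
  case (Cons b y)
  let ?d = "Assign 3 (Div (Reg 3) (Const 2))"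
  let ?a = "Assign 2 (Plus (Reg 2) (Const 1))"
  have 3: "s 3 = string_num y" using Cons.prems by (simp add: string_num_Cons_div)
  let ?s1 = "s(3 := string_num y div 2)" and ?s2 = "s(3 := string_num y div 2, 2 := s 2 + 1)"
  have d: "exec ?d s (acost (Div (Reg 3) (Const 2)) s) ?s1"
    using exec.Assign[of 3 "Div (Reg 3) (Const 2)" s] by (simp add: 3)
  have a: "exec ?a ?s1 (acost (Plus (Reg 2) (Const 1)) ?s1) ?s2"
    using exec.Assign[of 2 "Plus (Reg 2) (Const 1)" ?s1] by simp
  obtain t s3 where IH: "exec (While (Reg 3) (Seq ?d ?a)) ?s2 t s3"
      "t \<le> length y * (5 * M + 20) + 1" "s3 = ?s2(2 := ?s2 2 + length y, 3 := 0)"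
    using Cons.IH[of ?s2] Cons.prems unfolding runs_def by auto
  have s3: "s3 = s(2 := s 2 + length (b # y), 3 := 0)"
    using IH(3) by (auto simp: fun_eq_iff)
  have w: "exec (While (Reg 3) (Seq ?d ?a)) s (acost (Reg 3) s +
      (acost (Div (Reg 3) (Const 2)) s + acost (Plus (Reg 2) (Const 1)) ?s1) + t) s3"
    by (rule exec.WhileTrue[OF _ exec.Seq[OF d a] IH(1)]) (use 3 string_num_pos[of y] in simp)
  have c: "val_cost (string_num y) \<le> M + 2" "val_cost (string_num y div 2) \<le> M + 2"
    using Cons.prems floorlog_2_mono[of "string_num y div 2" "string_num y"]
    by (auto simp: val_cost_def floorlog_string_num)
  have "acost (Reg 3) s + (acost (Div (Reg 3) (Const 2)) s + acost (Plus (Reg 2) (Const 1)) ?s1)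
      \<le> 5 * M + 20"
    using c val_cost_le[of 2 2] val_cost_le[of 1 1] val_cost_le[of "s 2" M]
      val_cost_le[of "Suc (s 2)" M] Cons.prems
    by (simp add: 3)
  hence "acost (Reg 3) s + (acost (Div (Reg 3) (Const 2)) s + acost (Plus (Reg 2) (Const 1)) ?s1)
      + t \<le> length (b # y) * (5 * M + 20) + 1"
    using IH(2) by simp
  with w s3 show ?case
    unfolding runs_def by blast
qed

lemma runs_length_prog:
  assumes "s 0 = string_num x" "s 2 = 0"
  shows "runs length_prog s (2 * length x + 8 + (length x * (5 * length x + 20) + 1))
     (\<lambda>s'. s' = s(2 := length x, 3 := 0))"
  unfolding length_prog_def
proof (rule runs_Seq)
  have "val_cost (string_num x div 2) \<le> val_cost (string_num x)"
    using floorlog_2_mono[of "string_num x div 2" "string_num x"] by (simp add: val_cost_def)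
  moreover have "val_cost (string_num x) = length x + 2"
    by (simp add: val_cost_def floorlog_string_num)
  ultimately show "runs (Assign 3 (Div (Reg 0) (Const 2))) s (2 * length x + 8)
      (\<lambda>s'. s' = s(3 := string_num x div 2))"
    using assms val_cost_le[of 2 2] by (intro runs_Assign) auto
next
  fix s' assume "s' = s(3 := string_num x div 2)"
  thus "runs (While (Reg 3)
     (Seq (Assign 3 (Div (Reg 3) (Const 2))) (Assign 2 (Plus (Reg 2) (Const 1)))))
     s' (length x * (5 * length x + 20) + 1) (\<lambda>s'. s' = s(2 := length x, 3 := 0))"
    by (intro runs_weaken[OF runs_length_loop[of _ x "length x"]]) (use assms in \<open>auto simp: fun_eq_iff\<close>)
qed

section \<open>Writing the output\<close>

definition input_env :: "bool list \<Rightarrow> nat \<Rightarrow> nat \<Rightarrow> nat" where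
  "input_env x k = (\<lambda>_. 0)(0 := k, 1 := length x)"

text \<open>The loop counter is register 3, that is, variable 2 of \<open>bt\<close>. The output
  grows in register \<open>d + 1\<close> from the initial value 1, the end marker. The parameter is
  computed before register 0, which still holds the input, is overwritten.\<close>

definition output_prog :: "bexp \<Rightarrow> bexp \<Rightarrow> bexp \<Rightarrow> nat \<Rightarrow> com" where
  "output_prog sz bt par d =
     Seq (clear 2 d) (Seq length_prog (Seq (comp sz d)
    (Seq (Assign 3 (Reg (Suc d))) (Seq (Assign (Suc d) (Const 1))
    (Seq (countdown 3 (Seq (comp bt (Suc d))
       (Assign (Suc d) (Plus (Times (Reg (Suc d)) (Const 2)) (Reg (Suc (Suc d)))))))
    (Seq (comp par (Suc d)) (Seq (Assign 0 (Reg (Suc d))) (Assign 1 (Reg (Suc (Suc d)))))))))))"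

text \<open>The bits are produced from the last one to the first one.\<close>

lemma output_prog_correct:
  assumes bits: "\<And>x r. ev bt x r \<le> 1"
  shows "\<exists>c q. \<forall>x k s. s 0 = string_num x \<longrightarrow> s 1 = k \<longrightarrow>
     runs c s ((length x + k + 2) ^ q)
       (\<lambda>s'. s' 0 = string_num (map (\<lambda>j. ev bt (string_num x) ((input_env x k)(2 := j)) \<noteq> 0)
              [0..<ev sz (string_num x) (input_env x k)]) \<and>
          s' 1 = ev par (string_num x) (input_env x k))"
proof -
  define m where "m = max 3 (max (var_bound sz) (max (var_bound bt) (var_bound par)))"
  define d where "d = m"
  have vb: "var_bound sz \<le> m" "var_bound bt \<le> m" "var_bound par \<le> m" "3 \<le> m"
    by (auto simp: m_def)
  obtain p1 where p1: "comp_spec sz d (\<lambda>M. M ^ p1)"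
    using comp_correct[of sz d] vb d_def by auto
  obtain p2 where p2: "comp_spec bt (Suc d) (\<lambda>M. M ^ p2)"
    using comp_correct[of bt "Suc d"] vb d_def by auto
  obtain p3 where p3: "comp_spec par (Suc d) (\<lambda>M. M ^ p3)"
    using comp_correct[of par "Suc d"] vb d_def by auto
  let ?C = "\<lambda>M. M ^ (Suc p1 * p2) + (4 * M ^ p1 + 20)"
  let ?F = "\<lambda>M. Suc d + ((2 * M + 8 + (M * (5 * M + 20) + 1)) + (M ^ p1 + (Suc (M ^ p1) + (2 +
     ((M ^ p1 * (3 * M ^ p1 + 5 + ?C M) + 1) + (M ^ p3 + ((M ^ p1 + 2) + Suc (M ^ p3))))))))"
  have "poly_bounded ?F"
    by (intro poly_bounded_intros)
  then obtain q where q: "\<And>M. 2 \<le> M \<Longrightarrow> ?F M \<le> M ^ q"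
    unfolding poly_bounded_def by blast
  have "runs (output_prog sz bt par d) s ((length x + k + 2) ^ q)
       (\<lambda>s'. s' 0 = string_num (map (\<lambda>j. ev bt (string_num x) ((input_env x k)(2 := j)) \<noteq> 0)
              [0..<ev sz (string_num x) (input_env x k)]) \<and>
          s' 1 = ev par (string_num x) (input_env x k))"
    if s: "s 0 = string_num x" "s 1 = k" for x k s
  proof -
    define M where "M = length x + k + 2"
    define X where "X = string_num x"
    define r where "r = input_env x k"
    define f where "f j = (ev bt X (r(2 := j)) \<noteq> 0)" for j
    define L where "L = ev sz X r"
    have M: "2 \<le> M" and lM: "length x \<le> M" by (auto simp: M_def)
    define s0 :: state where "s0 = (\<lambda>i. if i = 0 then X else if i = 1 then k else if i = 2 then length x else 0)"
    have env: "env_state m M X r t" if "\<forall>i\<le>d. t i = s0 i" for t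
      unfolding env_state_def using that vb(4)
      by (auto simp: X_def floorlog_string_num M_def r_def input_env_def s0_def d_def)
    have el: "env_state (var_bound sz) M X r t" and ep: "env_state (var_bound par) M X r t"
      if "\<forall>i\<le>d. t i = s0 i" for t
      using env_state_mono[OF env[OF that]] vb by auto
    have LM: "L \<le> M ^ p1"
      unfolding L_def using comp_specD(1)[OF p1 M el[of s0]] by auto
    have LM': "L \<le> M ^ Suc p1"
      using LM le_power_Suc(1)[OF M] by (rule order.trans)
    have M': "2 \<le> M ^ Suc p1" using le_power_Suc(2)[OF M, of p1] M by linarith
    have eb: "env_state (var_bound bt) (M ^ Suc p1) X (r(2 := i)) t"
      if "i \<le> L" "t 3 = i" "\<forall>j\<le>d. j \<noteq> 3 \<longrightarrow> t j = s0 j" for i t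
    proof -
      have "env_state m (M ^ Suc p1) X (r(2 := i)) t"
        by (rule env_state_bound[OF env[of s0], of d])
          (use that vb LM' le_power_Suc(2)[OF M, of p1] in
            \<open>auto simp: d_def numeral_3_eq_3 numeral_2_eq_2 simp del: power_Suc\<close>)
      thus ?thesis by (rule env_state_mono) (use vb in auto)
    qed
    have pM: "ev par X r \<le> M ^ p3"
      using comp_specD(1)[OF p3 M ep[of s0]] by auto
    let ?out = "\<lambda>i. string_num (map f [i..<L])"
    have out_cost: "val_cost (?out i) \<le> L + 2" for i
      by (simp add: val_cost_def floorlog_string_num)
    let ?Inv = "\<lambda>i t. t (Suc d) = ?out i \<and> (\<forall>j\<le>d. j \<noteq> 3 \<longrightarrow> t j = s0 j)"
    have "runs (output_prog sz bt par d) s (?F M) (\<lambda>s'. s' 0 = ?out 0 \<and> s' 1 = ev par X r)"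
      unfolding output_prog_def
    proof (intro runs_Seq, rule runs_clear)
      fix s1 assume s1: "s1 = (\<lambda>i. if 2 \<le> i \<and> i \<le> 2 + d then 0 else s i)"
      show "runs length_prog s1 (2 * M + 8 + (M * (5 * M + 20) + 1)) (\<lambda>s'. \<forall>i\<le>d. s' i = s0 i)"
      proof (rule runs_weaken[OF runs_length_prog])
        show "2 * length x + 8 + (length x * (5 * length x + 20) + 1)
            \<le> 2 * M + 8 + (M * (5 * M + 20) + 1)"
          by (intro add_mono mult_mono) (use lM in auto)
        have "0 < i \<Longrightarrow> i \<noteq> 1 \<Longrightarrow> i \<noteq> 2 \<Longrightarrow> 2 \<le> i" for i :: nat by simp
        thus "\<forall>i\<le>d. s' i = s0 i" if "s' = s1(2 := length x, 3 := 0)" for s'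
          using s unfolding that s1 s0_def X_def by simp
      qed (use s1 s in auto)
    next
      fix s2 assume s2: "\<forall>i\<le>d. s2 i = s0 i"
      show "runs (comp sz d) s2 (M ^ p1) (\<lambda>s'. s' (Suc d) = L \<and> (\<forall>i\<le>d. s' i = s0 i))"
        by (rule runs_weaken[OF comp_specD(2)[OF p1 M el[OF s2]]]) (use s2 in \<open>auto simp: L_def\<close>)
    next
      fix s3 assume s3: "s3 (Suc d) = L \<and> (\<forall>i\<le>d. s3 i = s0 i)"
      show "runs (Assign 3 (Reg (Suc d))) s3 (Suc (M ^ p1))
         (\<lambda>s'. s' 3 = L \<and> (\<forall>j\<le>d. j \<noteq> 3 \<longrightarrow> s' j = s0 j))"
        by (rule runs_Assign) (use s3 val_cost_le[OF LM] in auto)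
    next
      fix s4 assume s4: "s4 3 = L \<and> (\<forall>j\<le>d. j \<noteq> 3 \<longrightarrow> s4 j = s0 j)"
      show "runs (Assign (Suc d) (Const 1)) s4 2 (\<lambda>s'. s' 3 = L \<and> ?Inv L s')"
        by (rule runs_Assign) (use s4 val_cost_le[of 1 1] vb(4) in \<open>auto simp: d_def string_num_Nil\<close>)
    next
      fix s5 assume s5: "s5 3 = L \<and> ?Inv L s5"
      let ?upd = "Plus (Times (Reg (Suc d)) (Const 2)) (Reg (Suc (Suc d)))"
      let ?body = "Seq (comp bt (Suc d)) (Assign (Suc d) ?upd)"
      have "runs (countdown 3 ?body) s5 (L * (3 * L + 5 + ?C M) + 1)
         (\<lambda>s'. s' 3 = 0 \<and> ?Inv 0 s')"
      proof (rule runs_countdown)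
        fix i t assume i: "i < L" and t: "?Inv (Suc i) t" "t 3 = Suc i"
        show "runs ?body (t(3 := i)) (?C M) (\<lambda>s'. s' 3 = i \<and> ?Inv i s')"
        proof (rule runs_Seq)
          have e: "env_state (var_bound bt) (M ^ Suc p1) X (r(2 := i)) (t(3 := i))"
            by (rule eb) (use i t in auto)
          show "runs (comp bt (Suc d)) (t(3 := i)) (M ^ (Suc p1 * p2))
            (\<lambda>s'. s' (Suc (Suc d)) = of_bool (f i) \<and> s' 3 = i \<and> ?Inv (Suc i) s')"
          proof (rule runs_weaken[OF comp_specD(2)[OF p2 M' e]])
            fix s' assume s': "s' (Suc (Suc d)) = ev bt X (r(2 := i)) \<and>
              (\<forall>j\<le>Suc d. s' j = (t(3 := i)) j)"
            have "ev bt X (r(2 := i)) = of_bool (f i)"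
              using bits[of X "r(2 := i)"] by (auto simp: f_def)
            thus "s' (Suc (Suc d)) = of_bool (f i) \<and> s' 3 = i \<and> ?Inv (Suc i) s'"
              using s' t vb(4) by (auto simp: d_def)
          qed (auto simp: power_mult simp del: power_Suc mult_Suc)
        next
          fix t1 assume t1: "t1 (Suc (Suc d)) = of_bool (f i) \<and> t1 3 = i \<and> ?Inv (Suc i) t1"
          \<comment> \<open>The first bit is the least significant one, so prepending a bit means
            doubling and adding.\<close>
          have eq: "?out i = ?out (Suc i) * 2 + of_bool (f i)"
            using i by (simp add: upt_rec[of i L] string_num_Cons)
          have c: "val_cost (?out (Suc i) * 2) \<le> L + 2" 
            using out_cost[of i] floorlog_2_mono[of "?out (Suc i) * 2" "?out i"] eq
            by (simp add: val_cost_def)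
          show "runs (Assign (Suc d) ?upd) t1 (4 * M ^ p1 + 20) (\<lambda>s'. s' 3 = i \<and> ?Inv i s')"
          proof (rule runs_Assign)
            have "val_cost (of_bool (f i)) \<le> 2"
              using val_cost_le[of "of_bool (f i)" 1] by (cases "f i") auto
            hence "acost ?upd t1 \<le> 3 * (L + 2) + 3 + 2"
              using t1 c out_cost[of i] out_cost[of "Suc i"] val_cost_le[of 2 2] eq
              by (simp split del: split_of_bool)
            thus "acost ?upd t1 \<le> 4 * M ^ p1 + 20" using LM by simp
          qed (use t1 eq vb(4) in \<open>auto simp: d_def\<close>)
        qed
      qed (use s5 in auto)
      moreover have "L * (3 * L + 5 + ?C M) + 1 \<le> M ^ p1 * (3 * M ^ p1 + 5 + ?C M) + 1"
        by (intro add_mono mult_mono) (use LM in auto)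
      ultimately show "runs (countdown 3 ?body) s5 (M ^ p1 * (3 * M ^ p1 + 5 + ?C M) + 1)
         (\<lambda>s'. s' 3 = 0 \<and> ?Inv 0 s')"
        by (rule runs_weaken)
    next
      fix s6 assume s6: "s6 3 = 0 \<and> ?Inv 0 s6"
      have "s6 i = s0 i" if "i \<le> d" for i
        using s6 that by (cases "i = 3") (auto simp: s0_def)
      hence e: "env_state (var_bound par) M X r s6"
        using ep by blast
      show "runs (comp par (Suc d)) s6 (M ^ p3)
        (\<lambda>s'. s' (Suc (Suc d)) = ev par X r \<and> s' (Suc d) = ?out 0)"
        by (rule runs_weaken[OF comp_specD(2)[OF p3 M e]]) (use s6 in auto)
    next
      fix s7 assume s7: "s7 (Suc (Suc d)) = ev par X r \<and> s7 (Suc d) = ?out 0"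
      show "runs (Assign 0 (Reg (Suc d))) s7 (M ^ p1 + 2)
        (\<lambda>s'. s' (Suc (Suc d)) = ev par X r \<and> s' 0 = ?out 0)"
        by (rule runs_Assign) (use s7 out_cost[of 0] LM in auto)
    next
      fix s8 assume s8: "s8 (Suc (Suc d)) = ev par X r \<and> s8 0 = ?out 0"
      show "runs (Assign 1 (Reg (Suc (Suc d)))) s8 (Suc (M ^ p3))
        (\<lambda>s'. s' 0 = ?out 0 \<and> s' 1 = ev par X r)"
        by (rule runs_Assign) (use s8 val_cost_le[OF pM] in auto)
    qed
    hence "runs (output_prog sz bt par d) s (M ^ q) (\<lambda>s'. s' 0 = ?out 0 \<and> s' 1 = ev par X r)"
      by (rule runs_weaken) (use q[OF M] in blast)+
    moreover have "f = (\<lambda>j. ev bt X (r(2 := j)) \<noteq> 0)"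
      by (simp add: fun_eq_iff f_def)
    ultimately show ?thesis
      by (simp only: M_def X_def r_def L_def)
  qed
  note main = this
  show ?thesis
    by (rule exI[of _ "output_prog sz bt par d"], rule exI[of _ q]) (intro allI impI main)
qed

section \<open>Hitting sets as Steiner trees\<close>

text \<open>The vertices form a grid with rows \<open>0, \<dots>, T\<close> and columns \<open>0, \<dots>, U\<close>. Row 0 consists of the
  root in column 0 and of one vertex per item. In row \<open>t + 1\<close>, which belongs to clause \<open>t\<close>, a hub in
  column 0 is joined in both directions with all other cells, and the item \<open>z\<close> has an
  arc to the cell in its column iff it hits the clause. Rows other than 0 consist of terminals,
  so they are free of charge and a hub is reached iff one item hitting its clause is chosen.\<close>

definition cell_arc :: "(nat \<Rightarrow> nat \<Rightarrow> bool) \<Rightarrow> nat \<Rightarrow> nat \<Rightarrow> nat \<Rightarrow> nat \<Rightarrow> bool" where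
  "cell_arc hit a b a' b' \<longleftrightarrow>
     a = 0 \<and> b = 0 \<and> a' = 0 \<and> 0 < b' \<or>
     a = 0 \<and> 0 < b \<and> 0 < a' \<and> b' = b \<and> hit (a' - 1) (b - 1) \<or>
     0 < a \<and> a = a' \<and> (b = 0) \<noteq> (b' = 0)"

definition hs_digraph :: "nat \<Rightarrow> nat \<Rightarrow> (nat \<Rightarrow> nat \<Rightarrow> bool) \<Rightarrow> nat pair_pre_digraph" where
  "hs_digraph T U hit = \<lparr>pverts = {..<Suc T * Suc U},
     parcs = {(u, v). u < Suc T * Suc U \<and> v < Suc T * Suc U \<and>
       cell_arc hit (u div Suc U) (u mod Suc U) (v div Suc U) (v mod Suc U)}\<rparr>"

definition hs_terminals :: "nat \<Rightarrow> nat \<Rightarrow> nat set" where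
  "hs_terminals T U = {Suc U..<Suc T * Suc U}"

lemma pverts_hs_digraph [simp]: "pverts (hs_digraph T U hit) = {..<Suc T * Suc U}"
  by (simp add: hs_digraph_def)

lemma parcs_hs_digraph: "(u, v) \<in> parcs (hs_digraph T U hit) \<longleftrightarrow>
   u < Suc T * Suc U \<and> v < Suc T * Suc U \<and>
   cell_arc hit (u div Suc U) (u mod Suc U) (v div Suc U) (v mod Suc U)"
  by (simp add: hs_digraph_def)

lemma row_pos_iff: "0 < v div Suc U \<longleftrightarrow> Suc U \<le> v"
  by (simp add: div_greater_zero_iff)

lemma pair_digraph_hs_digraph: "pair_digraph (hs_digraph T U hit)"
proof
  have "parcs (hs_digraph T U hit) \<subseteq> {..<Suc T * Suc U} \<times> {..<Suc T * Suc U}"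
    by (auto simp: parcs_hs_digraph)
  thus "finite (parcs (hs_digraph T U hit))"
    by (rule finite_subset) simp
qed (auto simp: parcs_hs_digraph cell_arc_def)

lemma dst_instance_hs_digraph:
  "dst_instance (Suc T * Suc U) (hs_digraph T U hit) 0 (hs_terminals T U)"
  unfolding dst_instance_def using pair_digraph_hs_digraph
  by (auto simp: hs_terminals_def)

lemma arcs_ends_induce:
  "(u, v) \<in> arcs_ends (with_proj D \<restriction> A) \<longleftrightarrow> (u, v) \<in> parcs D \<and> u \<in> A \<and> v \<in> A"
  by (auto simp: arcs_ends_def arc_to_ends_def)

text \<open>The non-terminals other than the root are exactly the items, vertex \<open>v\<close>
  being item \<open>v - 1\<close>, so Steiner sets are item sets of the same size. A row is entered
  only at a leaf whose item hits the clause, and from there the hub spreads reachability over the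
  whole row.\<close>

lemma dst_solvable_hs_digraph:
  "dst_solvable (hs_digraph T U hit) 0 (hs_terminals T U) K \<longleftrightarrow>
     (\<exists>Z\<subseteq>{..<U}. card Z \<le> K \<and> (\<forall>t<T. \<exists>z\<in>Z. hit t z))"
proof
  let ?D = "hs_digraph T U hit" and ?R = "hs_terminals T U" and ?W = "Suc U"
  interpret pair_digraph ?D by (rule pair_digraph_hs_digraph)
  {
    assume "dst_solvable ?D 0 ?R K"
    then obtain S where S: "S \<subseteq> pverts ?D - (?R \<union> {0})" "card S \<le> K"
      and paths: "\<And>t. t \<in> ?R \<Longrightarrow> \<exists>p. pre_digraph.apath (with_proj ?D \<restriction> (S \<union> ?R \<union> {0})) 0 p t"
      unfolding dst_solvable_def by blast
    let ?G = "with_proj ?D \<restriction> (S \<union> ?R \<union> {0})"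
    interpret G: wf_digraph ?G by (rule wellformed_induce_subgraph)
    define Z where "Z = (\<lambda>v. v - 1) ` S"
    have S': "0 < v \<and> v < ?W" if "v \<in> S" for v
      using S(1) that by (auto simp: hs_terminals_def)
    have "Z \<subseteq> {..<U}"
      using S' unfolding Z_def by fastforce
    moreover have "card Z \<le> K"
      using S card_image_le[of S "\<lambda>v. v - 1"] finite_subset[OF S(1)] by (simp add: Z_def)
    moreover have "\<exists>z\<in>Z. hit t z" if "t < T" for t
    proof -
      \<comment> \<open>Invariant of reachability. The root leads to row 0 only, a chosen item leads
        only to rows that it hits, and the arcs leaving a cell of a clause row stay in that
        row.\<close>
      let ?P = "\<lambda>v. v = 0 \<or> v \<in> S \<or> (?W \<le> v \<and> (\<exists>z\<in>Z. hit (v div ?W - 1) z))"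
      have step: "?P v" if u: "?P u" and uv: "(u, v) \<in> arcs_ends ?G" for u v
      proof -
        have v: "v \<in> S \<union> ?R \<union> {0}"
          and c: "cell_arc hit (u div ?W) (u mod ?W) (v div ?W) (v mod ?W)"
          using uv unfolding arcs_ends_induce parcs_hs_digraph by auto
        consider "u = 0" | "u \<in> S" | "?W \<le> u" "\<exists>z\<in>Z. hit (u div ?W - 1) z"
          using u by blast
        thus ?thesis
        proof cases
          case 1
          hence "v div ?W = 0"
            using c by (auto simp: cell_arc_def)
          hence "v \<notin> ?R"
            using row_pos_iff[of v U] by (simp add: hs_terminals_def)
          thus ?thesis using v by auto
        next
          case 2
          have "u div ?W = 0" "u mod ?W = u" "0 < u"
            using S'[OF 2] by auto
          hence "0 < v div ?W" "hit (v div ?W - 1) (u - 1)"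
            using c unfolding cell_arc_def by auto
          thus ?thesis
            using 2 row_pos_iff[of v U] unfolding Z_def by auto
        next
          case 3
          hence "v div ?W = u div ?W"
            using c row_pos_iff[of u U] unfolding cell_arc_def by auto
          thus ?thesis
            using 3 row_pos_iff[of u U] row_pos_iff[of v U] by auto
        qed
      qed
      \<comment> \<open>The hub of clause \<open>t\<close>, in row \<open>t + 1\<close> and column
        0.\<close>
      let ?h = "Suc t * ?W"
      have "?h < Suc T * ?W"
        using that by (intro mult_strict_right_mono) auto
      hence h: "?h \<in> ?R" by (simp add: hs_terminals_def)
      have "0 \<rightarrow>\<^sup>*\<^bsub>?G\<^esub> ?h"
        using paths[OF h] G.reachable_apath by blast
      hence "?P ?h"
        by (induction rule: G.reachable_induct) (use step in blast)+
      moreover have "?h \<notin> S" using S' by fastforce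
      moreover have "?h div ?W = Suc t" by (rule nonzero_mult_div_cancel_right) simp
      ultimately show ?thesis by auto
    qed
    ultimately show "\<exists>Z\<subseteq>{..<U}. card Z \<le> K \<and> (\<forall>t<T. \<exists>z\<in>Z. hit t z)"
      by blast
  }
  assume "\<exists>Z\<subseteq>{..<U}. card Z \<le> K \<and> (\<forall>t<T. \<exists>z\<in>Z. hit t z)"
  then obtain Z where Z: "Z \<subseteq> {..<U}" "card Z \<le> K" "\<And>t. t < T \<Longrightarrow> \<exists>z\<in>Z. hit t z"
    by blast
  define S where "S = Suc ` Z"
  let ?A = "S \<union> ?R \<union> {0}"
  let ?G = "with_proj ?D \<restriction> ?A"
  interpret G: wf_digraph ?G by (rule wellformed_induce_subgraph)
  have SW: "v < ?W" if "v \<in> S" for v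
    using that Z(1) by (auto simp: S_def)
  have "?W \<le> Suc T * ?W" by simp
  have "S \<subseteq> pverts ?D - (?R \<union> {0})"
    using SW \<open>?W \<le> Suc T * ?W\<close> by (force simp: S_def hs_terminals_def simp del: mult_Suc)
  moreover have "card S \<le> K"
    using Z(2) by (simp add: S_def card_image)
  moreover have "\<exists>p. G.apath 0 p v" if v: "v \<in> ?R" for v
  proof -
    define a where "a = v div ?W"
    have vN: "v < Suc T * ?W" and "?W \<le> v"
      using v by (auto simp: hs_terminals_def)
    hence a: "0 < a" "a < Suc T"
      using row_pos_iff[of v U] by (auto simp: a_def less_mult_imp_div_less simp del: mult_Suc)
    hence "a - 1 < T" by linarith
    then obtain z where z: "z \<in> Z" "hit (a - 1) z"
      using Z(3) by blast
    have zU: "Suc z < ?W" using z Z(1) by auto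
    define c where "c b = a * ?W + b" for b
    have c: "c b div ?W = a" "c b mod ?W = b" "c b \<in> ?R" if "b < ?W" for b
    proof -
      show "c b div ?W = a" "c b mod ?W = b"
        using that div_mult_self3[of ?W a b] mod_mult_self3[of a ?W b] unfolding c_def
        by (simp_all del: mult_Suc_right)
      have "c b < Suc a * ?W" using that by (simp add: c_def)
      also have "\<dots> \<le> Suc T * ?W" using a by (intro mult_right_mono) auto
      finally show "c b \<in> ?R"
        using a row_pos_iff[of "c b" U] \<open>c b div ?W = a\<close> by (simp add: hs_terminals_def)
    qed
    have N: "w < Suc T * ?W" if "w \<in> ?A" for w
      using that SW \<open>?W \<le> Suc T * ?W\<close> by (fastforce simp: hs_terminals_def)
    have arc: "u \<rightarrow>\<^bsub>?G\<^esub> w"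
      if "u \<in> ?A" "w \<in> ?A" "cell_arc hit (u div ?W) (u mod ?W) (w div ?W) (w mod ?W)" for u w
      unfolding arcs_ends_induce parcs_hs_digraph using that N by blast
    have "Suc z \<in> ?A" using z by (simp add: S_def)
    \<comment> \<open>The route to a cell of row \<open>a\<close> is root, item \<open>z\<close>,
      leaf of \<open>z\<close>, hub, cell.\<close>
    have 1: "0 \<rightarrow>\<^bsub>?G\<^esub> Suc z"
      by (rule arc) (use \<open>Suc z \<in> ?A\<close> zU in \<open>auto simp: cell_arc_def\<close>)
    have 2: "Suc z \<rightarrow>\<^bsub>?G\<^esub> c (Suc z)"
      by (rule arc) (use \<open>Suc z \<in> ?A\<close> zU c z a in \<open>auto simp: cell_arc_def\<close>)
    have 3: "c (Suc z) \<rightarrow>\<^bsub>?G\<^esub> c 0"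
      by (rule arc) (use zU c a in \<open>auto simp: cell_arc_def\<close>)
    have 4: "c 0 \<rightarrow>\<^sup>*\<^bsub>?G\<^esub> v"
    proof (cases "v mod ?W = 0")
      case True
      hence "v = c 0" by (metis a_def add.right_neutral c_def div_mod_decomp)
      moreover have "c 0 \<in> verts ?G" using c(3)[of 0] by simp
      ultimately show ?thesis using G.reachable_refl[of "c 0"] by (simp only:)
    next
      case False
      have "c 0 \<rightarrow>\<^bsub>?G\<^esub> v"
        by (rule arc) (use c a v False in \<open>auto simp: cell_arc_def a_def\<close>)
      thus ?thesis by blast
    qed
    have "0 \<rightarrow>\<^sup>*\<^bsub>?G\<^esub> v"
      using 1 2 3 4 by (meson G.reachable_adjI G.reachable_trans)
    thus ?thesis using G.reachable_apath by blast
  qed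
  ultimately show "dst_solvable ?D 0 ?R K"
    unfolding dst_solvable_def by blast
qed

text \<open>Elimination order: first the cells outside row and column 0, which have degree at most 2, then
  the items, which are left with the root only, and finally the root and the hubs.\<close>

lemma degeneracy_hs_digraph: "digraph_degeneracy (hs_digraph T U hit) \<le> 2"
  unfolding digraph_degeneracy_def degeneracy_def
proof (rule Least_le, intro allI impI)
  let ?D = "hs_digraph T U hit" and ?W = "Suc U"
  fix X F
  assume "X \<subseteq> pverts ?D \<and> X \<noteq> {} \<and> F \<subseteq> underlying_edges ?D \<and> \<Union> F \<subseteq> X"
  hence ne: "X \<noteq> {}" and FX: "\<And>e. e \<in> F \<Longrightarrow> e \<subseteq> X"
    and FE: "\<And>e. e \<in> F \<Longrightarrow> \<exists>u v. e = {u, v} \<and>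
       cell_arc hit (u div ?W) (u mod ?W) (v div ?W) (v mod ?W)"
    by (auto simp: underlying_edges_def parcs_hs_digraph)
  have small: "card {e \<in> F. w \<in> e} \<le> 2" if "{e \<in> F. w \<in> e} \<subseteq> {{w, x}, {w, y}}" for w x y
  proof -
    have "card {e \<in> F. w \<in> e} \<le> card {{w, x}, {w, y}}"
      by (rule card_mono[OF _ that]) simp
    also have "\<dots> \<le> 2" by (simp add: card_insert_if)
    finally show ?thesis .
  qed
  have eqI: "u = v" if "u div ?W = v div ?W" "u mod ?W = v mod ?W" for u v
    using that by (metis div_mod_decomp)
  consider (inner) w where "w \<in> X" "0 < w div ?W" "0 < w mod ?W"
    | (item) w where "w \<in> X" "w div ?W = 0" "0 < w mod ?W"
        "\<forall>v\<in>X. v div ?W = 0 \<or> v mod ?W = 0"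
    | (other) "\<forall>v\<in>X. v mod ?W = 0"
    by blast
  thus "\<exists>v\<in>X. card {e \<in> F. v \<in> e} \<le> 2"
  proof cases
    case inner
    \<comment> \<open>The neighbours are the item in the same column, whose vertex number is that
      column since it lies in row 0, and the hub of the row.\<close>
    have nb: "v = w mod ?W \<or> v = w div ?W * ?W"
      if "cell_arc hit (v div ?W) (v mod ?W) (w div ?W) (w mod ?W) \<or>
          cell_arc hit (w div ?W) (w mod ?W) (v div ?W) (v mod ?W)" for v
      using that inner(2,3) div_mod_decomp[of v ?W] unfolding cell_arc_def by auto
    have "{e \<in> F. w \<in> e} \<subseteq> {{w, w mod ?W}, {w, w div ?W * ?W}}"
    proof
      fix e assume e: "e \<in> {e \<in> F. w \<in> e}"
      then obtain u v where uv: "e = {u, v}"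
          "cell_arc hit (u div ?W) (u mod ?W) (v div ?W) (v mod ?W)"
        using FE by blast
      show "e \<in> {{w, w mod ?W}, {w, w div ?W * ?W}}"
      proof (cases "w = u")
        case True
        thus ?thesis using nb[of v] uv by auto
      next
        case False
        hence "w = v" using e uv by auto
        thus ?thesis using nb[of u] uv by auto
      qed
    qed
    thus ?thesis using small inner(1) by blast
  next
    case item
    \<comment> \<open>No leaf is left in \<open>X\<close>, so only the root can be a neighbour; the
      pair is doubled to fit the form of \<open>small\<close>.\<close>
    have "{e \<in> F. w \<in> e} \<subseteq> {{w, 0}, {w, 0}}"
    proof
      fix e assume e: "e \<in> {e \<in> F. w \<in> e}"
      then obtain u v where uv: "e = {u, v}"
          "cell_arc hit (u div ?W) (u mod ?W) (v div ?W) (v mod ?W)"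
        using FE by blast
      have uvX: "u \<in> X" "v \<in> X" using FX e uv by auto
      show "e \<in> {{w, 0}, {w, 0}}"
      proof (cases "w = u")
        case True
        thus ?thesis using uv(2) uvX item unfolding cell_arc_def by auto
      next
        case False
        hence "w = v" using e uv by auto
        hence "u div ?W = 0" "u mod ?W = 0"
          using uv(2) uvX item unfolding cell_arc_def by auto
        hence "u = 0" using eqI[of u 0] by simp
        thus ?thesis using uv \<open>w = v\<close> by auto
      qed
    qed
    thus ?thesis using small item(1) by blast
  next
    case other
    \<comment> \<open>Every arc has an end outside column 0, so a subgraph inside column 0 has no
      edge.\<close>
    have "F = {} \<or> \<not> (\<exists>e\<in>F. e \<noteq> {})"
    proof (rule ccontr)
      assume "\<not> ?thesis"
      then obtain e where "e \<in> F" by blast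
      then obtain u v where uv: "e = {u, v}"
          "cell_arc hit (u div ?W) (u mod ?W) (v div ?W) (v mod ?W)"
        using FE by blast
      have "u \<in> X" "v \<in> X" using FX \<open>e \<in> F\<close> uv by auto
      thus False using other uv(2) unfolding cell_arc_def by auto
    qed
    hence "{e \<in> F. v \<in> e} = {}" for v by auto
    thus ?thesis using ne by (metis all_not_in_conv card.empty zero_le)
  qed
qed

section \<open>Digits\<close>

definition dg :: "nat \<Rightarrow> nat \<Rightarrow> nat \<Rightarrow> nat" where
  "dg b w j = w div b ^ j mod b"

lemma dg_less: "0 < b \<Longrightarrow> dg b w j < b"
  by (simp add: dg_def)

lemma dg_0: "dg b w 0 = w mod b"
  by (simp add: dg_def)

lemma dg_Suc: "dg b w (Suc j) = dg b (w div b) j"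
  by (simp add: dg_def div_mult2_eq)

lemma digits_exist:
  "\<forall>j<m. f j < b \<Longrightarrow> \<exists>w<b ^ m. \<forall>j<m. dg b w j = f j"
proof (induction m arbitrary: f)
  case (Suc m)
  obtain w where w: "w < b ^ m" "\<forall>j<m. dg b w j = f (Suc j)"
    using Suc.IH[of "\<lambda>j. f (Suc j)"] Suc.prems by auto
  have f0: "f 0 < b" using Suc.prems by auto
  hence md: "(f 0 + b * w) mod b = f 0" "(f 0 + b * w) div b = w"
    by simp_all
  have "f 0 + b * w < b + b * w" using f0 by simp
  also have "\<dots> = b * Suc w" by simp
  also have "\<dots> \<le> b ^ Suc m" using w(1) by (simp del: mult_Suc_right)
  finally have "f 0 + b * w < b ^ Suc m" .
  moreover have "dg b (f 0 + b * w) j = f j" if "j < Suc m" for j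
    using that w(2) md by (cases j) (simp_all add: dg_0 dg_Suc)
  ultimately show ?case by blast
qed simp

lemma mod_div_eqI: "i < (a::nat) \<Longrightarrow> (i + a * j) mod a = i \<and> (i + a * j) div a = j"
  by simp

lemma mod_div_less: "i < (a::nat) \<Longrightarrow> j < b \<Longrightarrow> i + a * j < a * b"
proof -
  assume "i < a" "j < b"
  hence "i + a * j < a * Suc j" by simp
  also have "\<dots> \<le> a * b" using \<open>j < b\<close> by (simp del: mult_Suc_right)
  finally show ?thesis .
qed

lemma all_less_mult:
  assumes "0 < (a::nat)"
  shows "(\<forall>t<a * b. Q (t mod a) (t div a)) \<longleftrightarrow> (\<forall>i<a. \<forall>j<b. Q i j)"
proof (intro iffI allI impI)
  fix i j assume "\<forall>t<a * b. Q (t mod a) (t div a)" "i < a" "j < b"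
  thus "Q i j" using mod_div_eqI[of i a j] mod_div_less[of i a j b] by metis
next
  fix t assume "\<forall>i<a. \<forall>j<b. Q i j" "t < a * b"
  thus "Q (t mod a) (t div a)"
    using assms by (simp add: less_mult_imp_div_less mult.commute)
qed

lemma concat_map_upt:
  "concat (map (\<lambda>u. map (f u) [0..<n]) [0..<k]) = map (\<lambda>i. f (i div n) (i mod n)) [0..<k * n]"
proof (induction k)
  case (Suc k)
  have "map (\<lambda>i. f (i div n) (i mod n)) [k * n..<k * n + n] = map (f k) [0..<n]"
  proof (rule nth_equalityI)
    fix i assume "i < length (map (\<lambda>i. f (i div n) (i mod n)) [k * n..<k * n + n])"
    hence "i < n" by simp
    thus "map (\<lambda>i. f (i div n) (i mod n)) [k * n..<k * n + n] ! i = map (f k) [0..<n] ! i"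
      by simp
  qed simp
  moreover have "[0..<Suc k * n] = [0..<k * n] @ [k * n..<k * n + n]"
    using upt_add_eq_append[of 0 "k * n" n] by (simp add: add.commute)
  ultimately show ?case using Suc by simp
qed simp

text \<open>The list function varies the first component fastest, so position \<open>i\<close> holds
  the digits of \<open>i\<close>, least significant first; \<open>idx\<close> follows the same
  order.\<close>

lemma n_lists_upt:
  "List.n_lists r [0..<n] = map (\<lambda>i. map (dg n i) [0..<r]) [0..<n ^ r]"
proof (induction r)
  case (Suc r)
  have "List.n_lists (Suc r) [0..<n] =
      concat (map (\<lambda>i. map (\<lambda>y. y # map (dg n i) [0..<r]) [0..<n]) [0..<n ^ r])"
    by (simp add: Suc o_def)
  also have "\<dots> = map (\<lambda>i. i mod n # map (dg n (i div n)) [0..<r]) [0..<n ^ r * n]"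
    by (rule concat_map_upt)
  also have "\<dots> = map (\<lambda>i. map (dg n i) [0..<Suc r]) [0..<n ^ r * n]"
    by (simp add: map_upt_Suc dg_0 dg_Suc del: upt_Suc)
  finally show ?case by (simp add: mult.commute)
qed simp

primrec idx :: "nat \<Rightarrow> nat list \<Rightarrow> nat" where
  "idx n [] = 0"
| "idx n (y # ys) = y + n * idx n ys"

lemma idx_less: "xs \<in> tuples n r \<Longrightarrow> idx n xs < n ^ r"
proof (induction xs arbitrary: r)
  case (Cons y ys)
  then obtain r' where r: "r = Suc r'" "ys \<in> tuples n r'" "y < n"
    by (auto simp: tuples_def)
  show ?case using mod_div_less[OF r(3) Cons.IH[OF r(2)]] r(1) by simp
qed (simp add: tuples_def)

lemma map_dg_idx: "xs \<in> tuples n r \<Longrightarrow> map (dg n (idx n xs)) [0..<r] = xs"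
proof (induction xs arbitrary: r)
  case (Cons y ys)
  then obtain r' where r: "r = Suc r'" "ys \<in> tuples n r'" "y < n"
    by (auto simp: tuples_def)
  show ?case
    using Cons.IH[OF r(2)] r mod_div_eqI[OF r(3)]
    by (simp add: map_upt_Suc dg_0 dg_Suc del: upt_Suc)
qed (simp add: tuples_def)

lemma map_dg_tuples: "0 < n \<Longrightarrow> map (dg n i) [0..<r] \<in> tuples n r"
  by (auto simp: tuples_def dg_less)

lemma idx_map_dg: "i < n ^ r \<Longrightarrow> idx n (map (dg n i) [0..<r]) = i"
proof (induction r arbitrary: i)
  case (Suc r)
  have "i div n < n ^ r"
    using Suc.prems by (simp add: less_mult_imp_div_less mult.commute)
  thus ?case using Suc.IH[of "i div n"]
    by (simp add: map_upt_Suc dg_0 dg_Suc del: upt_Suc)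
qed simp

lemma bij_betw_idx:
  assumes "0 < n"
  shows "bij_betw (idx n) (tuples n r) {..<n ^ r}"
  by (rule bij_betwI[where g = "\<lambda>i. map (dg n i) [0..<r]"])
    (use assms in \<open>auto simp: idx_less map_dg_idx map_dg_tuples idx_map_dg\<close>)

section \<open>Guessing a set by its local views\<close>

text \<open>A \<open>k\<close>-element subset of \<open>{..<N}\<close> is given by the increasing sequence \<open>a\<close> of its elements, shifted
  by one and placed between the sentinels \<open>a 0 = 0\<close> and \<open>a (k + 1) = N + 1\<close>. Knowing \<open>a\<close> at a few
  slots certifies that an element belongs to the set, by one slot, or that it does not, by two
  consecutive slots with values around it.\<close>

definition enumerates :: "nat \<Rightarrow> nat \<Rightarrow> (nat \<Rightarrow> nat) \<Rightarrow> bool" where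
  "enumerates N k a \<longleftrightarrow> a 0 = 0 \<and> a (Suc k) = Suc N \<and> (\<forall>i j. i < j \<longrightarrow> j \<le> Suc k \<longrightarrow> a i < a j)"

definition enumerated :: "nat \<Rightarrow> (nat \<Rightarrow> nat) \<Rightarrow> nat set" where
  "enumerated k a = {c. \<exists>i\<in>{1..k}. a i = Suc c}"

lemma enumerates_le:
  assumes "enumerates N k a" "i \<le> Suc k"
  shows "a i < N + 2"
proof (cases "i = Suc k")
  case False
  hence "i < Suc k" using assms(2) by simp
  hence "a i < a (Suc k)" using assms(1) unfolding enumerates_def by blast
  thus ?thesis using assms by (simp add: enumerates_def)
qed (use assms in \<open>simp add: enumerates_def\<close>)

lemma enumerated_subset:
  assumes "enumerates N k a"
  shows "enumerated k a \<subseteq> {..<N}" and "card (enumerated k a) = k"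
proof -
  have lt: "a i < a j" if "i < j" "j \<le> Suc k" for i j
    using assms that by (auto simp: enumerates_def)
  have pos: "0 < a i" "a i < Suc N" if "i \<in> {1..k}" for i
    using lt[of 0 i] lt[of i "Suc k"] that assms by (auto simp: enumerates_def)
  show "enumerated k a \<subseteq> {..<N}"
    using pos by (fastforce simp: enumerated_def)
  have "enumerated k a = (\<lambda>i. a i - 1) ` {1..k}"
    using pos(1) by (force simp: enumerated_def)
  moreover have "inj_on (\<lambda>i. a i - 1) {1..k}"
  proof (rule linorder_inj_onI')
    fix i j assume "i \<in> {1..k}" "j \<in> {1..k}" "i < j"
    thus "a i - 1 \<noteq> a j - 1" using lt[of i j] pos(1)[of i] by auto
  qed
  ultimately show "card (enumerated k a) = k"
    by (simp add: card_image)
qed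

lemma enumerates_exists:
  assumes "S \<subseteq> {..<N}" "card S = k"
  shows "\<exists>a. enumerates N k a \<and> enumerated k a = S"
proof -
  have fin: "finite S" using assms(1) by (rule finite_subset) simp
  define ys where "ys = sorted_list_of_set S"
  define xs where "xs = 0 # map Suc ys @ [Suc N]"
  have ys: "length ys = k" "set ys = S" "sorted_wrt (<) ys"
    using fin assms(2) by (simp_all add: ys_def)
  have "sorted_wrt (<) xs"
    unfolding xs_def using ys assms(1) by (auto simp: sorted_wrt_append sorted_wrt_map)
  moreover have "length xs = k + 2" using ys by (simp add: xs_def)
  ultimately have "xs ! i < xs ! j" if "i < j" "j \<le> Suc k" for i j
    using sorted_wrt_nth_less[of "(<)" xs i j] that by simp
  moreover have "xs ! 0 = 0" "xs ! Suc k = Suc N"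
    using ys(1) by (simp_all add: xs_def nth_append)
  ultimately have "enumerates N k ((!) xs)"
    by (simp add: enumerates_def)
  moreover have "enumerated k ((!) xs) = S"
  proof -
    have "xs ! Suc i = Suc (ys ! i)" if "i < k" for i
      using that ys(1) by (simp add: xs_def nth_append)
    hence "enumerated k ((!) xs) = {c. \<exists>j<k. ys ! j = c}"
      unfolding enumerated_def image_Suc_lessThan[symmetric] by (auto cong: conj_cong)
    also have "\<dots> = set ys"
      using ys(1) by (auto simp: in_set_conv_nth)
    finally show ?thesis using ys(2) by simp
  qed
  ultimately show ?thesis by blast
qed

lemma enumerated_iff:
  assumes "enumerates N k a" "c < N"
  shows "c \<in> enumerated k a \<longleftrightarrow> (\<exists>i\<le>Suc k. a i = Suc c)"
proof -
  have "i \<in> {1..k}" if "i \<le> Suc k" "a i = Suc c" for i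
    using that assms unfolding enumerates_def by (cases "i = 0"; cases "i = Suc k") auto
  moreover have "i \<le> Suc k" if "i \<in> {1..k}" for i
    using that by simp
  ultimately show ?thesis unfolding enumerated_def by blast
qed

text \<open>The sentinels lie strictly on both sides of \<open>Suc c\<close>, so the sequence passes
  this value between two consecutive slots; it jumps over it exactly when \<open>c\<close> is not in
  the set.\<close>

lemma not_enumerated_iff:
  assumes a: "enumerates N k a" "c < N"
  shows "c \<notin> enumerated k a \<longleftrightarrow> (\<exists>i\<le>k. a i < Suc c \<and> Suc c < a (Suc i))"
proof
  assume nin: "c \<notin> enumerated k a"
  have ends: "a 0 < Suc c" "Suc c < a (Suc k)"
    using a by (auto simp: enumerates_def)
  have "\<exists>i\<le>k. a i < Suc c \<and> Suc c \<le> a (Suc i)"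
  proof (rule ccontr)
    assume no: "\<not> ?thesis"
    have "i \<le> Suc k \<Longrightarrow> a i < Suc c" for i
      using ends(1) no by (induction i) (auto simp: not_le)
    from this[of "Suc k"] ends(2) show False by simp
  qed
  then obtain i where "i \<le> k" "a i < Suc c" "Suc c \<le> a (Suc i)" by blast
  moreover have "a (Suc i) \<noteq> Suc c"
    using nin enumerated_iff[OF a] \<open>i \<le> k\<close> by auto
  ultimately show "\<exists>i\<le>k. a i < Suc c \<and> Suc c < a (Suc i)" by force
next
  assume "\<exists>i\<le>k. a i < Suc c \<and> Suc c < a (Suc i)"
  then obtain i where i: "i \<le> k" "a i < Suc c" "Suc c < a (Suc i)" by blast
  have mono: "p \<le> q \<Longrightarrow> q \<le> Suc k \<Longrightarrow> a p \<le> a q" for p q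
    using a(1) by (cases "p = q") (auto simp: enumerates_def less_imp_le)
  have "a j \<noteq> Suc c" if "j \<le> Suc k" for j
    using mono[of j i] mono[of "Suc i" j] i that by (cases "j \<le> i") auto
  thus "c \<notin> enumerated k a"
    using enumerated_iff[OF a] by auto
qed

text \<open>An item pairs a \<open>D\<close>-tuple \<open>I\<close> of slots with a \<open>D\<close>-tuple \<open>v\<close> of guessed values of \<open>a\<close> there.\<close>

definition guess_ok :: "nat \<Rightarrow> nat \<Rightarrow> nat \<Rightarrow> nat \<Rightarrow> nat \<Rightarrow> bool" where
  "guess_ok D k N I v \<longleftrightarrow> (\<forall>j<D.
     (dg (k + 2) I j = 0 \<longrightarrow> dg (N + 2) v j = 0) \<and>
     (dg (k + 2) I j = k + 1 \<longrightarrow> dg (N + 2) v j = N + 1) \<and>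
     (\<forall>l<D. dg (k + 2) I j < dg (k + 2) I l \<longrightarrow> dg (N + 2) v j < dg (N + 2) v l))"

text \<open>Comparing with the tuple that repeats a single slot makes a guessed value depend on the
  slot alone, and not on the tuple or position in which it occurs.\<close>

definition consistent :: "nat \<Rightarrow> nat \<Rightarrow> nat \<Rightarrow> nat \<Rightarrow> nat \<Rightarrow> nat \<Rightarrow> nat \<Rightarrow> bool" where
  "consistent D k N I u J v \<longleftrightarrow> (\<forall>j<D. \<forall>l<D.
     dg (k + 2) I j = dg (k + 2) J l \<longrightarrow> dg (N + 2) u j = dg (N + 2) v l)"

text \<open>Clauses with \<open>y = 0\<close> say that the guess for \<open>J\<close> is consistent with \<open>u\<close> if \<open>u\<close> is the
  guess for \<open>I\<close>; since the budget allows only one guess for each \<open>I\<close>, a guess other than \<open>u\<close>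
  refutes \<open>u\<close>. Clauses with \<open>y = 1\<close> say that some guess certifies condition \<open>e\<close>.\<close>

definition guess_clause :: "nat \<Rightarrow> nat \<Rightarrow> nat \<Rightarrow> (nat \<Rightarrow> nat \<Rightarrow> nat \<Rightarrow> bool) \<Rightarrow>
    nat \<Rightarrow> nat \<Rightarrow> nat \<Rightarrow> nat \<Rightarrow> nat \<Rightarrow> nat \<Rightarrow> nat \<Rightarrow> bool" where
  "guess_clause D k N forced y I J u e K' v \<longleftrightarrow> guess_ok D k N K' v \<and>
     (if y = 0 then (K' = I \<and> v \<noteq> u) \<or> (K' = J \<and> consistent D k N I u J v)
      else forced e K' v)"

text \<open>Clause and item numbers are written in mixed radix. Condition \<open>e\<close> takes the
  top position, so that decoding does not involve its range.\<close>

definition guess_hit :: "nat \<Rightarrow> nat \<Rightarrow> nat \<Rightarrow> (nat \<Rightarrow> nat \<Rightarrow> nat \<Rightarrow> bool) \<Rightarrow> nat \<Rightarrow> nat \<Rightarrow> bool" where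
  "guess_hit D k N forced t z =
     (let K = (k + 2) ^ D; V = (N + 2) ^ D; t1 = t div 2; t2 = t1 div K; t3 = t2 div K
      in guess_clause D k N forced (t mod 2) (t1 mod K) (t2 mod K) (t3 mod V) (t3 div V)
           (z mod K) (z div K))"

lemma guess_hit_all:
  fixes D k N :: nat
  defines "K \<equiv> (k + 2) ^ D" and "V \<equiv> (N + 2) ^ D"
  shows "(\<forall>t<2 * (K * (K * (V * E))). \<exists>z\<in>Z. guess_hit D k N forced t z) \<longleftrightarrow>
     (\<forall>y<2. \<forall>I<K. \<forall>J<K. \<forall>u<V. \<forall>e<E.
        \<exists>z\<in>Z. guess_clause D k N forced y I J u e (z mod K) (z div K))"
proof -
  have pos: "0 < K" "0 < V" by (simp_all add: K_def V_def)
  let ?C = "\<lambda>y I J u e. \<exists>z\<in>Z. guess_clause D k N forced y I J u e (z mod K) (z div K)"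
  have "(\<exists>z\<in>Z. guess_hit D k N forced t z) \<longleftrightarrow>
      ?C (t mod 2) (t div 2 mod K) (t div 2 div K mod K) (t div 2 div K div K mod V)
        (t div 2 div K div K div V)" for t
    by (simp add: guess_hit_def Let_def K_def V_def)
  hence "(\<forall>t<2 * (K * (K * (V * E))). \<exists>z\<in>Z. guess_hit D k N forced t z) \<longleftrightarrow>
     (\<forall>t<2 * (K * (K * (V * E))). ?C (t mod 2) (t div 2 mod K) (t div 2 div K mod K)
       (t div 2 div K div K mod V) (t div 2 div K div K div V))"
    by simp
  also have "\<dots> \<longleftrightarrow> (\<forall>y<2. \<forall>t<K * (K * (V * E)). ?C y (t mod K) (t div K mod K)
       (t div K div K mod V) (t div K div K div V))"
    by (rule all_less_mult[where a = 2 and b = "K * (K * (V * E))"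
        and Q = "\<lambda>y t. ?C y (t mod K) (t div K mod K) (t div K div K mod V) (t div K div K div V)"]) simp
  also have "\<dots> \<longleftrightarrow> (\<forall>y<2. \<forall>I<K. \<forall>t<K * (V * E). ?C y I (t mod K)
       (t div K mod V) (t div K div V))"
    by (rule all_cong, rule all_less_mult[where a = K and b = "K * (V * E)"
        and Q = "\<lambda>I t. ?C _ I (t mod K) (t div K mod V) (t div K div V)"]) (rule pos)
  also have "\<dots> \<longleftrightarrow> (\<forall>y<2. \<forall>I<K. \<forall>J<K. \<forall>t<V * E. ?C y I J (t mod V) (t div V))"
    by (intro all_cong, rule all_less_mult[where a = K and b = "V * E"
        and Q = "\<lambda>J t. ?C _ _ J (t mod V) (t div V)"]) (rule pos)
  also have "\<dots> \<longleftrightarrow> (\<forall>y<2. \<forall>I<K. \<forall>J<K. \<forall>u<V. \<forall>e<E. ?C y I J u e)"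
    by (intro all_cong, rule all_less_mult[where a = V and b = E
        and Q = "\<lambda>u e. ?C _ _ _ u e"]) (rule pos)
  finally show ?thesis .
qed

text \<open>A solution is a function from slot tuples to guesses, and the clauses make it the
  restriction of one enumeration \<open>a\<close>; conversely, an enumeration supplies all guesses.
  What the conditions \<open>sat\<close> are does not matter, as long as \<open>forced\<close>
  certifies them from the values of \<open>a\<close> at \<open>D\<close> slots.\<close>

theorem guess_hitting_set:
  fixes D k N E :: nat
  defines "K \<equiv> (k + 2) ^ D" and "V \<equiv> (N + 2) ^ D"
  assumes D: "2 \<le> D" and E: "0 < E"
    and sound: "\<And>e I v a. e < E \<Longrightarrow> enumerates N k a \<Longrightarrow>
      \<forall>j<D. dg (N + 2) v j = a (dg (k + 2) I j) \<Longrightarrow> forced e I v \<Longrightarrow> sat e (enumerated k a)"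
    and complete: "\<And>e a. e < E \<Longrightarrow> enumerates N k a \<Longrightarrow> sat e (enumerated k a) \<Longrightarrow>
      \<exists>f. (\<forall>j<D. f j < k + 2) \<and> (\<forall>I v. (\<forall>j<D. dg (k + 2) I j = f j) \<longrightarrow>
        (\<forall>j<D. dg (N + 2) v j = a (f j)) \<longrightarrow> forced e I v)"
  shows "(\<exists>Z\<subseteq>{..<K * V}. card Z \<le> K \<and>
      (\<forall>t<2 * (K * (K * (V * E))). \<exists>z\<in>Z. guess_hit D k N forced t z)) \<longleftrightarrow>
    (\<exists>S\<subseteq>{..<N}. card S = k \<and> (\<forall>e<E. sat e S))"
    (is "?L \<longleftrightarrow> ?R")
proof
  have pos: "0 < K" "0 < V" by (simp_all add: K_def V_def)
  note all_iff = guess_hit_all[where D = D and k = k and N = N and E = E and forced = forced,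
      folded K_def V_def]
  {
    assume ?L
    then obtain Z where Z: "Z \<subseteq> {..<K * V}" "card Z \<le> K"
      and all: "\<forall>t<2 * (K * (K * (V * E))). \<exists>z\<in>Z. guess_hit D k N forced t z"
      by (elim exE conjE)
    have hit: "\<exists>z\<in>Z. guess_clause D k N forced y I J u e (z mod K) (z div K)"
      if "y < 2" "I < K" "J < K" "u < V" "e < E" for y I J u e
      using all_iff[THEN iffD1, OF all] that by simp
    have fin: "finite Z" using Z(1) by (rule finite_subset) simp
    \<comment> \<open>For \<open>J = I\<close> both alternatives of the clause name
      \<open>I\<close>, so some item for \<open>I\<close> must be chosen. A positive
      \<open>E\<close> makes \<open>e = 0\<close> available.\<close>
    have "\<exists>z\<in>Z. z mod K = I \<and> guess_ok D k N I (z div K)" if "I < K" for I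
      using hit[of 0 I I 0 0] that pos E by (auto simp: guess_clause_def)
    then obtain w where w: "\<And>I. I < K \<Longrightarrow> w I \<in> Z \<and> w I mod K = I \<and> guess_ok D k N I (w I div K)"
      by metis
    have sub: "{..<K} \<subseteq> (\<lambda>z. z mod K) ` Z"
    proof
      fix I assume "I \<in> {..<K}"
      thus "I \<in> (\<lambda>z. z mod K) ` Z" using w[of I] by (intro rev_image_eqI[of "w I"]) auto
    qed
    have "K \<le> card ((\<lambda>z. z mod K) ` Z)"
      using card_mono[OF finite_imageI[OF fin] sub] by simp
    hence "card ((\<lambda>z. z mod K) ` Z) = card Z"
      using Z(2) card_image_le[OF fin, of "\<lambda>z. z mod K"] by simp
    \<comment> \<open>Pigeonhole: all \<open>K\<close> residues occur among at most \<open>K\<close>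
      items, so no tuple has two guesses.\<close>
    hence inj: "inj_on (\<lambda>z. z mod K) Z"
      by (rule eq_card_imp_inj_on[OF fin])
    have w_eq: "z = w (z mod K)" if "z \<in> Z" for z
      using inj_onD[OF inj, of z "w (z mod K)"] w[of "z mod K"] pos that by simp
    define v where "v I = w I div K" for I
    have vV: "v I < V" if "I < K" for I
    proof -
      have "w I < V * K" using w[OF that] Z(1) by (auto simp: mult.commute)
      thus ?thesis unfolding v_def by (rule less_mult_imp_div_less)
    qed
    have cons: "consistent D k N I (v I) J (v J)" if IJ: "I < K" "J < K" for I J
    proof -
      \<comment> \<open>With \<open>u\<close> the guess made for \<open>I\<close>, the alternative
        of a different guess is closed, which leaves consistency.\<close>
      obtain z where z: "z \<in> Z" "guess_clause D k N forced 0 I J (v I) 0 (z mod K) (z div K)"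
        using hit[of 0 I J "v I" 0] IJ vV E by auto
      have "z div K = v (z mod K)"
        using w_eq[OF z(1)] by (simp add: v_def)
      thus ?thesis using z(2) by (auto simp: guess_clause_def)
    qed
    \<comment> \<open>Tuples with \<open>i\<close> in position 0 and \<open>i'\<close> elsewhere.
      Those with \<open>i = i'\<close> define \<open>a\<close>, the others compare two slots, which
      takes two positions.\<close>
    have "\<exists>c<K. dg (k + 2) c 0 = i \<and> dg (k + 2) c 1 = i'" if "i < k + 2" "i' < k + 2" for i i'
    proof -
      have "\<forall>j<D. (if j = 0 then i else i') < k + 2" using that by simp
      from digits_exist[OF this] obtain c
        where "c < K" "\<forall>j<D. dg (k + 2) c j = (if j = 0 then i else i')"
        unfolding K_def by blast
      thus ?thesis using D by (intro exI[of _ c]) auto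
    qed
    then obtain c where c: "\<And>i i'. i < k + 2 \<Longrightarrow> i' < k + 2 \<Longrightarrow>
        c i i' < K \<and> dg (k + 2) (c i i') 0 = i \<and> dg (k + 2) (c i i') 1 = i'"
      by metis
    define a where "a i = dg (N + 2) (v (c i i)) 0" for i
    have va: "dg (N + 2) (v I) j = a (dg (k + 2) I j)" if "I < K" "j < D" for I j
    proof -
      have "dg (k + 2) I j < k + 2" by (rule dg_less) simp
      from c[OF this this] cons[OF that(1), of "c (dg (k + 2) I j) (dg (k + 2) I j)"]
      show ?thesis using that(2) D unfolding consistent_def a_def by auto
    qed
    have ok: "guess_ok D k N I (v I)" if "I < K" for I
      using w[OF that] by (simp add: v_def)
    have en: "enumerates N k a"
      unfolding enumerates_def
    proof (intro conjI allI impI)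
      have "guess_ok D k N (c 0 0) (v (c 0 0))" using ok c by simp
      thus "a 0 = 0" using c[of 0 0] D by (auto simp: guess_ok_def a_def)
      have "guess_ok D k N (c (Suc k) (Suc k)) (v (c (Suc k) (Suc k)))" using ok c by simp
      thus "a (Suc k) = Suc N" using c[of "Suc k" "Suc k"] D by (auto simp: guess_ok_def a_def)
      fix i j assume ij: "i < j" "j \<le> Suc k"
      let ?c = "c i j"
      have cc: "?c < K" "dg (k + 2) ?c 0 = i" "dg (k + 2) ?c 1 = j"
        using c[of i j] ij by auto
      have "dg (N + 2) (v ?c) 0 < dg (N + 2) (v ?c) 1"
        using ok[OF cc(1)] cc(2,3) ij D unfolding guess_ok_def by fastforce
      thus "a i < a j"
        using va[OF cc(1), of 0] va[OF cc(1), of 1] cc D by simp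
    qed
    have "sat e (enumerated k a)" if "e < E" for e
    proof -
      obtain z where z: "z \<in> Z" "guess_clause D k N forced 1 0 0 0 e (z mod K) (z div K)"
        using hit[of 1 0 0 0 e] \<open>e < E\<close> pos by auto
      have "z div K = v (z mod K)"
        using w_eq[OF z(1)] by (simp add: v_def)
      hence "forced e (z mod K) (v (z mod K))"
        using z(2) by (simp add: guess_clause_def)
      thus ?thesis
        using sound[OF that en, of "v (z mod K)" "z mod K"] va pos by simp
    qed
    thus ?R using enumerated_subset[OF en] by blast
  }
  assume ?R
  then obtain S where S: "S \<subseteq> {..<N}" "card S = k" "\<And>e. e < E \<Longrightarrow> sat e S" by blast
  obtain a where a: "enumerates N k a" "enumerated k a = S"
    using enumerates_exists[OF S(1,2)] by blast
  have "\<exists>v<V. \<forall>j<D. dg (N + 2) v j = a (dg (k + 2) I j)" for I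
    unfolding V_def
  proof (rule digits_exist, intro allI impI)
    fix j
    have "dg (k + 2) I j < k + 2" by (rule dg_less) simp
    thus "a (dg (k + 2) I j) < N + 2" using enumerates_le[OF a(1)] by simp
  qed
  then obtain v where v: "\<And>I. v I < V" "\<And>I j. j < D \<Longrightarrow> dg (N + 2) (v I) j = a (dg (k + 2) I j)"
    by metis
  have ok: "guess_ok D k N I (v I)" for I
  proof -
    have le: "dg (k + 2) I j < k + 2" for j by (rule dg_less) simp
    show ?thesis
      unfolding guess_ok_def
    proof (intro allI impI conjI)
      fix j l assume jl: "j < D" "l < D" "dg (k + 2) I j < dg (k + 2) I l"
      have "dg (k + 2) I l \<le> Suc k" using le[of l] by simp
      hence "a (dg (k + 2) I j) < a (dg (k + 2) I l)"
        using a(1) jl(3) unfolding enumerates_def by blast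
      thus "dg (N + 2) (v I) j < dg (N + 2) (v I) l"
        using jl by (simp only: v)
    qed (use a(1) in \<open>simp_all only: v enumerates_def Suc_eq_plus1\<close>)
  qed
  define Z where "Z = (\<lambda>I. I + K * v I) ` {..<K}"
  have ZK: "Z \<subseteq> {..<K * V}" "card Z \<le> K"
    unfolding Z_def using mod_div_less v(1) card_image_le[of "{..<K}" "\<lambda>I. I + K * v I"] by auto
  have hit: "\<exists>z\<in>Z. guess_clause D k N forced y I J u e (z mod K) (z div K)"
    if "I < K" "J < K" "e < E" for y I J u e
  proof -
    have ex: "\<exists>z\<in>Z. P (z mod K) (z div K)" if "I < K" "P I (v I)" for P I
      unfolding Z_def using mod_div_eqI[OF that(1), of "v I"] that by auto
    show ?thesis
    proof (cases "y = 0")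
      case True
      show ?thesis
      \<comment> \<open>If \<open>u\<close> is not the guess for \<open>I\<close>, the item of
        \<open>I\<close> hits the clause. Otherwise the item of \<open>J\<close> does, since both
        guesses are read off \<open>a\<close>.\<close>
      proof (cases "v I = u")
        case False
        show ?thesis
          by (rule ex[of I]) (use that True False ok in \<open>auto simp: guess_clause_def\<close>)
      next
        case u: True
        have "consistent D k N I u J (v J)"
          unfolding consistent_def u[symmetric]
          by (intro allI impI) (simp only: v)
        thus ?thesis
          by (intro ex[of J]) (use that True ok in \<open>auto simp: guess_clause_def\<close>)
      qed
    next
      case False
      obtain f where f: "\<forall>j<D. f j < k + 2" "\<And>I v. \<forall>j<D. dg (k + 2) I j = f j \<Longrightarrow>
          \<forall>j<D. dg (N + 2) v j = a (f j) \<Longrightarrow> forced e I v"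
        using complete[OF \<open>e < E\<close> a(1)] S(3)[OF \<open>e < E\<close>] a(2) by blast
      obtain L where L: "L < K" "\<forall>j<D. dg (k + 2) L j = f j"
        unfolding K_def using digits_exist[OF f(1)] by blast
      have "forced e L (v L)" using L(2) v by (intro f(2)) auto
      thus ?thesis
        by (intro ex[of L]) (use L ok False in \<open>auto simp: guess_clause_def\<close>)
    qed
  qed
  have "\<forall>t<2 * (K * (K * (V * E))). \<exists>z\<in>Z. guess_hit D k N forced t z"
    by (rule all_iff[THEN iffD2]) (intro allI impI hit)
  thus ?L using ZK by (intro exI[of _ Z] conjI)
qed

section \<open>Weighted definability by \<open>\<Pi>\<^sub>2\<close>-formulas\<close>

lemma Pi_0_iff: "Pi_fo 0 \<phi> \<longleftrightarrow> qfree \<phi>"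
  by (auto elim: Pi_fo.cases intro: Sigma_fo_Pi_fo.intros)

lemma Sigma_1_induct [consumes 1, case_names qfree Ex]:
  assumes "Sigma_fo (Suc 0) \<phi>"
    and "\<And>\<phi>. qfree \<phi> \<Longrightarrow> P \<phi>" and "\<And>x \<phi>. P \<phi> \<Longrightarrow> P (Ex x \<phi>)"
  shows "P \<phi>"
  using assms(1)
proof (induction \<phi> rule: fo.induct)
  case (Ex x \<phi>)
  from Ex.prems show ?case
    by (cases rule: Sigma_fo.cases) (use assms(2,3) Ex.IH Pi_0_iff in auto)
qed (use assms(2) Pi_0_iff in \<open>auto elim: Sigma_fo.cases\<close>)

text \<open>Only \<open>Pi_All\<close> adds a quantifier at this level; the other way to derive the
  formula drops to the existential level by \<open>Pi_Suc\<close>.\<close>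

lemma Pi_2_prefix:
  assumes "Pi_fo 2 \<phi>"
  shows "\<exists>xs \<chi>. \<phi> = foldr All xs \<chi> \<and> Sigma_fo (Suc 0) \<chi>"
  using assms
proof (induction \<phi> rule: fo.induct)
  case (All x \<phi>)
  from All.prems show ?case
  proof (cases rule: Pi_fo.cases)
    case (Pi_Suc t)
    thus ?thesis by (intro exI[of _ "[]"]) (auto simp: numeral_2_eq_2)
  next
    case (Pi_All t)
    then obtain xs \<chi> where "\<phi> = foldr All xs \<chi>" "Sigma_fo (Suc 0) \<chi>"
      using All.IH by (auto simp: numeral_2_eq_2)
    thus ?thesis by (intro exI[of _ "x # xs"]) auto
  qed auto
qed (auto elim!: Pi_fo.cases intro!: exI[of _ "[]"] simp: numeral_2_eq_2)

lemma finite_fo_free: "finite (fo_free \<phi>)"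
  by (induction \<phi>) auto

lemma fo_sat_cong:
  "\<forall>i\<in>fo_free \<phi>. e i = e' i \<Longrightarrow> fo_sat n rels S e \<phi> = fo_sat n rels S e' \<phi>"
proof (induction \<phi> arbitrary: e e')
  case (Rel i xs)
  hence "map e xs = map e' xs" by simp
  thus ?case by (simp del: map_eq_conv)
next
  case (SetVar xs)
  hence "map e xs = map e' xs" by simp
  thus ?case by (simp del: map_eq_conv)
next
  case (Neg \<phi>)
  show ?case using Neg.IH[of e e'] Neg.prems by simp
next
  case (Conj \<phi> \<psi>)
  show ?case using Conj.IH(1)[of e e'] Conj.IH(2)[of e e'] Conj.prems by simp
next
  case (Disj \<phi> \<psi>)
  show ?case using Disj.IH(1)[of e e'] Disj.IH(2)[of e e'] Disj.prems by simp
next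
  case (Ex x \<phi>)
  have "fo_sat n rels S (e(x := a)) \<phi> = fo_sat n rels S (e'(x := a)) \<phi>" for a
    by (rule Ex.IH) (use Ex.prems in auto)
  thus ?case by simp
next
  case (All x \<phi>)
  have "fo_sat n rels S (e(x := a)) \<phi> = fo_sat n rels S (e'(x := a)) \<phi>" for a
    by (rule All.IH) (use All.prems in auto)
  thus ?case by simp
qed simp

text \<open>Quantifying over all assignments on both sides absorbs the prefix without tracking which
  variables it binds, or whether it binds one twice.\<close>

lemma fo_sat_prefix:
  "(\<forall>e. (\<forall>i. e i < n) \<longrightarrow> fo_sat n rels S e (foldr All xs \<chi>)) \<longleftrightarrow>
   (\<forall>e. (\<forall>i. e i < n) \<longrightarrow> fo_sat n rels S e \<chi>)"
proof (induction xs)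
  case (Cons x xs)
  let ?\<phi> = "foldr All xs \<chi>"
  have "(\<forall>e. (\<forall>i. e i < n) \<longrightarrow> fo_sat n rels S e (All x ?\<phi>)) \<longleftrightarrow>
     (\<forall>e. (\<forall>i. e i < n) \<longrightarrow> fo_sat n rels S e ?\<phi>)"
  proof (intro iffI allI impI)
    fix e :: "nat \<Rightarrow> nat"
    assume "\<forall>e. (\<forall>i. e i < n) \<longrightarrow> fo_sat n rels S e (All x ?\<phi>)" "\<forall>i. e i < n"
    hence "fo_sat n rels S (e(x := e x)) ?\<phi>" unfolding fo_sat.simps by blast
    thus "fo_sat n rels S e ?\<phi>" by simp
  next
    fix e :: "nat \<Rightarrow> nat"
    assume "\<forall>e. (\<forall>i. e i < n) \<longrightarrow> fo_sat n rels S e ?\<phi>" "\<forall>i. e i < n"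
    thus "fo_sat n rels S e (All x ?\<phi>)" by simp
  qed
  thus ?case using Cons by simp
qed simp

text \<open>Evaluation to the truth value \<open>b\<close> when only some positive and negative facts about the
  set variable are known.\<close>

primrec forces :: "(nat list \<Rightarrow> bool) \<Rightarrow> (nat list \<Rightarrow> bool) \<Rightarrow> nat \<Rightarrow> nat list set list \<Rightarrow>
    bool \<Rightarrow> (nat \<Rightarrow> nat) \<Rightarrow> fo \<Rightarrow> bool" where
  "forces P Q n rels b e (Eq x y) \<longleftrightarrow> (e x = e y) = b"
| "forces P Q n rels b e (Rel i xs) \<longleftrightarrow> (map e xs \<in> rels ! i) = b"
| "forces P Q n rels b e (SetVar xs) \<longleftrightarrow> (if b then P (map e xs) else Q (map e xs))"
| "forces P Q n rels b e (Neg \<phi>) \<longleftrightarrow> forces P Q n rels (\<not> b) e \<phi>"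
| "forces P Q n rels b e (Conj \<phi> \<psi>) \<longleftrightarrow>
     (if b then forces P Q n rels b e \<phi> \<and> forces P Q n rels b e \<psi>
      else forces P Q n rels b e \<phi> \<or> forces P Q n rels b e \<psi>)"
| "forces P Q n rels b e (Disj \<phi> \<psi>) \<longleftrightarrow>
     (if b then forces P Q n rels b e \<phi> \<or> forces P Q n rels b e \<psi>
      else forces P Q n rels b e \<phi> \<and> forces P Q n rels b e \<psi>)"
| "forces P Q n rels b e (Ex x \<phi>) \<longleftrightarrow> b \<and> (\<exists>a<n. forces P Q n rels b (e(x := a)) \<phi>)"
| "forces P Q n rels b e (All x \<phi>) \<longleftrightarrow> False"

text \<open>Two slots per atom cover both polarities. Existential quantifiers do not multiply the
  count, since only one witness has to be certified.\<close>

primrec slots :: "fo \<Rightarrow> nat" where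
  "slots (Eq x y) = 0"
| "slots (Rel i xs) = 0"
| "slots (SetVar xs) = 2"
| "slots (Neg \<phi>) = slots \<phi>"
| "slots (Conj \<phi> \<psi>) = slots \<phi> + slots \<psi>"
| "slots (Disj \<phi> \<psi>) = slots \<phi> + slots \<psi>"
| "slots (Ex x \<phi>) = slots \<phi>"
| "slots (All x \<phi>) = slots \<phi>"

lemma forces_sound:
  assumes "\<And>xs. xs \<in> tuples n s \<Longrightarrow> P xs \<Longrightarrow> xs \<in> S"
    and "\<And>xs. xs \<in> tuples n s \<Longrightarrow> Q xs \<Longrightarrow> xs \<notin> S"
  shows "forces P Q n rels b e \<phi> \<Longrightarrow> fo_wf ar s \<phi> \<Longrightarrow> \<forall>i. e i < n \<Longrightarrow>
    fo_sat n rels S e \<phi> = b"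
proof (induction \<phi> arbitrary: b e)
  case (SetVar xs)
  hence "map e xs \<in> tuples n s" by (auto simp: tuples_def)
  thus ?case using SetVar.prems(1) assms by (cases b) auto
next
  case (Neg \<phi>)
  thus ?case using Neg.IH[of "\<not> b" e] by auto
next
  case (Conj \<phi> \<psi>)
  thus ?case using Conj.IH(1)[of b e] Conj.IH(2)[of b e] by (cases b) auto
next
  case (Disj \<phi> \<psi>)
  thus ?case using Disj.IH(1)[of b e] Disj.IH(2)[of b e] by (cases b) auto
next
  case (Ex x \<phi>)
  then obtain a where "a < n" "forces P Q n rels b (e(x := a)) \<phi>" b by auto
  moreover from this have "\<forall>i. (e(x := a)) i < n" "fo_wf ar s \<phi>"
    using Ex.prems(2,3) by auto
  ultimately have "fo_sat n rels S (e(x := a)) \<phi>"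
    using Ex.IH[of b "e(x := a)"] by blast
  thus ?case using \<open>a < n\<close> \<open>b\<close> by auto
qed auto

text \<open>A certificate is a list of slots, and forcing is demanded for every \<open>J\<close>
  containing them. Certificates of two subformulas can thus be concatenated, within the sum of their
  bounds.\<close>

lemma forces_complete_qfree:
  assumes "\<And>xs. xs \<in> tuples n s \<Longrightarrow> xs \<in> S \<Longrightarrow> \<exists>js. length js \<le> 2 \<and> set js \<subseteq> A \<and>
      (\<forall>J. set js \<subseteq> J \<longrightarrow> P J xs)"
    and "\<And>xs. xs \<in> tuples n s \<Longrightarrow> xs \<notin> S \<Longrightarrow> \<exists>js. length js \<le> 2 \<and> set js \<subseteq> A \<and>
      (\<forall>J. set js \<subseteq> J \<longrightarrow> Q J xs)"
    and "\<forall>i. e i < n"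
  shows "qfree \<phi> \<Longrightarrow> fo_wf ar s \<phi> \<Longrightarrow> fo_sat n rels S e \<phi> = b \<Longrightarrow>
    \<exists>js. length js \<le> slots \<phi> \<and> set js \<subseteq> A \<and> (\<forall>J. set js \<subseteq> J \<longrightarrow> forces (P J) (Q J) n rels b e \<phi>)"
proof (induction \<phi> arbitrary: b)
  case (SetVar xs)
  hence "map e xs \<in> tuples n s" using assms(3) by (auto simp: tuples_def)
  thus ?case using SetVar.prems(3) assms(1,2)[of "map e xs"] by (cases b) simp_all
next
  case (Neg \<phi>)
  thus ?case using Neg.IH[of "\<not> b"] by auto
next
  case (Conj \<phi> \<psi>)
  show ?case
  proof (cases b)
    case True
    obtain js js' where "length js \<le> slots \<phi>" "set js \<subseteq> A" "length js' \<le> slots \<psi>" "set js' \<subseteq> A"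
      "\<forall>J. set js \<subseteq> J \<longrightarrow> forces (P J) (Q J) n rels b e \<phi>"
      "\<forall>J. set js' \<subseteq> J \<longrightarrow> forces (P J) (Q J) n rels b e \<psi>"
      using Conj.IH(1)[of b] Conj.IH(2)[of b] Conj.prems True by auto
    thus ?thesis using True by (intro exI[of _ "js @ js'"]) auto
  next
    case False
    hence "(\<exists>js. length js \<le> slots \<phi> \<and> set js \<subseteq> A \<and> (\<forall>J. set js \<subseteq> J \<longrightarrow> forces (P J) (Q J) n rels b e \<phi>)) \<or>
      (\<exists>js. length js \<le> slots \<psi> \<and> set js \<subseteq> A \<and> (\<forall>J. set js \<subseteq> J \<longrightarrow> forces (P J) (Q J) n rels b e \<psi>))"
      using Conj.IH(1)[of b] Conj.IH(2)[of b] Conj.prems by auto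
    thus ?thesis using False by (elim disjE exE) (rule exI, force)+
  qed
next
  case (Disj \<phi> \<psi>)
  show ?case
  proof (cases b)
    case False
    obtain js js' where "length js \<le> slots \<phi>" "set js \<subseteq> A" "length js' \<le> slots \<psi>" "set js' \<subseteq> A"
      "\<forall>J. set js \<subseteq> J \<longrightarrow> forces (P J) (Q J) n rels b e \<phi>"
      "\<forall>J. set js' \<subseteq> J \<longrightarrow> forces (P J) (Q J) n rels b e \<psi>"
      using Disj.IH(1)[of b] Disj.IH(2)[of b] Disj.prems False by auto
    thus ?thesis using False by (intro exI[of _ "js @ js'"]) auto
  next
    case True
    hence "(\<exists>js. length js \<le> slots \<phi> \<and> set js \<subseteq> A \<and> (\<forall>J. set js \<subseteq> J \<longrightarrow> forces (P J) (Q J) n rels b e \<phi>)) \<or>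
      (\<exists>js. length js \<le> slots \<psi> \<and> set js \<subseteq> A \<and> (\<forall>J. set js \<subseteq> J \<longrightarrow> forces (P J) (Q J) n rels b e \<psi>))"
      using Disj.IH(1)[of b] Disj.IH(2)[of b] Disj.prems by auto
    thus ?thesis using True by (elim disjE exE) (rule exI, force)+
  qed
qed auto

lemma forces_complete:
  assumes "Sigma_fo (Suc 0) \<phi>"
    and "\<And>xs. xs \<in> tuples n s \<Longrightarrow> xs \<in> S \<Longrightarrow> \<exists>js. length js \<le> 2 \<and> set js \<subseteq> A \<and>
      (\<forall>J. set js \<subseteq> J \<longrightarrow> P J xs)"
    and "\<And>xs. xs \<in> tuples n s \<Longrightarrow> xs \<notin> S \<Longrightarrow> \<exists>js. length js \<le> 2 \<and> set js \<subseteq> A \<and>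
      (\<forall>J. set js \<subseteq> J \<longrightarrow> Q J xs)"
    and "\<forall>i. e i < n" and "fo_wf ar s \<phi>" and "fo_sat n rels S e \<phi>"
  shows "\<exists>js. length js \<le> slots \<phi> \<and> set js \<subseteq> A \<and>
      (\<forall>J. set js \<subseteq> J \<longrightarrow> forces (P J) (Q J) n rels True e \<phi>)"
  using assms(1,4-6)
proof (induction \<phi> arbitrary: e rule: Sigma_1_induct)
  case (qfree \<phi>)
  thus ?case using forces_complete_qfree[OF assms(2,3), where b = True and e = e and \<phi> = \<phi>] by simp
next
  case (Ex x \<phi>)
  obtain a where a: "a < n" "fo_sat n rels S (e(x := a)) \<phi>"
    using Ex.prems by auto
  have wf: "fo_wf ar s \<phi>" "\<forall>i. (e(x := a)) i < n"
    using a(1) Ex.prems(1,2) by auto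
  obtain js where "length js \<le> slots \<phi>" "set js \<subseteq> A"
      "\<forall>J. set js \<subseteq> J \<longrightarrow> forces (P J) (Q J) n rels True (e(x := a)) \<phi>"
    using Ex.IH[OF wf(2,1) a(2)] by blast
  thus ?case using a by (intro exI[of _ js]) auto
qed

text \<open>For \<open>c < N\<close> the value \<open>Suc c\<close> differs from the sentinel values
  \<open>0\<close> and \<open>N + 1\<close>, so finding it at any slot certifies membership.\<close>

definition member_cert :: "nat \<Rightarrow> nat \<Rightarrow> nat \<Rightarrow> nat \<Rightarrow> bool" where
  "member_cert D N v c \<longleftrightarrow> (\<exists>j<D. dg (N + 2) v j = Suc c)"

definition nonmember_cert :: "nat \<Rightarrow> nat \<Rightarrow> nat \<Rightarrow> nat \<Rightarrow> nat \<Rightarrow> nat \<Rightarrow> bool" where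
  "nonmember_cert D k N I v c \<longleftrightarrow> (\<exists>j<D. \<exists>l<D. dg (k + 2) I l = Suc (dg (k + 2) I j) \<and>
     dg (N + 2) v j < Suc c \<and> Suc c < dg (N + 2) v l)"

definition digit_env :: "nat \<Rightarrow> nat \<Rightarrow> nat \<Rightarrow> nat \<Rightarrow> nat" where
  "digit_env n m t i = (if i < m then dg n t i else 0)"

definition item_forces :: "nat \<Rightarrow> nat \<Rightarrow> nat \<Rightarrow> nat \<Rightarrow> nat \<Rightarrow> nat list set list \<Rightarrow> fo \<Rightarrow>
    nat \<Rightarrow> nat \<Rightarrow> nat \<Rightarrow> bool" where
  "item_forces D s m k n rels \<chi> t I v \<longleftrightarrow>
     forces (\<lambda>xs. member_cert D (n ^ s) v (idx n xs)) (\<lambda>xs. nonmember_cert D k (n ^ s) I v (idx n xs))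
       n rels True (digit_env n m t) \<chi>"

lemma digit_env_less: "0 < n \<Longrightarrow> digit_env n m t i < n"
  by (simp add: digit_env_def dg_less)

text \<open>The conditions are the \<open>n ^ m\<close> assignments to the variables below
  \<open>m\<close>, and the set of tuples becomes a set of numbers through \<open>idx\<close>. A
  guess is partial knowledge of the set variable, from which \<open>forces\<close> evaluates the
  matrix.\<close>

theorem WD_iff_hitting_set:
  fixes k n s m :: nat
  assumes n: "0 < n" and \<chi>: "Sigma_fo (Suc 0) \<chi>" "fo_wf ar s \<chi>" "fo_free \<chi> \<subseteq> {..<m}"
    and closed: "fo_free (foldr All ys \<chi>) = {}"
  defines "D \<equiv> slots \<chi> + 2"
  defines "K \<equiv> (k + 2) ^ D" and "V \<equiv> (n ^ s + 2) ^ D"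
  shows "(\<exists>S\<subseteq>tuples n s. card S = k \<and> fo_sat n rels S (\<lambda>_. 0) (foldr All ys \<chi>)) \<longleftrightarrow>
    (\<exists>Z\<subseteq>{..<K * V}. card Z \<le> K \<and> (\<forall>t<2 * (K * (K * (V * n ^ m))). \<exists>z\<in>Z.
       guess_hit D k (n ^ s) (item_forces D s m k n rels \<chi>) t z))"
proof -
  define N where "N = n ^ s"
  define dec where "dec S = {xs \<in> tuples n s. idx n xs \<in> S}" for S
  define sat where "sat t S = fo_sat n rels (dec S) (digit_env n m t) \<chi>" for t S
  have all_env: "fo_sat n rels S (\<lambda>_. 0) (foldr All ys \<chi>) \<longleftrightarrow>
      (\<forall>t<n ^ m. fo_sat n rels S (digit_env n m t) \<chi>)" for S
  proof -
    have "fo_sat n rels S (\<lambda>_. 0) (foldr All ys \<chi>) \<longleftrightarrow>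
        (\<forall>e. (\<forall>i. e i < n) \<longrightarrow> fo_sat n rels S e (foldr All ys \<chi>))"
      using fo_sat_cong[of "foldr All ys \<chi>" "\<lambda>_. 0" _ n rels S] closed n by auto
    also have "\<dots> \<longleftrightarrow> (\<forall>e. (\<forall>i. e i < n) \<longrightarrow> fo_sat n rels S e \<chi>)"
      by (rule fo_sat_prefix)
    also have "\<dots> \<longleftrightarrow> (\<forall>t<n ^ m. fo_sat n rels S (digit_env n m t) \<chi>)"
    proof (intro iffI allI impI)
      fix e :: "nat \<Rightarrow> nat"
      assume all: "\<forall>t<n ^ m. fo_sat n rels S (digit_env n m t) \<chi>" and e: "\<forall>i. e i < n"
      obtain t where t: "t < n ^ m" "\<forall>j<m. dg n t j = e j"
        using digits_exist[of m e n] e by blast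
      hence "\<forall>i\<in>fo_free \<chi>. digit_env n m t i = e i"
        using \<chi>(3) by (auto simp: digit_env_def)
      thus "fo_sat n rels S e \<chi>" using fo_sat_cong[of \<chi> _ e] all t(1) by metis
    qed (use n digit_env_less in auto)
    finally show ?thesis .
  qed
  have "(\<exists>S\<subseteq>tuples n s. card S = k \<and> fo_sat n rels S (\<lambda>_. 0) (foldr All ys \<chi>)) \<longleftrightarrow>
     (\<exists>S\<subseteq>{..<N}. card S = k \<and> (\<forall>t<n ^ m. sat t S))"
  proof
    have bij: "bij_betw (idx n) (tuples n s) {..<N}"
      unfolding N_def using n by (rule bij_betw_idx)
    note inj = bij_betw_imp_inj_on[OF bij]
    {
      assume "\<exists>S\<subseteq>tuples n s. card S = k \<and> fo_sat n rels S (\<lambda>_. 0) (foldr All ys \<chi>)"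
      then obtain S where S: "S \<subseteq> tuples n s" "card S = k"
        "\<forall>t<n ^ m. fo_sat n rels S (digit_env n m t) \<chi>"
        unfolding all_env by blast
      have "dec (idx n ` S) = S"
        using S(1) inj_on_image_mem_iff[OF inj _ S(1)] by (auto simp: dec_def)
      moreover have "card (idx n ` S) = k"
        using S card_image[OF inj_on_subset[OF inj S(1)]] by simp
      moreover have "idx n ` S \<subseteq> {..<N}"
        using S(1) bij_betw_imp_surj_on[OF bij] by blast
      ultimately show "\<exists>S\<subseteq>{..<N}. card S = k \<and> (\<forall>t<n ^ m. sat t S)"
        using S(3) by (intro exI[of _ "idx n ` S"]) (simp add: sat_def)
    }
    assume "\<exists>S\<subseteq>{..<N}. card S = k \<and> (\<forall>t<n ^ m. sat t S)"
    then obtain S where S: "S \<subseteq> {..<N}" "card S = k" "\<forall>t<n ^ m. sat t S" by blast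
    have sub: "dec S \<subseteq> tuples n s" by (auto simp: dec_def)
    have "idx n ` dec S = S"
      using S(1) bij_betw_imp_surj_on[OF bij] by (auto simp: dec_def image_iff) 
    hence "card (dec S) = k"
      using S(2) card_image[OF inj_on_subset[OF inj sub]] by simp
    thus "\<exists>S\<subseteq>tuples n s. card S = k \<and> fo_sat n rels S (\<lambda>_. 0) (foldr All ys \<chi>)"
      unfolding all_env using S(3) sub by (intro exI[of _ "dec S"]) (simp add: sat_def)
  qed
  also have "\<dots> \<longleftrightarrow> (\<exists>Z\<subseteq>{..<K * V}. card Z \<le> K \<and> (\<forall>t<2 * (K * (K * (V * n ^ m))). \<exists>z\<in>Z.
       guess_hit D k N (item_forces D s m k n rels \<chi>) t z))"
    unfolding K_def V_def N_def[symmetric]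
  proof (rule guess_hitting_set[symmetric])
    show "2 \<le> D" by (simp add: D_def)
    show "0 < n ^ m" using n by simp
    fix t a assume en: "enumerates N k a"
    have idN: "idx n xs < N" if "xs \<in> tuples n s" for xs
      using idx_less[OF that] by (simp add: N_def)
    have env: "\<forall>i. digit_env n m t i < n" using digit_env_less[OF n] by blast
    {
      fix I v assume v: "\<forall>j<D. dg (N + 2) v j = a (dg (k + 2) I j)"
        and f: "item_forces D s m k n rels \<chi> t I v"
      have dk: "dg (k + 2) I j \<le> Suc k" for j
        using dg_less[of "k + 2" I j] by simp
      show "sat t (enumerated k a)"
        unfolding sat_def
      proof (rule forces_sound[OF _ _ f[unfolded item_forces_def] \<chi>(2) env, THEN iffD2, OF _ _ TrueI])
        fix xs assume xs: "xs \<in> tuples n s"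
        {
          assume "member_cert D (n ^ s) v (idx n xs)"
          hence "\<exists>i\<le>Suc k. a i = Suc (idx n xs)"
            using v dk unfolding member_cert_def N_def by metis
          thus "xs \<in> dec (enumerated k a)"
            using enumerated_iff[OF en idN[OF xs]] xs by (simp add: dec_def)
        }
        assume "nonmember_cert D k (n ^ s) I v (idx n xs)"
        then obtain j l where jl: "j < D" "l < D" "dg (k + 2) I l = Suc (dg (k + 2) I j)"
            "dg (N + 2) v j < Suc (idx n xs)" "Suc (idx n xs) < dg (N + 2) v l"
          unfolding nonmember_cert_def N_def by blast
        have "dg (k + 2) I j \<le> k" using dk[of l] jl(3) by simp
        moreover have "a (dg (k + 2) I j) < Suc (idx n xs)" "Suc (idx n xs) < a (Suc (dg (k + 2) I j))"
          using jl v by metis+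
        ultimately have "idx n xs \<notin> enumerated k a"
          using not_enumerated_iff[OF en idN[OF xs]] by blast
        thus "xs \<notin> dec (enumerated k a)" by (simp add: dec_def)
      qed
    }
    assume "sat t (enumerated k a)"
    hence sat: "fo_sat n rels (dec (enumerated k a)) (digit_env n m t) \<chi>" by (simp add: sat_def)
    let ?P = "\<lambda>J xs. \<exists>i\<in>J. a i = Suc (idx n xs)"
    let ?Q = "\<lambda>J xs. \<exists>i. i \<in> J \<and> Suc i \<in> J \<and> a i < Suc (idx n xs) \<and> Suc (idx n xs) < a (Suc i)"
    have "\<exists>js. length js \<le> slots \<chi> \<and> set js \<subseteq> {..Suc k} \<and> (\<forall>J. set js \<subseteq> J \<longrightarrow>
        forces (?P J) (?Q J) n rels True (digit_env n m t) \<chi>)"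
    proof (rule forces_complete[OF \<chi>(1) _ _ env \<chi>(2) sat])
      fix xs assume xs: "xs \<in> tuples n s"
      {
        assume "xs \<in> dec (enumerated k a)"
        then obtain i where "i \<le> Suc k" "a i = Suc (idx n xs)"
          using enumerated_iff[OF en idN[OF xs]] by (auto simp: dec_def)
        thus "\<exists>js. length js \<le> 2 \<and> set js \<subseteq> {..Suc k} \<and> (\<forall>J. set js \<subseteq> J \<longrightarrow> ?P J xs)"
          by (intro exI[of _ "[i]"]) auto
      }
      assume "xs \<notin> dec (enumerated k a)"
      hence "idx n xs \<notin> enumerated k a" using xs by (simp add: dec_def)
      then obtain i where "i \<le> k" "a i < Suc (idx n xs)" "Suc (idx n xs) < a (Suc i)"
        using not_enumerated_iff[OF en idN[OF xs]] by blast
      thus "\<exists>js. length js \<le> 2 \<and> set js \<subseteq> {..Suc k} \<and> (\<forall>J. set js \<subseteq> J \<longrightarrow> ?Q J xs)"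
        by (intro exI[of _ "[i, Suc i]"]) auto
    qed
    then obtain js where js: "length js \<le> slots \<chi>" "set js \<subseteq> {..Suc k}"
      and frc: "\<And>J. set js \<subseteq> J \<Longrightarrow> forces (?P J) (?Q J) n rels True (digit_env n m t) \<chi>"
      by blast
    \<comment> \<open>The certificate is padded with slot 0 to \<open>D\<close> positions; further
      known slots do no harm.\<close>
    define f where "f j = (if j < length js then js ! j else 0)" for j
    have "f j < k + 2" for j
    proof (cases "j < length js")
      case True
      hence "js ! j \<le> Suc k" using js(2) nth_mem[OF True] by blast
      thus ?thesis using True by (simp add: f_def)
    qed (simp add: f_def)
    moreover have "item_forces D s m k n rels \<chi> t I v"
      if I: "\<forall>j<D. dg (k + 2) I j = f j" and v: "\<forall>j<D. dg (N + 2) v j = a (f j)" for I v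
    proof -
      let ?J = "f ` {..<D}"
      have "x \<in> ?J" if "x \<in> set js" for x
      proof -
        obtain j where "j < length js" "x = js ! j" using \<open>x \<in> set js\<close> by (auto simp: in_set_conv_nth)
        thus ?thesis using js(1) by (intro image_eqI[of _ _ j]) (auto simp: f_def D_def)
      qed
      hence "forces (?P ?J) (?Q ?J) n rels True (digit_env n m t) \<chi>" by (intro frc) blast
      moreover have "?P ?J = (\<lambda>xs. member_cert D (n ^ s) v (idx n xs))"
        using v unfolding member_cert_def N_def by (auto simp: fun_eq_iff)
      moreover have "?Q ?J = (\<lambda>xs. nonmember_cert D k (n ^ s) I v (idx n xs))"
      proof (rule ext, rule iffI)
        fix xs assume "?Q ?J xs"
        then obtain j l where "j < D" "l < D" "f l = Suc (f j)" "a (f j) < Suc (idx n xs)"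
          "Suc (idx n xs) < a (f l)" by auto
        thus "nonmember_cert D k (n ^ s) I v (idx n xs)"
          unfolding nonmember_cert_def N_def[symmetric]
          by (intro exI[of _ j] exI[of _ l] conjI) (use I v in simp_all)
      next
        fix xs assume "nonmember_cert D k (n ^ s) I v (idx n xs)"
        then obtain j l where jl: "j < D" "l < D" "dg (k + 2) I l = Suc (dg (k + 2) I j)"
            "dg (N + 2) v j < Suc (idx n xs)" "Suc (idx n xs) < dg (N + 2) v l"
          unfolding nonmember_cert_def N_def by blast
        hence "f l = Suc (f j)" and *: "a (f j) < Suc (idx n xs)" "Suc (idx n xs) < a (f l)"
          using I v by metis+
        moreover have "f j \<in> ?J" "f l \<in> ?J" using jl(1,2) by blast+
        ultimately have "f j \<in> ?J \<and> Suc (f j) \<in> ?J \<and> a (f j) < Suc (idx n xs) \<and>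
            Suc (idx n xs) < a (Suc (f j))"
          using * by simp
        thus "?Q ?J xs" by (rule exI)
      qed
      ultimately show ?thesis unfolding item_forces_def by simp
    qed
    ultimately show "\<exists>f. (\<forall>j<D. f j < k + 2) \<and> (\<forall>I v. (\<forall>j<D. dg (k + 2) I j = f j) \<longrightarrow>
        (\<forall>j<D. dg (N + 2) v j = a (f j)) \<longrightarrow> item_forces D s m k n rels \<chi> t I v)"
      by blast
  qed
  finally show ?thesis by (simp add: N_def)
qed

section \<open>Encodings\<close>

definition lead :: "bool list \<Rightarrow> nat" where
  "lead x = length (takeWhile id x)"

lemma lead_append: "lead (replicate n True @ False # y) = n"
  by (induction n) (auto simp: lead_def)

lemma less_lead_iff: "i < lead x \<longleftrightarrow> i < length x \<and> (\<forall>j\<le>i. x ! j)"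
proof (induction x arbitrary: i)
  case (Cons b x)
  show ?case
  proof (cases i)
    case 0
    thus ?thesis by (simp add: lead_def)
  next
    case (Suc i')
    have "(\<forall>j\<le>Suc i'. (b # x) ! j) \<longleftrightarrow> b \<and> (\<forall>j\<le>i'. x ! j)"
      unfolding less_Suc_eq_le[symmetric] All_less_Suc2 by simp
    thus ?thesis using Cons[of i'] Suc by (auto simp: lead_def)
  qed
qed (simp add: lead_def)

lemma upt_split: "a \<le> b \<Longrightarrow> b \<le> c \<Longrightarrow> [a..<c] = [a..<b] @ [b..<c]"
  by (metis le_add_diff_inverse upt_add_eq_append)

lemma upt_split_at: "i < c \<Longrightarrow> [0..<c] = [0..<i] @ i # [Suc i..<c]"
  using upt_split[of 0 i c] by (simp add: upt_conv_Cons)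

text \<open>\<open>Suc n\<close> skips the unary universe size and the separator.\<close>

definition block_start :: "nat list \<Rightarrow> nat \<Rightarrow> nat \<Rightarrow> nat" where
  "block_start ar n i = Suc n + sum_list (map (\<lambda>r. n ^ r) (take i ar))"

text \<open>Any bits may follow the unary prefix and the separator, so besides a nonempty universe
  only the length is checked.\<close>

definition well_formed :: "nat list \<Rightarrow> bool list \<Rightarrow> bool" where
  "well_formed ar x \<longleftrightarrow> 0 < lead x \<and> length x = block_start ar (lead x) (length ar)"

definition decode_rels :: "nat list \<Rightarrow> bool list \<Rightarrow> nat list set list" where
  "decode_rels ar x = map (\<lambda>i. {xs \<in> tuples (lead x) (ar ! i).
     x ! (block_start ar (lead x) i + idx (lead x) xs)}) [0..<length ar]"

lemma block_start_Suc:
  "i < length ar \<Longrightarrow> block_start ar n (Suc i) = block_start ar n i + n ^ (ar ! i)"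
  by (simp add: block_start_def take_Suc_conv_app_nth)

lemma block_start_le:
  assumes "i < length ar"
  shows "block_start ar n i + n ^ (ar ! i) \<le> block_start ar n (length ar)"
proof -
  have "sum_list (map (\<lambda>r. n ^ r) ar) =
      sum_list (map (\<lambda>r. n ^ r) (take (Suc i) ar)) + sum_list (map (\<lambda>r. n ^ r) (drop (Suc i) ar))"
    by (metis append_take_drop_id map_append sum_list_append)
  thus ?thesis using assms by (simp add: block_start_def take_Suc_conv_app_nth)
qed

lemma structure_string_eq:
  "structure_string ar n rels = replicate n True @ False #
     concat (map (\<lambda>i. map (\<lambda>j. map (dg n j) [0..<ar ! i] \<in> rels ! i) [0..<n ^ (ar ! i)]) [0..<length ar])"
  by (simp add: structure_string_def n_lists_upt o_def)

lemma length_blocks: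
  "i \<le> length ar \<Longrightarrow> length (concat (map (\<lambda>i. map (f i) [0..<n ^ (ar ! i)]) [0..<i])) + Suc n =
     block_start ar n i"
proof (induction i)
  case 0
  show ?case by (simp add: block_start_def)
next
  case (Suc i)
  thus ?case using block_start_Suc[of i ar n] by simp
qed

lemma nth_block:
  assumes "i < length ar" "j < n ^ (ar ! i)"
  shows "(replicate n True @ False # concat (map (\<lambda>i. map (f i) [0..<n ^ (ar ! i)]) [0..<length ar]))
      ! (block_start ar n i + j) = f i j"
proof -
  let ?c = "\<lambda>i. map (f i) [0..<n ^ (ar ! i)]"
  let ?pre = "replicate n True @ False # concat (map ?c [0..<i])"
  have "[0..<length ar] = [0..<i] @ i # [Suc i..<length ar]"
    using assms(1) by (rule upt_split_at)
  hence eq: "replicate n True @ False # concat (map ?c [0..<length ar]) =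
      ?pre @ ?c i @ concat (map ?c [Suc i..<length ar])"
    by simp
  have "length ?pre = block_start ar n i"
    using length_blocks[of i ar f n] assms(1) by simp
  moreover have "(?pre @ ?c i @ concat (map ?c [Suc i..<length ar])) ! (length ?pre + j) = f i j"
    unfolding nth_append_length_plus using assms(2) by (simp add: nth_append)
  ultimately show ?thesis
    by (simp only: eq)
qed

lemma structure_string_decode:
  assumes "fo_structure ar n rels"
  shows "lead (structure_string ar n rels) = n"
    and "well_formed ar (structure_string ar n rels)"
    and "decode_rels ar (structure_string ar n rels) = rels"
proof -
  let ?x = "structure_string ar n rels"
  have n: "0 < n" and len: "length rels = length ar"
    and sub: "\<And>i. i < length ar \<Longrightarrow> rels ! i \<subseteq> tuples n (ar ! i)"
    using assms by (auto simp: fo_structure_def)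
  show lead: "lead ?x = n"
    by (simp add: structure_string_eq lead_append)
  have "length ?x = block_start ar n (length ar)"
    using length_blocks[of "length ar" ar "\<lambda>i j. map (dg n j) [0..<ar ! i] \<in> rels ! i" n]
    by (simp add: structure_string_eq)
  thus "well_formed ar ?x" using n by (simp add: well_formed_def lead)
  have "decode_rels ar ?x ! i = rels ! i" if i: "i < length ar" for i
  proof -
    have "?x ! (block_start ar n i + idx n xs) \<longleftrightarrow> xs \<in> rels ! i" if "xs \<in> tuples n (ar ! i)" for xs
      unfolding structure_string_eq
      using nth_block[OF i idx_less[OF that], of "\<lambda>i j. map (dg n j) [0..<ar ! i] \<in> rels ! i"]
      by (simp add: map_dg_idx[OF that])
    thus ?thesis using sub[OF i] i by (auto simp: decode_rels_def lead)
  qed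
  thus "decode_rels ar ?x = rels"
    using len by (intro nth_equalityI) (auto simp: decode_rels_def)
qed

lemma decode_structure:
  assumes "well_formed ar x"
  shows "structure_string ar (lead x) (decode_rels ar x) = x"
    and "fo_structure ar (lead x) (decode_rels ar x)"
proof -
  let ?n = "lead x" and ?R = "decode_rels ar x"
  have n: "0 < ?n" and len: "length x = block_start ar ?n (length ar)"
    using assms by (auto simp: well_formed_def)
  show "fo_structure ar ?n ?R"
    using n by (auto simp: fo_structure_def decode_rels_def)
  let ?f = "\<lambda>i j. map (dg ?n j) [0..<ar ! i] \<in> ?R ! i"
  have blocks: "concat (map (\<lambda>i. map (?f i) [0..<?n ^ (ar ! i)]) [0..<i]) =
      map ((!) x) [Suc ?n..<block_start ar ?n i]" if "i \<le> length ar" for i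
    using that
  proof (induction i)
    case 0
    show ?case by (simp add: block_start_def)
  next
    case (Suc i)
    let ?b = "block_start ar ?n i"
    have i: "i < length ar" using Suc.prems by simp
    have "map (?f i) [0..<?n ^ (ar ! i)] = map (\<lambda>j. x ! (?b + j)) [0..<?n ^ (ar ! i)]"
      using i n by (auto simp: decode_rels_def idx_map_dg map_dg_tuples)
    also have "\<dots> = map ((!) x) [?b..<?b + ?n ^ (ar ! i)]"
      by (rule nth_equalityI) auto
    finally have "concat (map (\<lambda>i. map (?f i) [0..<?n ^ (ar ! i)]) [0..<Suc i]) =
        map ((!) x) [Suc ?n..<?b] @ map ((!) x) [?b..<?b + ?n ^ (ar ! i)]"
      using Suc by simp
    moreover have "Suc ?n \<le> ?b" by (simp add: block_start_def)
    ultimately show ?case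
      using block_start_Suc[OF i, of ?n] upt_split[of "Suc ?n" ?b "?b + ?n ^ (ar ! i)"]
      by (simp flip: map_append)
  qed
  have len': "?n < length x" using len by (simp add: block_start_def)
  have "x = map ((!) x) [0..<length x]" by (rule map_nth[symmetric])
  also have "[0..<length x] = [0..<?n] @ ?n # [Suc ?n..<length x]"
    using len' by (rule upt_split_at)
  also have "map ((!) x) \<dots> = map ((!) x) [0..<?n] @ x ! ?n # map ((!) x) [Suc ?n..<length x]"
    by simp
  also have "map ((!) x) [0..<?n] = replicate ?n True"
    by (rule nth_equalityI) (use less_lead_iff[of _ x] in auto)
  also have "x ! ?n = False"
    using nth_length_takeWhile[of id x] len' by (simp add: lead_def)
  finally show "structure_string ar ?n ?R = x"
    using blocks[of "length ar"] by (simp add: structure_string_eq len)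
qed

text \<open>Encoding and decoding are mutually inverse, so the structure quantified in
  \<open>WD\<close> can be replaced by the decoded one.\<close>

lemma WD_decode:
  "(x, k) \<in> WD ar s \<phi> \<longleftrightarrow> well_formed ar x \<and>
     (\<exists>S\<subseteq>tuples (lead x) s. card S = k \<and> fo_sat (lead x) (decode_rels ar x) S (\<lambda>_. 0) \<phi>)"
    (is "?L \<longleftrightarrow> ?R")
proof
  assume ?L
  then obtain n rels where "x = structure_string ar n rels" "fo_structure ar n rels"
      "\<exists>S\<subseteq>tuples n s. card S = k \<and> fo_sat n rels S (\<lambda>_. 0) \<phi>"
    unfolding WD_def by blast
  thus ?R using structure_string_decode by simp
next
  assume ?R
  hence "x = structure_string ar (lead x) (decode_rels ar x)"
      "fo_structure ar (lead x) (decode_rels ar x)"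
    using decode_structure[of ar x] by auto
  thus ?L unfolding WD_def using \<open>?R\<close> by blast
qed

text \<open>Position \<open>n\<close> satisfies no disjunct: it is the separator.\<close>

definition dst_bit :: "nat \<Rightarrow> nat pair_pre_digraph \<Rightarrow> nat \<Rightarrow> nat set \<Rightarrow> nat \<Rightarrow> bool" where
  "dst_bit n D r T j \<longleftrightarrow> j < n \<or>
     (n < j \<and> j < Suc n + n * n \<and> ((j - Suc n) div n, (j - Suc n) mod n) \<in> parcs D) \<or>
     (Suc n + n * n \<le> j \<and> j < Suc n + n * n + n \<and> j - (Suc n + n * n) = r) \<or>
     (Suc n + n * n + n \<le> j \<and> j - (Suc n + n * n + n) \<in> T)"

lemma map_upt_shift: "map f [a..<a + b] = map (\<lambda>i. f (a + i)) [0..<b]"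
  by (rule nth_equalityI) auto

lemma dst_string_bits:
  "dst_string n D r T = map (dst_bit n D r T) [0..<Suc n + n * n + n + n]"
proof -
  let ?b = "dst_bit n D r T"
  have "[0..<Suc n + n * n + n + n] = [0..<n] @ [n] @ [Suc n..<Suc n + n * n] @
      [Suc n + n * n..<Suc n + n * n + n] @ [Suc n + n * n + n..<Suc n + n * n + n + n]"
    using upt_split_at[of n "Suc n + n * n + n + n"]
      upt_split[of "Suc n" "Suc n + n * n" "Suc n + n * n + n + n"]
      upt_split[of "Suc n + n * n" "Suc n + n * n + n" "Suc n + n * n + n + n"]
    by (simp del: upt_Suc)
  moreover have "map ?b [0..<n] = replicate n True"
    by (rule nth_equalityI) (auto simp: dst_bit_def)
  moreover have "map ?b [n] = [False]"
    by (simp add: dst_bit_def)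
  moreover have "map ?b [Suc n..<Suc n + n * n] =
      concat (map (\<lambda>u. map (\<lambda>v. (u, v) \<in> parcs D) [0..<n]) [0..<n])"
    unfolding concat_map_upt map_upt_shift by (auto simp: dst_bit_def)
  moreover have "map ?b [Suc n + n * n..<Suc n + n * n + n] = map (\<lambda>v. v = r) [0..<n]"
    unfolding map_upt_shift by (auto simp: dst_bit_def)
  moreover have "map ?b [Suc n + n * n + n..<Suc n + n * n + n + n] = map (\<lambda>v. v \<in> T) [0..<n]"
    unfolding map_upt_shift by (auto simp: dst_bit_def)
  ultimately show ?thesis
    by (simp only: map_append dst_string_def)
qed

text \<open>\<open>DST\<close> quantifies over instances, so a string could enter it through another
  instance with the same encoding; injectivity excludes this.\<close>

lemma dst_string_inj:
  assumes inst: "dst_instance n D r T" "dst_instance n' D' r' T'"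
    and eq: "dst_string n D r T = dst_string n' D' r' T'"
  shows "n = n' \<and> D = D' \<and> r = r' \<and> T = T'"
proof -
  have "lead (dst_string n D r T) = n" "lead (dst_string n' D' r' T') = n'"
    by (simp_all add: dst_string_def lead_append)
  hence n: "n = n'" using eq by simp
  have all: "\<forall>j\<in>set [0..<Suc n + n * n + n + n]. dst_bit n D r T j = dst_bit n D' r' T' j"
    using eq unfolding dst_string_bits n[symmetric] by (simp only: map_eq_conv)
  have bit: "dst_bit n D r T j \<longleftrightarrow> dst_bit n D' r' T' j" if "j < Suc n + n * n + n + n" for j
    by (rule bspec[OF all]) (use that in \<open>simp del: upt_Suc\<close>)
  have V: "pverts D = {..<n}" "pverts D' = {..<n}" "r < n" "r' < n" "T \<subseteq> {..<n}" "T' \<subseteq> {..<n}"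
    and D: "pair_digraph D" "pair_digraph D'"
    using inst n by (auto simp: dst_instance_def)
  have arcs: "(u, v) \<in> parcs D \<longleftrightarrow> (u, v) \<in> parcs D'" if "u < n" "v < n" for u v
  proof -
    have lt: "v + n * u < n * n" by (rule mod_div_less) (use that in auto)
    have "dst_bit n E q X (Suc n + (v + n * u)) \<longleftrightarrow> (u, v) \<in> parcs E" for E q X
      using lt that mod_div_eqI[of v n u] by (simp add: dst_bit_def)
    thus ?thesis using bit[of "Suc n + (v + n * u)"] lt by simp
  qed
  have small: "u < n \<and> v < n" if "(u, v) \<in> parcs E" "pair_digraph E" "pverts E = {..<n}" for u v E
  proof -
    interpret pair_digraph E by (rule that(2))
    show ?thesis using arc_fst_in_verts[OF that(1)] arc_snd_in_verts[OF that(1)] that(3) by simp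
  qed
  have "parcs D = parcs D'"
  proof (rule set_eqI)
    fix e
    show "e \<in> parcs D \<longleftrightarrow> e \<in> parcs D'"
      using small[OF _ D(1) V(1), of "fst e" "snd e"] small[OF _ D(2) V(2), of "fst e" "snd e"]
        arcs[of "fst e" "snd e"] by auto
  qed
  hence "D = D'" using V(1,2) by (intro pair_pre_digraph.equality) auto
  moreover have "r = r'"
  proof -
    have "dst_bit n E q X (Suc n + n * n + r) \<longleftrightarrow> r = q" for E q X
      using V by (auto simp: dst_bit_def)
    thus ?thesis using bit[of "Suc n + n * n + r"] V(3) by simp
  qed
  moreover have "T = T'"
  proof -
    have "dst_bit n E q X (Suc n + n * n + n + v) \<longleftrightarrow> v \<in> X" if "v < n" for E q X v
      using V that by (auto simp: dst_bit_def)
    hence "v \<in> T \<longleftrightarrow> v \<in> T'" if "v < n" for v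
      using bit[of "Suc n + n * n + n + v"] that by simp
    thus ?thesis using V by blast
  qed
  ultimately show ?thesis using n by blast
qed

lemma dst_string_in_DST:
  assumes "dst_instance n D r T"
  shows "(dst_string n D r T, k) \<in> DST \<longleftrightarrow> dst_solvable D r T k"
proof
  assume "(dst_string n D r T, k) \<in> DST"
  then obtain n' D' r' T' where "dst_string n D r T = dst_string n' D' r' T'"
      "dst_instance n' D' r' T'" "dst_solvable D' r' T' k"
    unfolding DST_def by blast
  thus "dst_solvable D r T k" using dst_string_inj[OF assms] by metis
next
  assume "dst_solvable D r T k"
  thus "(dst_string n D r T, k) \<in> DST" using assms unfolding DST_def by blast
qed

section \<open>The reduction as a program\<close>

locale wd_problem =
  fixes ar :: "nat list" and s m :: nat and \<chi> :: fo
  assumes Sigma_1: "Sigma_fo (Suc 0) \<chi>" and wf: "fo_wf ar s \<chi>" and free: "fo_free \<chi> \<subseteq> {..<m}"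
begin

definition D :: nat where "D = slots \<chi> + 2"

text \<open>The maximum keeps the number of clauses positive on strings that encode no structure; they
  yield instances without solution, as their clauses are hit by no item.\<close>

definition univ :: "bool list \<Rightarrow> nat" where "univ x = max 1 (lead x)"
definition K :: "nat \<Rightarrow> nat" where "K k = (k + 2) ^ D"
definition V :: "bool list \<Rightarrow> nat" where "V x = (univ x ^ s + 2) ^ D"
definition items :: "bool list \<Rightarrow> nat \<Rightarrow> nat" where "items x k = K k * V x"
definition clauses :: "bool list \<Rightarrow> nat \<Rightarrow> nat" where
  "clauses x k = 2 * (K k * (K k * (V x * univ x ^ m)))"

definition hit :: "bool list \<Rightarrow> nat \<Rightarrow> nat \<Rightarrow> nat \<Rightarrow> bool" where
  "hit x k t z \<longleftrightarrow> well_formed ar x \<and>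
     guess_hit D k (univ x ^ s) (item_forces D s m k (univ x) (decode_rels ar x) \<chi>) t z"

definition size :: "bool list \<Rightarrow> nat \<Rightarrow> nat" where
  "size x k = Suc (clauses x k) * Suc (items x k)"

definition graph :: "bool list \<Rightarrow> nat \<Rightarrow> nat pair_pre_digraph" where
  "graph x k = hs_digraph (clauses x k) (items x k) (hit x k)"

definition terminals :: "bool list \<Rightarrow> nat \<Rightarrow> nat set" where
  "terminals x k = hs_terminals (clauses x k) (items x k)"

definition red :: "bool list \<times> nat \<Rightarrow> bool list \<times> nat" where
  "red = (\<lambda>(x, k). (dst_string (size x k) (graph x k) 0 (terminals x k), K k))"

lemma red_instance: "dst_instance (size x k) (graph x k) 0 (terminals x k)"
  unfolding size_def graph_def terminals_def by (rule dst_instance_hs_digraph)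

lemma red_degenerate: "range red \<subseteq> DST_degenerate_instances 2"
proof
  fix I assume "I \<in> range red"
  then obtain x k where I: "I = red (x, k)" by auto
  have "digraph_degeneracy (graph x k) \<le> 2"
    unfolding graph_def by (rule degeneracy_hs_digraph)
  thus "I \<in> DST_degenerate_instances 2"
    unfolding DST_degenerate_instances_def I red_def prod.case using red_instance by blast
qed

lemma red_correct:
  assumes closed: "fo_free (foldr All ys \<chi>) = {}"
  shows "I \<in> WD ar s (foldr All ys \<chi>) \<longleftrightarrow> red I \<in> DST"
proof -
  obtain x k where I: "I = (x, k)" by (cases I)
  have "red I \<in> DST \<longleftrightarrow> dst_solvable (graph x k) 0 (terminals x k) (K k)"
    unfolding I red_def prod.case by (rule dst_string_in_DST[OF red_instance])
  also have "\<dots> \<longleftrightarrow> (\<exists>Z\<subseteq>{..<items x k}. card Z \<le> K k \<and> (\<forall>t<clauses x k. \<exists>z\<in>Z. hit x k t z))"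
    unfolding graph_def terminals_def by (rule dst_solvable_hs_digraph)
  also have "\<dots> \<longleftrightarrow> I \<in> WD ar s (foldr All ys \<chi>)"
  proof (cases "well_formed ar x")
    case True
    hence u: "0 < lead x" "univ x = lead x" by (auto simp: well_formed_def univ_def)
    show ?thesis
      unfolding I WD_decode using True
        WD_iff_hitting_set[OF u(1) Sigma_1 wf free closed, of k "decode_rels ar x"]
      by (simp add: hit_def items_def clauses_def K_def V_def D_def u(2) del: power_Suc)
  next
    case False
    have "0 < univ x" by (simp add: univ_def max_def)
    hence "0 < clauses x k" by (simp add: clauses_def K_def V_def)
    thus ?thesis using False unfolding I WD_decode hit_def by auto
  qed
  finally show ?thesis by blast
qed

end

section \<open>Logic inside bounded arithmetic\<close>

abbreviation holds :: "bexp \<Rightarrow> nat \<Rightarrow> (nat \<Rightarrow> nat) \<Rightarrow> bool" where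
  "holds e x r \<equiv> 0 < ev e x r"

text \<open>Truth is a nonzero value: product is conjunction, sum is disjunction or bounded
  quantification, truncated difference is strict comparison. Negation always yields 0 or 1, which
  matters where truth values are counted or output.\<close>

definition NotE :: "bexp \<Rightarrow> bexp" where "NotE a = Sub (Num 1) a"
definition AndE :: "bexp \<Rightarrow> bexp \<Rightarrow> bexp" where "AndE a b = Mul a b"
definition OrE :: "bexp \<Rightarrow> bexp \<Rightarrow> bexp" where "OrE a b = Add a b"
definition ImpE :: "bexp \<Rightarrow> bexp \<Rightarrow> bexp" where "ImpE a b = OrE (NotE a) b"
definition ExE :: "nat \<Rightarrow> bexp \<Rightarrow> bexp \<Rightarrow> bexp" where "ExE v a b = BSum v a b"
definition EqE :: "bexp \<Rightarrow> bexp \<Rightarrow> bexp" where "EqE a b = NotE (Add (Sub a b) (Sub b a))"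
definition LessE :: "bexp \<Rightarrow> bexp \<Rightarrow> bexp" where "LessE a b = Sub b a"
definition ModE :: "bexp \<Rightarrow> bexp \<Rightarrow> bexp" where "ModE a b = Sub a (Mul (Quo a b) b)"
primrec PowE :: "bexp \<Rightarrow> nat \<Rightarrow> bexp" where
  "PowE a 0 = Num 1"
| "PowE a (Suc j) = Mul a (PowE a j)"
definition DigitE :: "bexp \<Rightarrow> bexp \<Rightarrow> nat \<Rightarrow> bexp" where
  "DigitE b w j = ModE (Quo w (PowE b j)) b"
definition SumE :: "bexp list \<Rightarrow> bexp" where "SumE es = foldr Add es (Num 0)"
definition ProdE :: "bexp list \<Rightarrow> bexp" where "ProdE es = foldr Mul es (Num 1)"

lemma ev_NotE: "ev (NotE a) x r = of_bool (ev a x r = 0)"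
  by (simp add: NotE_def)

lemma holds_NotE [simp]: "holds (NotE a) x r \<longleftrightarrow> \<not> holds a x r"
  by (simp add: ev_NotE)

lemma holds_OrE [simp]: "holds (OrE a b) x r \<longleftrightarrow> holds a x r \<or> holds b x r"
  by (simp add: OrE_def)

lemma holds_AndE [simp]: "holds (AndE a b) x r \<longleftrightarrow> holds a x r \<and> holds b x r"
  by (simp add: AndE_def)

lemma holds_ImpE [simp]: "holds (ImpE a b) x r \<longleftrightarrow> (holds a x r \<longrightarrow> holds b x r)"
  unfolding ImpE_def holds_OrE holds_NotE imp_conv_disj ..

lemma holds_ExE [simp]: "holds (ExE v a b) x r \<longleftrightarrow> (\<exists>i<ev a x r. holds b x (r(v := i)))"
proof -
  have "ev (ExE v a b) x r = 0 \<longleftrightarrow> (\<forall>i<ev a x r. ev b x (r(v := i)) = 0)"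
    by (simp add: ExE_def Ball_def)
  thus ?thesis by auto
qed

lemma holds_EqE [simp]: "holds (EqE a b) x r \<longleftrightarrow> ev a x r = ev b x r"
  unfolding EqE_def holds_NotE by auto

lemma holds_LessE [simp]: "holds (LessE a b) x r \<longleftrightarrow> ev a x r < ev b x r"
  by (simp add: LessE_def)

lemma ev_ModE [simp]: "ev (ModE a b) x r = ev a x r mod ev b x r"
  by (simp add: ModE_def minus_div_mult_eq_mod)

lemma ev_PowE [simp]: "ev (PowE a j) x r = ev a x r ^ j"
  by (induction j) auto

lemma ev_DigitE [simp]: "ev (DigitE b w j) x r = dg (ev b x r) (ev w x r) j"
  by (simp add: DigitE_def dg_def)

lemma ev_SumE: "ev (SumE es) x r = sum_list (map (\<lambda>e. ev e x r) es)"
  unfolding SumE_def by (induction es) auto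

lemma holds_SumE [simp]: "holds (SumE es) x r \<longleftrightarrow> (\<exists>e\<in>set es. holds e x r)"
  unfolding ev_SumE by (induction es) auto

lemma holds_ProdE [simp]: "holds (ProdE es) x r \<longleftrightarrow> (\<forall>e\<in>set es. holds e x r)"
  unfolding ProdE_def by (induction es) auto

lemma holds_Bind: "holds (Bind v a b) x r \<longleftrightarrow> holds b x (r(v := ev a x r))"
  by simp

text \<open>Counts the positions up to which all bits are set; the outer negation makes each summand
  0 or 1.\<close>

definition LeadE :: bexp where
  "LeadE = BSum 7 (Var 1) (NotE (ExE 8 (Add (Var 7) (Num 1)) (NotE (Bit (Var 8)))))"

lemma ev_LeadE:
  assumes "r 1 = length x"
  shows "ev LeadE (string_num x) r = lead x"
proof -
  have "ev (NotE (ExE 8 (Add (Var 7) (Num 1)) (NotE (Bit (Var 8))))) (string_num x) (r(7 := i)) =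
      of_bool (i < lead x)" if i: "i < length x" for i
  proof -
    have "holds (NotE (ExE 8 (Add (Var 7) (Num 1)) (NotE (Bit (Var 8))))) (string_num x) (r(7 := i))
      \<longleftrightarrow> (\<forall>j\<le>i. x ! j)"
      using i string_num_bit[of _ x] by (auto simp: less_Suc_eq_le)
    also have "\<dots> \<longleftrightarrow> i < lead x" using i by (simp add: less_lead_iff)
    finally show ?thesis by (auto simp: ev_NotE)
  qed
  hence "ev LeadE (string_num x) r = (\<Sum>i<length x. of_bool (i < lead x))"
    unfolding LeadE_def using assms by (simp del: fun_upd_apply)
  also have "\<dots> = card ({..<length x} \<inter> {i. i < lead x})"
    by simp
  also have "{..<length x} \<inter> {i. i < lead x} = {..<lead x}"
    using less_lead_iff[of _ x] by auto
  finally show ?thesis by simp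
qed

text \<open>Variables: 0 parameter, 1 input length, 2 index of the output bit, 4 universe size,
  5 number of clauses, 6 number of items, 7 number of vertices, 8 to 11 coordinates of the two ends
  of an arc, 12 clause, 13 item, 14 and 15 the slots and values of the item, 16 to 19 the components
  \<open>I\<close>, \<open>u\<close>, \<open>J\<close>, \<open>e\<close> of the clause, and \<open>20 + i\<close> the first-order variable \<open>i\<close>.\<close>

context wd_problem
begin

section \<open>Clauses and the formula as expressions\<close>

definition NE :: bexp where "NE = PowE (Var 4) s"
definition KE :: bexp where "KE = PowE (Add (Var 0) (Num 2)) D"
definition VE :: bexp where "VE = PowE (Add NE (Num 2)) D"
definition SlotE :: "bexp \<Rightarrow> nat \<Rightarrow> bexp" where "SlotE w j = DigitE (Add (Var 0) (Num 2)) w j"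
definition ValE :: "bexp \<Rightarrow> nat \<Rightarrow> bexp" where "ValE w j = DigitE (Add NE (Num 2)) w j"

lemma ev_NE [simp]: "ev NE x r = r 4 ^ s"
  and ev_KE [simp]: "ev KE x r = (r 0 + 2) ^ D"
  and ev_VE [simp]: "ev VE x r = (r 4 ^ s + 2) ^ D"
  and ev_SlotE [simp]: "ev (SlotE w j) x r = dg (r 0 + 2) (ev w x r) j"
  and ev_ValE [simp]: "ev (ValE w j) x r = dg (r 4 ^ s + 2) (ev w x r) j"
  by (simp_all add: NE_def KE_def VE_def SlotE_def ValE_def)

definition OkE :: bexp where
  "OkE = ProdE (map (\<lambda>j. ProdE (
     ImpE (EqE (SlotE (Var 14) j) (Num 0)) (EqE (ValE (Var 15) j) (Num 0)) #
     ImpE (EqE (SlotE (Var 14) j) (Add (Var 0) (Num 1))) (EqE (ValE (Var 15) j) (Add NE (Num 1))) #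
     map (\<lambda>l. ImpE (LessE (SlotE (Var 14) j) (SlotE (Var 14) l))
       (LessE (ValE (Var 15) j) (ValE (Var 15) l))) [0..<D])) [0..<D])"

lemma holds_OkE: "holds OkE x r \<longleftrightarrow> guess_ok D (r 0) (r 4 ^ s) (r 14) (r 15)"
  by (auto simp: OkE_def guess_ok_def)

definition ConsE :: bexp where
  "ConsE = ProdE (map (\<lambda>j. ProdE (map (\<lambda>l.
     ImpE (EqE (SlotE (Var 16) j) (SlotE (Var 18) l)) (EqE (ValE (Var 17) j) (ValE (Var 15) l)))
     [0..<D])) [0..<D])"

lemma holds_ConsE: "holds ConsE x r \<longleftrightarrow> consistent D (r 0) (r 4 ^ s) (r 16) (r 17) (r 18) (r 15)"
  by (auto simp: ConsE_def consistent_def)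

primrec IdxE :: "nat list \<Rightarrow> bexp" where
  "IdxE [] = Num 0"
| "IdxE (y # ys) = Add (Var (20 + y)) (Mul (Var 4) (IdxE ys))"

lemma ev_IdxE [simp]: "ev (IdxE ys) x r = idx (r 4) (map (\<lambda>i. r (20 + i)) ys)"
  by (induction ys) auto

definition BlockE :: "nat \<Rightarrow> bexp" where
  "BlockE i = Add (Add (Var 4) (Num 1)) (SumE (map (PowE (Var 4)) (take i ar)))"

lemma ev_BlockE [simp]: "ev (BlockE i) x r = block_start ar (r 4) i"
  by (simp add: BlockE_def block_start_def ev_SumE o_def)

definition MemberE :: "bexp \<Rightarrow> bexp" where
  "MemberE c = SumE (map (\<lambda>j. EqE (ValE (Var 15) j) (Add c (Num 1))) [0..<D])"

definition NonmemberE :: "bexp \<Rightarrow> bexp" where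
  "NonmemberE c = SumE (map (\<lambda>j. SumE (map (\<lambda>l.
     AndE (EqE (SlotE (Var 14) l) (Add (SlotE (Var 14) j) (Num 1)))
       (AndE (LessE (ValE (Var 15) j) (Add c (Num 1))) (LessE (Add c (Num 1)) (ValE (Var 15) l))))
     [0..<D])) [0..<D])"

lemma holds_MemberE: "holds (MemberE c) x r \<longleftrightarrow> member_cert D (r 4 ^ s) (r 15) (ev c x r)"
  by (auto simp: MemberE_def member_cert_def)

lemma holds_NonmemberE:
  "holds (NonmemberE c) x r \<longleftrightarrow> nonmember_cert D (r 0) (r 4 ^ s) (r 14) (r 15) (ev c x r)"
  by (simp add: NonmemberE_def nonmember_cert_def Bex_def)

text \<open>The polarity \<open>b\<close> is resolved when the expression is built, as in
  \<open>forces\<close>, so each atom of the set variable becomes a test for one kind of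
  certificate.\<close>

primrec FormulaE :: "bool \<Rightarrow> fo \<Rightarrow> bexp" where
  "FormulaE b (Eq x y) = (if b then EqE (Var (20 + x)) (Var (20 + y))
     else NotE (EqE (Var (20 + x)) (Var (20 + y))))"
| "FormulaE b (Rel i xs) = (if b then Bit (Add (BlockE i) (IdxE xs))
     else NotE (Bit (Add (BlockE i) (IdxE xs))))"
| "FormulaE b (SetVar xs) = (if b then MemberE (IdxE xs) else NonmemberE (IdxE xs))"
| "FormulaE b (Neg \<phi>) = FormulaE (\<not> b) \<phi>"
| "FormulaE b (Conj \<phi> \<psi>) = (if b then AndE (FormulaE b \<phi>) (FormulaE b \<psi>)
     else OrE (FormulaE b \<phi>) (FormulaE b \<psi>))"
| "FormulaE b (Disj \<phi> \<psi>) = (if b then OrE (FormulaE b \<phi>) (FormulaE b \<psi>)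
     else AndE (FormulaE b \<phi>) (FormulaE b \<psi>))"
| "FormulaE b (Ex x \<phi>) = (if b then ExE (20 + x) (Var 4) (FormulaE b \<phi>) else Num 0)"
| "FormulaE b (All x \<phi>) = Num 0"

lemma holds_FormulaE:
  assumes x: "well_formed ar x"
  shows "r 4 = lead x \<Longrightarrow> fo_wf ar s \<phi> \<Longrightarrow> \<forall>i. r (20 + i) < lead x \<Longrightarrow>
    holds (FormulaE b \<phi>) (string_num x) r \<longleftrightarrow>
    forces (\<lambda>xs. member_cert D (lead x ^ s) (r 15) (idx (lead x) xs))
      (\<lambda>xs. nonmember_cert D (r 0) (lead x ^ s) (r 14) (r 15) (idx (lead x) xs))
      (lead x) (decode_rels ar x) b (\<lambda>i. r (20 + i)) \<phi>"
proof (induction \<phi> arbitrary: b r)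
  case (Rel i xs)
  let ?xs = "map (\<lambda>i. r (20 + i)) xs"
  have i: "i < length ar" and xs: "?xs \<in> tuples (lead x) (ar ! i)"
    using Rel.prems by (auto simp: tuples_def)
  \<comment> \<open>The bit lies before the end marker of the numeral, since the blocks fill the
    string exactly.\<close>
  have "block_start ar (lead x) i + idx (lead x) ?xs < length x"
    using idx_less[OF xs] block_start_le[OF i, of "lead x"] x by (simp add: well_formed_def)
  hence "holds (Bit (Add (BlockE i) (IdxE xs))) (string_num x) r \<longleftrightarrow> ?xs \<in> decode_rels ar x ! i"
    using string_num_bit[of _ x] i xs Rel.prems(1) by (simp add: decode_rels_def)
  thus ?case by (auto simp del: ev.simps(7))
next
  case (SetVar xs)
  thus ?case by (simp add: holds_MemberE holds_NonmemberE)
next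
  case (Neg \<phi>)
  thus ?case using Neg.IH[of r "\<not> b"] by simp
next
  case (Conj \<phi> \<psi>)
  thus ?case using Conj.IH(1)[of r b] Conj.IH(2)[of r b]
    by simp
next
  case (Disj \<phi> \<psi>)
  thus ?case using Disj.IH(1)[of r b] Disj.IH(2)[of r b]
    by simp
next
  case (Ex y \<phi>)
  have "holds (FormulaE b (Ex y \<phi>)) (string_num x) r \<longleftrightarrow>
      b \<and> (\<exists>a<lead x. holds (FormulaE b \<phi>) (string_num x) (r(20 + y := a)))"
    using Ex.prems(1) by simp
  moreover have "holds (FormulaE b \<phi>) (string_num x) (r(20 + y := a)) \<longleftrightarrow>
    forces (\<lambda>xs. member_cert D (lead x ^ s) (r 15) (idx (lead x) xs))
      (\<lambda>xs. nonmember_cert D (r 0) (lead x ^ s) (r 14) (r 15) (idx (lead x) xs))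
      (lead x) (decode_rels ar x) b ((\<lambda>i. r (20 + i))(y := a)) \<phi>" if "a < lead x" for a
  proof -
    let ?r = "r(20 + y := a)"
    have "(\<lambda>i. ?r (20 + i)) = (\<lambda>i. r (20 + i))(y := a)" by auto
    moreover have "?r 0 = r 0" "?r 4 = lead x" "?r 14 = r 14" "?r 15 = r 15"
        "fo_wf ar s \<phi>" "\<forall>i. ?r (20 + i) < lead x"
      using Ex.prems that by auto
    ultimately show ?thesis
      using Ex.IH[of ?r b] by (simp only: simp_thms)
  qed
  ultimately show ?case unfolding forces.simps by blast
qed auto

primrec BindsE :: "nat \<Rightarrow> bexp \<Rightarrow> bexp" where
  "BindsE 0 b = b"
| "BindsE (Suc i) b = BindsE i (Bind (20 + i) (DigitE (Var 4) (Var 19) i) b)"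

lemma ev_BindsE:
  "ev (BindsE i b) x r =
     ev b x (\<lambda>v. if 20 \<le> v \<and> v < 20 + i then dg (r 4) (r 19) (v - 20) else r v)"
proof (induction i arbitrary: b)
  case (Suc i)
  let ?r = "\<lambda>v. if 20 \<le> v \<and> v < 20 + i then dg (r 4) (r 19) (v - 20) else r v"
  have "ev (BindsE (Suc i) b) x r = ev b x (?r(20 + i := dg (r 4) (r 19) i))"
    using Suc[of "Bind (20 + i) (DigitE (Var 4) (Var 19) i) b"] by simp
  also have "?r(20 + i := dg (r 4) (r 19) i) =
      (\<lambda>v. if 20 \<le> v \<and> v < 20 + Suc i then dg (r 4) (r 19) (v - 20) else r v)"
    by (auto simp: fun_eq_iff)
  finally show ?case .
next
  case 0
  have "(\<lambda>v. if 20 \<le> v \<and> v < 20 + 0 then dg (r 4) (r 19) (v - 20) else r v) = r"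
    by (auto simp: fun_eq_iff)
  thus ?case by (simp only: BindsE.simps)
qed

text \<open>Formula variables from \<open>m\<close> on keep the value 0 from the environment, which
  is also the default of \<open>digit_env\<close>.\<close>

lemma holds_BindsE_FormulaE:
  assumes x: "well_formed ar x" and r: "r 4 = lead x" "\<forall>i\<ge>20. r i = 0"
  shows "holds (BindsE m (FormulaE True \<chi>)) (string_num x) r \<longleftrightarrow>
    item_forces D s m (r 0) (lead x) (decode_rels ar x) \<chi> (r 19) (r 14) (r 15)"
proof -
  let ?r = "\<lambda>v. if 20 \<le> v \<and> v < 20 + m then dg (r 4) (r 19) (v - 20) else r v"
  have eq: "(\<lambda>i. ?r (20 + i)) = digit_env (lead x) m (r 19)"
    using r by (auto simp: fun_eq_iff digit_env_def)
  have "0 < lead x" using x by (simp add: well_formed_def)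
  hence "\<forall>i. ?r (20 + i) < lead x"
    using fun_cong[OF eq] digit_env_less[of "lead x"] by simp
  from holds_FormulaE[OF x _ wf this, of True] show ?thesis
    using r(1) unfolding ev_BindsE eq item_forces_def by simp
qed

text \<open>\<open>LeadE\<close> is tested separately because variable 4 holds 1 also when the unary
  prefix is empty.\<close>

definition WellFormedE :: bexp where
  "WellFormedE = AndE LeadE (EqE (Var 1) (BlockE (length ar)))"

definition HitE :: bexp where
  "HitE = Bind 14 (ModE (Var 13) KE) (Bind 15 (Quo (Var 13) KE)
    (Bind 16 (ModE (Quo (Var 12) (Num 2)) KE)
    (Bind 17 (ModE (Quo (Quo (Quo (Var 12) (Num 2)) KE) KE) VE)
    (Bind 18 (ModE (Quo (Quo (Var 12) (Num 2)) KE) KE)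
    (Bind 19 (Quo (Quo (Quo (Quo (Var 12) (Num 2)) KE) KE) VE)
    (AndE WellFormedE (AndE OkE (OrE
      (AndE (EqE (ModE (Var 12) (Num 2)) (Num 0))
        (OrE (AndE (EqE (Var 14) (Var 16)) (NotE (EqE (Var 15) (Var 17))))
          (AndE (EqE (Var 14) (Var 18)) ConsE)))
      (AndE (NotE (EqE (ModE (Var 12) (Num 2)) (Num 0))) (BindsE m (FormulaE True \<chi>)))))))))))"

lemma holds_HitE:
  assumes r: "r 1 = length x" "r 4 = univ x" "\<forall>i\<ge>20. r i = 0"
  shows "holds HitE (string_num x) r \<longleftrightarrow> hit x (r 0) (r 12) (r 13)"
proof (cases "well_formed ar x")
  case False
  have "\<not> holds WellFormedE (string_num x) r'" if "r' 1 = length x" "r' 4 = univ x" for r'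
  proof (cases "lead x = 0")
    case True
    thus ?thesis using that ev_LeadE[of r' x] by (simp add: WellFormedE_def)
  next
    case False
    hence "univ x = lead x" by (simp add: univ_def)
    thus ?thesis using that False \<open>\<not> well_formed ar x\<close>
      by (auto simp: WellFormedE_def well_formed_def)
  qed
  thus ?thesis using False r by (simp add: HitE_def hit_def)
next
  case True
  hence u: "univ x = lead x" by (simp add: well_formed_def univ_def)
  define r' where "r' = r(14 := r 13 mod K (r 0), 15 := r 13 div K (r 0),
     16 := r 12 div 2 mod K (r 0),
     17 := r 12 div 2 div K (r 0) div K (r 0) mod V x,
     18 := r 12 div 2 div K (r 0) mod K (r 0),
     19 := r 12 div 2 div K (r 0) div K (r 0) div V x)"
  have r': "r' 0 = r 0" "r' 1 = length x" "r' 4 = lead x" "\<forall>i\<ge>20. r' i = 0" "r' 12 = r 12"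
      "r' 14 = r 13 mod K (r 0)" "r' 15 = r 13 div K (r 0)"
    and cl: "r' 16 = r 12 div 2 mod K (r 0)"
      "r' 17 = r 12 div 2 div K (r 0) div K (r 0) mod V x"
      "r' 18 = r 12 div 2 div K (r 0) mod K (r 0)"
      "r' 19 = r 12 div 2 div K (r 0) div K (r 0) div V x"
    using r u by (auto simp: r'_def)
  have "holds WellFormedE (string_num x) r'"
    using True r' ev_LeadE[of r' x] by (simp add: WellFormedE_def well_formed_def)
  moreover have "holds HitE (string_num x) r \<longleftrightarrow> holds (AndE WellFormedE (AndE OkE (OrE
      (AndE (EqE (ModE (Var 12) (Num 2)) (Num 0))
        (OrE (AndE (EqE (Var 14) (Var 16)) (NotE (EqE (Var 15) (Var 17))))
          (AndE (EqE (Var 14) (Var 18)) ConsE)))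
      (AndE (NotE (EqE (ModE (Var 12) (Num 2)) (Num 0))) (BindsE m (FormulaE True \<chi>))))))
      (string_num x) r'"
    unfolding HitE_def r'_def K_def V_def r(2)[symmetric] holds_Bind by simp
  moreover have "hit x (r 0) (r 12) (r 13) \<longleftrightarrow> guess_clause D (r 0) (lead x ^ s)
      (item_forces D s m (r 0) (lead x) (decode_rels ar x) \<chi>) (r' 12 mod 2) (r' 16) (r' 18) (r' 17) (r' 19)
      (r' 14) (r' 15)"
    using True unfolding hit_def guess_hit_def Let_def r'(5-7) cl K_def V_def u by simp
  ultimately show ?thesis
    using holds_BindsE_FormulaE[OF True r'(3,4)] r'(1,3)
    by (simp add: holds_OkE holds_ConsE guess_clause_def)
qed

section \<open>The bits of the Steiner tree instance as expressions\<close>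

definition CellE :: bexp where
  "CellE = OrE (AndE (NotE (Var 8)) (AndE (NotE (Var 9)) (AndE (NotE (Var 10)) (Var 11))))
    (OrE (AndE (NotE (Var 8)) (AndE (Var 9) (AndE (Var 10) (AndE (EqE (Var 11) (Var 9))
        (Bind 12 (Sub (Var 10) (Num 1)) (Bind 13 (Sub (Var 9) (Num 1)) HitE))))))
      (AndE (Var 8) (AndE (EqE (Var 8) (Var 10))
        (OrE (AndE (NotE (Var 9)) (Var 11)) (AndE (Var 9) (NotE (Var 11)))))))"

lemma holds_CellE:
  assumes r: "r 1 = length x" "r 4 = univ x" "\<forall>i\<ge>20. r i = 0"
  shows "holds CellE (string_num x) r \<longleftrightarrow> cell_arc (hit x (r 0)) (r 8) (r 9) (r 10) (r 11)"
  unfolding CellE_def holds_OrE holds_AndE holds_Bind holds_NotE holds_EqE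
  using r by (auto simp: cell_arc_def holds_HitE)

definition ArcE :: bexp where
  "ArcE = (let p = Sub (Var 2) (Add (Var 7) (Num 1)); w = Add (Var 6) (Num 1) in
     Bind 8 (Quo (Quo p (Var 7)) w) (Bind 9 (ModE (Quo p (Var 7)) w)
    (Bind 10 (Quo (ModE p (Var 7)) w) (Bind 11 (ModE (ModE p (Var 7)) w) CellE))))"

text \<open>Adding the negation turns a vanishing \<open>lead\<close> into 1, which gives
  \<open>univ\<close>.\<close>

definition HeaderE :: "bexp \<Rightarrow> bexp" where
  "HeaderE b = Bind 4 (Add LeadE (NotE LeadE))
    (Bind 5 (Mul (Num 2) (Mul KE (Mul KE (Mul VE (PowE (Var 4) m)))))
    (Bind 6 (Mul KE VE) (Bind 7 (Mul (Add (Var 5) (Num 1)) (Add (Var 6) (Num 1))) b)))"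

lemma ev_HeaderE:
  assumes "r 1 = length x" "r 0 = k"
  shows "ev (HeaderE b) (string_num x) r =
    ev b (string_num x) (r(4 := univ x, 5 := clauses x k, 6 := items x k, 7 := size x k))"
proof -
  have "ev (Add LeadE (NotE LeadE)) (string_num x) r = univ x"
    using ev_LeadE[of r x] assms by (simp add: ev_NotE univ_def)
  thus ?thesis
    unfolding HeaderE_def ev.simps(9) using assms
    by (simp add: clauses_def items_def size_def K_def V_def del: mult_Suc mult_Suc_right)
qed

definition MatrixEndE :: bexp where
  "MatrixEndE = Add (Add (Var 7) (Num 1)) (Mul (Var 7) (Var 7))"

definition LengthE :: bexp where
  "LengthE = HeaderE (Add (Add MatrixEndE (Var 7)) (Var 7))"

text \<open>The root is vertex 0, so its block has a single one, in its first position. The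
  terminals are all vertices above the number of items, so their block ends in ones only.\<close>

definition BodyE :: bexp where
  "BodyE = OrE (LessE (Var 2) (Var 7))
    (OrE (AndE (LessE (Var 7) (Var 2)) (AndE (LessE (Var 2) MatrixEndE) ArcE))
      (OrE (EqE (Var 2) MatrixEndE) (LessE (Add (Add MatrixEndE (Var 7)) (Var 6)) (Var 2))))"

definition BitE :: bexp where "BitE = HeaderE BodyE"

lemma ev_LengthE:
  "ev LengthE (string_num x) (input_env x k) = Suc (size x k) + size x k * size x k + size x k + size x k"
  unfolding LengthE_def by (subst ev_HeaderE[where k = k]) (auto simp: input_env_def MatrixEndE_def)

lemma holds_BitE:
  assumes j: "j < Suc (size x k) + size x k * size x k + size x k + size x k"
  shows "holds BitE (string_num x) ((input_env x k)(2 := j)) \<longleftrightarrow>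
    dst_bit (size x k) (graph x k) 0 (terminals x k) j"
proof -
  define r where "r = (input_env x k)(2 := j, 4 := univ x, 5 := clauses x k, 6 := items x k, 7 := size x k)"
  let ?N = "size x k" and ?W = "Suc (items x k)"
  let ?u = "(j - Suc ?N) div ?N" and ?v = "(j - Suc ?N) mod ?N"
  have r: "r 0 = k" "r 1 = length x" "r 2 = j" "r 4 = univ x" "r 6 = items x k" "r 7 = ?N" "\<forall>i\<ge>20. r i = 0"
    by (auto simp: r_def input_env_def)
  have pos: "0 < ?N" by (simp add: size_def)
  have me: "ev MatrixEndE (string_num x) r = Suc ?N + ?N * ?N"
    using r by (simp add: MatrixEndE_def)
  have arc: "holds ArcE (string_num x) r \<longleftrightarrow>
      cell_arc (hit x k) (?u div ?W) (?u mod ?W) (?v div ?W) (?v mod ?W)"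
    unfolding ArcE_def Let_def holds_Bind
    by (subst holds_CellE) (use r in auto)
  have arc': "(?u, ?v) \<in> parcs (graph x k) \<longleftrightarrow> holds ArcE (string_num x) r"
    if "?N < j" "j < Suc ?N + ?N * ?N"
  proof -
    have "?u < ?N" using that by (intro less_mult_imp_div_less) simp
    moreover have "?v < ?N" using pos by simp
    ultimately show ?thesis
      unfolding arc graph_def parcs_hs_digraph size_def[symmetric] by simp
  qed
  have "ev BitE (string_num x) ((input_env x k)(2 := j)) = ev BodyE (string_num x) r"
    unfolding BitE_def r_def by (rule ev_HeaderE) (simp_all add: input_env_def)
  hence "holds BitE (string_num x) ((input_env x k)(2 := j)) \<longleftrightarrow> j < ?N \<or>
      (?N < j \<and> j < Suc ?N + ?N * ?N \<and> holds ArcE (string_num x) r) \<or>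
      j = Suc ?N + ?N * ?N \<or> Suc ?N + ?N * ?N + ?N + items x k < j"
    by (simp add: BodyE_def me r)
  also have "\<dots> \<longleftrightarrow> dst_bit ?N (graph x k) 0 (terminals x k) j"
    unfolding dst_bit_def terminals_def hs_terminals_def size_def[symmetric]
    using arc' j pos by auto
  finally show ?thesis .
qed

lemma poly_time_red: "poly_time_reduction red"
proof -
  \<comment> \<open>Double negation normalises the truth value to a binary digit.\<close>
  let ?bt = "NotE (NotE BitE)"
  have "ev ?bt x r \<le> 1" for x r by (simp add: ev_NotE)
  from output_prog_correct[of ?bt LengthE KE, OF this] obtain c q where c: "\<And>x k st. st 0 = string_num x \<Longrightarrow> st 1 = k \<Longrightarrow>
     runs c st ((length x + k + 2) ^ q)
       (\<lambda>s'. s' 0 = string_num (map (\<lambda>j. ev ?bt (string_num x) ((input_env x k)(2 := j)) \<noteq> 0)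
              [0..<ev LengthE (string_num x) (input_env x k)]) \<and>
          s' 1 = ev KE (string_num x) (input_env x k))"
    by blast
  have "map (\<lambda>j. ev ?bt (string_num x) ((input_env x k)(2 := j)) \<noteq> 0)
      [0..<ev LengthE (string_num x) (input_env x k)] = fst (red (x, k))" for x k
    unfolding red_def prod.case fst_conv dst_string_bits ev_LengthE map_eq_conv neq0_conv
    using holds_BitE[of _ x k] by (simp del: upt_Suc)
  moreover have "ev KE (string_num x) (input_env x k) = snd (red (x, k))" for x k
    by (simp add: red_def K_def input_env_def)
  ultimately have "runs c st ((length x + k + 2) ^ q)
      (\<lambda>s'. s' 0 = string_num (fst (red (x, k))) \<and> s' 1 = snd (red (x, k)))"
    if "st 0 = string_num x" "st 1 = k" for x k st
    using c[OF that] by simp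
  thus ?thesis
    unfolding poly_time_reduction_def by (intro exI[of _ c] exI[of _ q] allI impI)
qed

lemma snd_red: "snd (red (x, k)) \<le> (k + 2) ^ D"
  by (simp add: red_def K_def)

end

lemma fo_wf_prefix: "fo_wf ar s (foldr All ys \<chi>) \<longleftrightarrow> fo_wf ar s \<chi>"
  by (induction ys) auto

theorem theorem4:
  shows "W_hard_on 2 DST (DST_degenerate_instances 2)"
  unfolding W_hard_on_def
proof
  fix L assume "L \<in> W 2"
  then obtain ar s \<phi> R where \<phi>: "fo_wf ar s \<phi>" "fo_free \<phi> = {}" "Pi_fo 2 \<phi>"
      and R: "fpt_reduction R L (WD ar s \<phi>)"
    unfolding W_def by blast
  obtain ys \<chi> where \<chi>: "\<phi> = foldr All ys \<chi>" "Sigma_fo (Suc 0) \<chi>"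
    using Pi_2_prefix[OF \<phi>(3)] by blast
  obtain m where m: "fo_free \<chi> \<subseteq> {..<m}"
    using finite_fo_free[of \<chi>] finite_nat_bounded by blast
  interpret wd_problem ar s m \<chi>
    using \<phi>(1) \<chi> m by unfold_locales (simp_all add: fo_wf_prefix)
  \<comment> \<open>The given reduction to weighted definability is followed by \<open>red\<close>;
    every produced instance thus lies in the range of \<open>red\<close>.\<close>
  have "fpt_reduction (\<lambda>I. red (R I)) L DST"
    using R unfolding \<chi>(1)
    by (rule fpt_reduction_comp)
      (use red_correct[OF \<phi>(2)[unfolded \<chi>(1)]] poly_time_red snd_red in blast)+
  moreover have "range (\<lambda>I. red (R I)) \<subseteq> DST_degenerate_instances 2"
    using red_degenerate by blast
  ultimately show "\<exists>R. fpt_reduction R L DST \<and> range R \<subseteq> DST_degenerate_instances 2"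
    by blast
qed

end
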